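(* Over $\mathsf{RCA}_0$ the following are equivalent: (1) $\mathsf{ACA}_0$; (2) every pre-Eulerian graph has an Euler path; (3) every locally finite pre-Eulerian graph has an Euler path.
   Context: Work in second-order arithmetic, whose number variables range over $\mathbb{N}$ and set variables over subsets of $\mathbb{N}$; finite sequences, functions, graphs, etc. are coded by sets of natural numbers in the standard way. $\mathsf{RCA}_0$ is the subsystem consisting of the basic axioms of Peano arithmetic, induction restricted to $\Sigma^0_1$ formulas, and recursive comprehension (any set definable by both a $\Sigma^0_1$ formula and a $\Pi^0_1$ formula, with set parameters, exists). $\mathsf{ACA}_0$ is $\mathsf{RCA}_0$ together with arithmetical comprehension: every set definable by a formula with no set quantifiers (set parameters allowed) exists. A graph $G=\langle V,E\rangle$ has vertex set $V\subseteq\mathbb{N}$ and edge set $E$ a set of unordered pairs of elements of $V$. $G$ is locally finite if for each vertex $v$ the set $\{u\in V:(v,u)\in E\}$ is finite. A path in $G$ is a sequence of vertices $v_0,v_1,v_2,\dots$ (indexed by $\mathbb{N}$) such that $(v_i,v_{i+1})\in E$ for every $i$; it is an Euler path if it uses every edge of $G$ exactly once. For a subgraph $H$ of $G$, $G-H$ is the graph obtained from $G$ by deleting the edges of $H$. $G$ is pre-Eulerian if (1) $G$ is connected, (2) $G$ has at most one vertex of odd degree, (3) if $G$ has no vertex of odd degree then it has at least one vertex of infinite degree, and (4) for every finite subgraph $H$ of $G$, $G-H$ has exactly one infinite connected component. *)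

theory Defs
  imports Main
begin

section \<open>The language of second-order arithmetic\<close>

datatype tm = NVar nat | Zero | One | Plus tm tm | Times tm tm

text \<open>Number variables and set variables are two separate supplies, both named by \<^typ>\<open>nat\<close>.\<close>

datatype fm =
    Eq tm tm
  | Less tm tm
  | Mem tm nat
  | Neg fm
  | Conj fm fm
  | Disj fm fm
  | Imp fm fm
  | AllN nat fm
  | ExN nat fm
  | AllS nat fm
  | ExS nat fm

fun tm_vars :: "tm \<Rightarrow> nat set" where
  "tm_vars (NVar x) = {x}"
| "tm_vars Zero = {}"
| "tm_vars One = {}"
| "tm_vars (Plus s t) = tm_vars s \<union> tm_vars t"
| "tm_vars (Times s t) = tm_vars s \<union> tm_vars t"

inductive bounded_fm :: "fm \<Rightarrow> bool" where
  "bounded_fm (Eq s t)"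
| "bounded_fm (Less s t)"
| "bounded_fm (Mem t X)"
| "bounded_fm \<phi> \<Longrightarrow> bounded_fm (Neg \<phi>)"
| "bounded_fm \<phi> \<Longrightarrow> bounded_fm \<psi> \<Longrightarrow> bounded_fm (Conj \<phi> \<psi>)"
| "bounded_fm \<phi> \<Longrightarrow> bounded_fm \<psi> \<Longrightarrow> bounded_fm (Disj \<phi> \<psi>)"
| "bounded_fm \<phi> \<Longrightarrow> bounded_fm \<psi> \<Longrightarrow> bounded_fm (Imp \<phi> \<psi>)"
| "bounded_fm \<phi> \<Longrightarrow> x \<notin> tm_vars t \<Longrightarrow> bounded_fm (AllN x (Imp (Less (NVar x) t) \<phi>))"
| "bounded_fm \<phi> \<Longrightarrow> x \<notin> tm_vars t \<Longrightarrow> bounded_fm (ExN x (Conj (Less (NVar x) t) \<phi>))"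

definition Sigma01 :: "fm \<Rightarrow> bool" where
  "Sigma01 \<phi> \<longleftrightarrow> (\<exists>x \<theta>. bounded_fm \<theta> \<and> \<phi> = ExN x \<theta>)"

definition Pi01 :: "fm \<Rightarrow> bool" where
  "Pi01 \<phi> \<longleftrightarrow> (\<exists>x \<theta>. bounded_fm \<theta> \<and> \<phi> = AllN x \<theta>)"

fun arithmetical :: "fm \<Rightarrow> bool" where
  "arithmetical (Eq s t) \<longleftrightarrow> True"
| "arithmetical (Less s t) \<longleftrightarrow> True"
| "arithmetical (Mem t X) \<longleftrightarrow> True"
| "arithmetical (Neg \<phi>) \<longleftrightarrow> arithmetical \<phi>"
| "arithmetical (Conj \<phi> \<psi>) \<longleftrightarrow> arithmetical \<phi> \<and> arithmetical \<psi>"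
| "arithmetical (Disj \<phi> \<psi>) \<longleftrightarrow> arithmetical \<phi> \<and> arithmetical \<psi>"
| "arithmetical (Imp \<phi> \<psi>) \<longleftrightarrow> arithmetical \<phi> \<and> arithmetical \<psi>"
| "arithmetical (AllN x \<phi>) \<longleftrightarrow> arithmetical \<phi>"
| "arithmetical (ExN x \<phi>) \<longleftrightarrow> arithmetical \<phi>"
| "arithmetical (AllS X \<phi>) \<longleftrightarrow> False"
| "arithmetical (ExS X \<phi>) \<longleftrightarrow> False"


section \<open>Structures and satisfaction\<close>

text \<open>
  Structures are Henkin structures: number variables range over the whole type \<^typ>\<open>'a\<close>, whose
  elements may be nonstandard numbers, and set variables range over \<open>Sets M\<close> only.  As usual in
  first-order logic both domains have to be nonempty; for \<open>Sets M\<close> this is \<open>L2_structure\<close>.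
\<close>

record 'a L2 =
  zer :: 'a
  one :: 'a
  add :: "'a \<Rightarrow> 'a \<Rightarrow> 'a"
  mul :: "'a \<Rightarrow> 'a \<Rightarrow> 'a"
  lt :: "'a \<Rightarrow> 'a \<Rightarrow> bool"
  Sets :: "'a set set"

definition L2_structure :: "'a L2 \<Rightarrow> bool" where
  "L2_structure M \<longleftrightarrow> Sets M \<noteq> {}"

fun tm_val :: "'a L2 \<Rightarrow> (nat \<Rightarrow> 'a) \<Rightarrow> tm \<Rightarrow> 'a" where
  "tm_val M e (NVar x) = e x"
| "tm_val M e Zero = zer M"
| "tm_val M e One = one M"
| "tm_val M e (Plus s t) = add M (tm_val M e s) (tm_val M e t)"
| "tm_val M e (Times s t) = mul M (tm_val M e s) (tm_val M e t)"

fun sat :: "'a L2 \<Rightarrow> (nat \<Rightarrow> 'a) \<Rightarrow> (nat \<Rightarrow> 'a set) \<Rightarrow> fm \<Rightarrow> bool" where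
  "sat M e S (Eq s t) \<longleftrightarrow> tm_val M e s = tm_val M e t"
| "sat M e S (Less s t) \<longleftrightarrow> lt M (tm_val M e s) (tm_val M e t)"
| "sat M e S (Mem t X) \<longleftrightarrow> tm_val M e t \<in> S X"
| "sat M e S (Neg \<phi>) \<longleftrightarrow> \<not> sat M e S \<phi>"
| "sat M e S (Conj \<phi> \<psi>) \<longleftrightarrow> sat M e S \<phi> \<and> sat M e S \<psi>"
| "sat M e S (Disj \<phi> \<psi>) \<longleftrightarrow> sat M e S \<phi> \<or> sat M e S \<psi>"
| "sat M e S (Imp \<phi> \<psi>) \<longleftrightarrow> (sat M e S \<phi> \<longrightarrow> sat M e S \<psi>)"
| "sat M e S (AllN x \<phi>) \<longleftrightarrow> (\<forall>a. sat M (e(x := a)) S \<phi>)"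
| "sat M e S (ExN x \<phi>) \<longleftrightarrow> (\<exists>a. sat M (e(x := a)) S \<phi>)"
| "sat M e S (AllS X \<phi>) \<longleftrightarrow> (\<forall>A\<in>Sets M. sat M e (S(X := A)) \<phi>)"
| "sat M e S (ExS X \<phi>) \<longleftrightarrow> (\<exists>A\<in>Sets M. sat M e (S(X := A)) \<phi>)"


section \<open>Subsystems of second-order arithmetic\<close>

definition basic_axioms :: "'a L2 \<Rightarrow> bool" where
  "basic_axioms M \<longleftrightarrow>
     (\<forall>n. add M n (one M) \<noteq> zer M) \<and>
     (\<forall>m n. add M m (one M) = add M n (one M) \<longrightarrow> m = n) \<and>
     (\<forall>m. add M m (zer M) = m) \<and>
     (\<forall>m n. add M m (add M n (one M)) = add M (add M m n) (one M)) \<and>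
     (\<forall>m. mul M m (zer M) = zer M) \<and>
     (\<forall>m n. mul M m (add M n (one M)) = add M (mul M m n) m) \<and>
     (\<forall>m. \<not> lt M m (zer M)) \<and>
     (\<forall>m n. lt M m (add M n (one M)) \<longleftrightarrow> lt M m n \<or> m = n)"

text \<open>
  The schemes range over all formulas of the given class, and over all values \<open>e\<close>, \<open>S\<close> of their
  number and set parameters.  The set asserted to exist by a comprehension axiom cannot be a
  parameter of the defining formula, since no variable names it.
\<close>

definition Sigma01_induction :: "'a L2 \<Rightarrow> bool" where
  "Sigma01_induction M \<longleftrightarrow>
     (\<forall>\<phi> x e S. Sigma01 \<phi> \<and> range S \<subseteq> Sets M \<and>
        sat M (e(x := zer M)) S \<phi> \<and>
        (\<forall>n. sat M (e(x := n)) S \<phi> \<longrightarrow> sat M (e(x := add M n (one M))) S \<phi>)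
        \<longrightarrow> (\<forall>n. sat M (e(x := n)) S \<phi>))"

definition recursive_comprehension :: "'a L2 \<Rightarrow> bool" where
  "recursive_comprehension M \<longleftrightarrow>
     (\<forall>\<phi> \<psi> x e S. Sigma01 \<phi> \<and> Pi01 \<psi> \<and> range S \<subseteq> Sets M \<and>
        (\<forall>n. sat M (e(x := n)) S \<phi> \<longleftrightarrow> sat M (e(x := n)) S \<psi>)
        \<longrightarrow> {n. sat M (e(x := n)) S \<phi>} \<in> Sets M)"

definition arithmetical_comprehension :: "'a L2 \<Rightarrow> bool" where
  "arithmetical_comprehension M \<longleftrightarrow>
     (\<forall>\<phi> x e S. arithmetical \<phi> \<and> range S \<subseteq> Sets M
        \<longrightarrow> {n. sat M (e(x := n)) S \<phi>} \<in> Sets M)"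

definition RCA0 :: "'a L2 \<Rightarrow> bool" where
  "RCA0 M \<longleftrightarrow> basic_axioms M \<and> Sigma01_induction M \<and> recursive_comprehension M"

definition ACA0 :: "'a L2 \<Rightarrow> bool" where
  "ACA0 M \<longleftrightarrow> RCA0 M \<and> arithmetical_comprehension M"


section \<open>Graphs inside a structure\<close>

text \<open>
  The notions below are the interpretations in \<open>M\<close> of formulas of second-order arithmetic: every
  quantifier over numbers ranges over \<^typ>\<open>'a\<close>, and every quantifier over sets (hence over
  functions, finite sequences and graphs) is restricted to \<open>Sets M\<close>.  In particular finiteness,
  cardinality and reachability are meant in the sense of \<open>M\<close>.

  Pairs are coded by \<open>(i, j) = (i + j)\<^sup>2 + i\<close>.
\<close>

definition pair :: "'a L2 \<Rightarrow> 'a \<Rightarrow> 'a \<Rightarrow> 'a" where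
  "pair M i j = add M (mul M (add M i j) (add M i j)) i"

definition finite_in :: "'a L2 \<Rightarrow> 'a set \<Rightarrow> bool" where
  "finite_in M X \<longleftrightarrow> (\<exists>b. \<forall>x\<in>X. lt M x b)"

definition total_fun :: "'a L2 \<Rightarrow> 'a set \<Rightarrow> bool" where
  "total_fun M F \<longleftrightarrow>
     (\<forall>x\<in>F. \<exists>i w. x = pair M i w) \<and> (\<forall>i. \<exists>!w. pair M i w \<in> F)"

text \<open>A finite sequence of length \<open>l\<close> is a function on \<open>{i. i < l}\<close>.\<close>

definition fin_seq :: "'a L2 \<Rightarrow> 'a set \<Rightarrow> 'a \<Rightarrow> bool" where
  "fin_seq M F l \<longleftrightarrow>
     (\<forall>x\<in>F. \<exists>i w. lt M i l \<and> x = pair M i w) \<and>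
     (\<forall>i. lt M i l \<longrightarrow> (\<exists>!w. pair M i w \<in> F))"

definition has_card :: "'a L2 \<Rightarrow> 'a set \<Rightarrow> 'a \<Rightarrow> bool" where
  "has_card M X n \<longleftrightarrow>
     (\<exists>F\<in>Sets M. fin_seq M F n \<and>
        (\<forall>i u. pair M i u \<in> F \<longrightarrow> u \<in> X) \<and>
        (\<forall>u\<in>X. \<exists>!i. pair M i u \<in> F))"

text \<open>
  A set of unordered pairs \<open>{u, v}\<close> (with \<open>u \<noteq> v\<close>) is coded by the set containing both
  \<open>(u, v)\<close> and \<open>(v, u)\<close> for each of them.
\<close>

definition graph :: "'a L2 \<Rightarrow> 'a set \<Rightarrow> 'a set \<Rightarrow> bool" where
  "graph M V E \<longleftrightarrow> V \<in> Sets M \<and> E \<in> Sets M \<and>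
     (\<forall>x\<in>E. \<exists>u v. x = pair M u v) \<and>
     (\<forall>u v. pair M u v \<in> E \<longrightarrow> u \<in> V \<and> v \<in> V \<and> u \<noteq> v \<and> pair M v u \<in> E)"

definition nbrs :: "'a L2 \<Rightarrow> 'a set \<Rightarrow> 'a set \<Rightarrow> 'a \<Rightarrow> 'a set" where
  "nbrs M V E v = {u \<in> V. pair M v u \<in> E}"

definition locally_finite :: "'a L2 \<Rightarrow> 'a set \<Rightarrow> 'a set \<Rightarrow> bool" where
  "locally_finite M V E \<longleftrightarrow> (\<forall>v\<in>V. finite_in M (nbrs M V E v))"

definition infinite_degree :: "'a L2 \<Rightarrow> 'a set \<Rightarrow> 'a set \<Rightarrow> 'a \<Rightarrow> bool" where
  "infinite_degree M V E v \<longleftrightarrow> \<not> finite_in M (nbrs M V E v)"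

definition odd_degree :: "'a L2 \<Rightarrow> 'a set \<Rightarrow> 'a set \<Rightarrow> 'a \<Rightarrow> bool" where
  "odd_degree M V E v \<longleftrightarrow> (\<exists>k. has_card M (nbrs M V E v) (add M (add M k k) (one M)))"

definition joined :: "'a L2 \<Rightarrow> 'a set \<Rightarrow> 'a set \<Rightarrow> 'a \<Rightarrow> 'a \<Rightarrow> bool" where
  "joined M V E u v \<longleftrightarrow> u \<in> V \<and> v \<in> V \<and>
     (\<exists>n. \<exists>F\<in>Sets M. fin_seq M F (add M n (one M)) \<and>
        pair M (zer M) u \<in> F \<and> pair M n v \<in> F \<and>
        (\<forall>i w w'. lt M i n \<and> pair M i w \<in> F \<and> pair M (add M i (one M)) w' \<in> F
           \<longrightarrow> pair M w w' \<in> E))"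

definition connected_graph :: "'a L2 \<Rightarrow> 'a set \<Rightarrow> 'a set \<Rightarrow> bool" where
  "connected_graph M V E \<longleftrightarrow> (\<forall>u\<in>V. \<forall>v\<in>V. joined M V E u v)"

text \<open>
  A connected component is a definable class that need not belong to \<open>Sets M\<close>, so components are
  referred to through their vertices.
\<close>

definition component :: "'a L2 \<Rightarrow> 'a set \<Rightarrow> 'a set \<Rightarrow> 'a \<Rightarrow> 'a set" where
  "component M V E v = {u. joined M V E v u}"

definition one_infinite_component :: "'a L2 \<Rightarrow> 'a set \<Rightarrow> 'a set \<Rightarrow> bool" where
  "one_infinite_component M V E \<longleftrightarrow>
     (\<exists>v\<in>V. \<not> finite_in M (component M V E v) \<and>
        (\<forall>w\<in>V. \<not> finite_in M (component M V E w)
           \<longrightarrow> component M V E w = component M V E v))"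

definition finite_subgraph ::
  "'a L2 \<Rightarrow> 'a set \<Rightarrow> 'a set \<Rightarrow> 'a set \<Rightarrow> 'a set \<Rightarrow> bool" where
  "finite_subgraph M V' E' V E \<longleftrightarrow>
     graph M V' E' \<and> V' \<subseteq> V \<and> E' \<subseteq> E \<and> finite_in M V' \<and> finite_in M E'"

definition pre_Eulerian :: "'a L2 \<Rightarrow> 'a set \<Rightarrow> 'a set \<Rightarrow> bool" where
  "pre_Eulerian M V E \<longleftrightarrow>
     graph M V E \<and>
     connected_graph M V E \<and>
     (\<forall>u\<in>V. \<forall>v\<in>V. odd_degree M V E u \<and> odd_degree M V E v \<longrightarrow> u = v) \<and>
     ((\<forall>v\<in>V. \<not> odd_degree M V E v) \<longrightarrow> (\<exists>v\<in>V. infinite_degree M V E v)) \<and>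
     (\<forall>V'\<in>Sets M. \<forall>E'\<in>Sets M. finite_subgraph M V' E' V E
        \<longrightarrow> one_infinite_component M V (E - E'))"

definition infinite_path :: "'a L2 \<Rightarrow> 'a set \<Rightarrow> 'a set \<Rightarrow> 'a set \<Rightarrow> bool" where
  "infinite_path M V E P \<longleftrightarrow> P \<in> Sets M \<and> total_fun M P \<and>
     (\<forall>i w. pair M i w \<in> P \<longrightarrow> w \<in> V) \<and>
     (\<forall>i w w'. pair M i w \<in> P \<and> pair M (add M i (one M)) w' \<in> P \<longrightarrow> pair M w w' \<in> E)"

text \<open>The \<open>i\<close>-th step of \<open>P\<close> uses the edge \<open>{u, v}\<close>, in either direction.\<close>

definition uses_edge :: "'a L2 \<Rightarrow> 'a set \<Rightarrow> 'a \<Rightarrow> 'a \<Rightarrow> 'a \<Rightarrow> bool" where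
  "uses_edge M P i u v \<longleftrightarrow>
     (pair M i u \<in> P \<and> pair M (add M i (one M)) v \<in> P) \<or>
     (pair M i v \<in> P \<and> pair M (add M i (one M)) u \<in> P)"

definition Euler_path :: "'a L2 \<Rightarrow> 'a set \<Rightarrow> 'a set \<Rightarrow> 'a set \<Rightarrow> bool" where
  "Euler_path M V E P \<longleftrightarrow> infinite_path M V E P \<and>
     (\<forall>u v. pair M u v \<in> E \<longrightarrow> (\<exists>!i. uses_edge M P i u v))"

definition pre_Eulerian_thm :: "'a L2 \<Rightarrow> bool" where
  "pre_Eulerian_thm M \<longleftrightarrow>
     (\<forall>V\<in>Sets M. \<forall>E\<in>Sets M. pre_Eulerian M V E \<longrightarrow> (\<exists>P\<in>Sets M. Euler_path M V E P))"

definition locally_finite_pre_Eulerian_thm :: "'a L2 \<Rightarrow> bool" where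
  "locally_finite_pre_Eulerian_thm M \<longleftrightarrow>
     (\<forall>V\<in>Sets M. \<forall>E\<in>Sets M. locally_finite M V E \<and> pre_Eulerian M V E
        \<longrightarrow> (\<exists>P\<in>Sets M. Euler_path M V E P))"

end

theory Submission
  imports Defs
begin

text \<open>
  Over \<open>RCA\<^sub>0\<close>, arithmetical comprehension amounts to the existence of the domain of every relation coded
  by a set.

  For the reversal, thin the relation out to a partial function, take a ray, and attach to its \<open>(n + 1)\<close>-st
  vertex a triangle for the pair \<open>(n, x)\<close> if there is one.  The graph is locally finite and pre-Eulerian; that
  deleting a finite subgraph leaves the other components bounded needs strong \<open>\<Sigma>\<^sub>1\<close> bounding.  In an
  Euler path the triangle has to be traversed before the path leaves along the ray, because that edge is a
  bridge with a bounded side.  So \<open>n\<close> is not in the domain iff the path crosses the bridge without having seen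
  a triangle, which makes the domain \<open>\<Delta>\<^sub>1\<close>.

  Conversely, let arithmetical comprehension hold and call a finite trail from the odd vertex (or else
  from a vertex of infinite degree) good if the edges it leaves over are connected.  A good trail can be
  extended to a good trail through any given edge \<open>e\<close>: prolong it to a trail through \<open>e\<close>; after deleting that,
  all but one component is finite.  Among the trails with the same end that prolong the given one, contain these edges
  and avoid the infinite component, one with a maximal set of edges is good, since in a finite
  component left over a maximal trail is closed by parity and could be spliced in.  Iterating this along an
  enumeration of the edges gives the Euler path.
\<close>

section \<open>Definable relations\<close>

text \<open>\<open>M\<close> may be nonstandard, so finite means bounded in \<open>M\<close>. HOL's
  own finiteness and cardinality help only for the degrees in the reversal; elsewhere every
  induction has to run inside \<open>M\<close> on a definable predicate. Definability is therefore
  treated as a property of HOL predicates on assignments, with closure lemmas in place of formulas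
  written out by hand. Below arithmetical comprehension only one unbounded quantifier is at hand.
  The beta function is made to fit this: a bounded \<Sigma>1 set is coded as the set of indices
  whose modulus does not divide some \<open>c\<close>, and minimality of \<open>c\<close> yields
  both the code and a common bound for witnesses. Once projections exist, the same codes turn
  quantifiers over finite sets, sequences and walks into number quantifiers, so that parity,
  reachability and goodness become definable. The obstacle in the construction is that a maximal
  trail exists only if the edges available to it are bounded. This is why additions are confined to
  the components other than the infinite one, which moreover survives untouched.\<close>

text \<open>Even-numbered variables carry the arguments of a definable relation and odd-numbered variables its
  number parameters; set parameters of two formulas are interleaved in the same way.\<close>

definition mix :: "(nat \<Rightarrow> 'a) \<Rightarrow> (nat \<Rightarrow> 'a) \<Rightarrow> nat \<Rightarrow> 'a" where
  "mix p e i = (if even i then e (i div 2) else p (i div 2))"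

section \<open>Renaming of variables\<close>

fun ren_tm :: "(nat \<Rightarrow> nat) \<Rightarrow> tm \<Rightarrow> tm" where
  "ren_tm r (NVar x) = NVar (r x)"
| "ren_tm r Zero = Zero"
| "ren_tm r One = One"
| "ren_tm r (Plus s t) = Plus (ren_tm r s) (ren_tm r t)"
| "ren_tm r (Times s t) = Times (ren_tm r s) (ren_tm r t)"

fun ren :: "(nat \<Rightarrow> nat) \<Rightarrow> (nat \<Rightarrow> nat) \<Rightarrow> fm \<Rightarrow> fm" where
  "ren r q (Eq s t) = Eq (ren_tm r s) (ren_tm r t)"
| "ren r q (Less s t) = Less (ren_tm r s) (ren_tm r t)"
| "ren r q (Mem t X) = Mem (ren_tm r t) (q X)"
| "ren r q (Neg \<phi>) = Neg (ren r q \<phi>)"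
| "ren r q (Conj \<phi> \<psi>) = Conj (ren r q \<phi>) (ren r q \<psi>)"
| "ren r q (Disj \<phi> \<psi>) = Disj (ren r q \<phi>) (ren r q \<psi>)"
| "ren r q (Imp \<phi> \<psi>) = Imp (ren r q \<phi>) (ren r q \<psi>)"
| "ren r q (AllN x \<phi>) = AllN (r x) (ren r q \<phi>)"
| "ren r q (ExN x \<phi>) = ExN (r x) (ren r q \<phi>)"
| "ren r q (AllS X \<phi>) = AllS (q X) (ren r q \<phi>)"
| "ren r q (ExS X \<phi>) = ExS (q X) (ren r q \<phi>)"

fun nvars :: "fm \<Rightarrow> nat set" where
  "nvars (Eq s t) = tm_vars s \<union> tm_vars t"
| "nvars (Less s t) = tm_vars s \<union> tm_vars t"
| "nvars (Mem t X) = tm_vars t"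
| "nvars (Neg \<phi>) = nvars \<phi>"
| "nvars (Conj \<phi> \<psi>) = nvars \<phi> \<union> nvars \<psi>"
| "nvars (Disj \<phi> \<psi>) = nvars \<phi> \<union> nvars \<psi>"
| "nvars (Imp \<phi> \<psi>) = nvars \<phi> \<union> nvars \<psi>"
| "nvars (AllN x \<phi>) = insert x (nvars \<phi>)"
| "nvars (ExN x \<phi>) = insert x (nvars \<phi>)"
| "nvars (AllS X \<phi>) = nvars \<phi>"
| "nvars (ExS X \<phi>) = nvars \<phi>"

lemma finite_tm_vars [simp]: "finite (tm_vars t)"
  by (induction t) auto

lemma finite_nvars [simp]: "finite (nvars \<phi>)"
  by (induction \<phi>) auto

lemma tm_vars_ren_tm: "tm_vars (ren_tm r t) = r ` tm_vars t"
  by (induction t) auto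

lemma tm_val_ren_tm: "tm_val M e (ren_tm r t) = tm_val M (e \<circ> r) t"
  by (induction t) auto

lemma tm_val_cong: "(\<And>x. x \<in> tm_vars t \<Longrightarrow> e x = e' x) \<Longrightarrow> tm_val M e t = tm_val M e' t"
  by (induction t) auto

lemma sat_cong:
  "(\<And>x. x \<in> nvars \<phi> \<Longrightarrow> e x = e' x) \<Longrightarrow> sat M e S \<phi> = sat M e' S \<phi>"
proof (induction \<phi> arbitrary: e e' S)
  case (Eq s t)
  then have "tm_val M e s = tm_val M e' s" "tm_val M e t = tm_val M e' t"
    by (auto intro!: tm_val_cong)
  then show ?case by simp
next
  case (Less s t)
  then have "tm_val M e s = tm_val M e' s" "tm_val M e t = tm_val M e' t"
    by (auto intro!: tm_val_cong)
  then show ?case by simp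
next
  case (Mem t X)
  then have "tm_val M e t = tm_val M e' t" by (auto intro!: tm_val_cong)
  then show ?case by simp
next
  case (Neg \<phi>)
  have "sat M e S \<phi> = sat M e' S \<phi>"
    by (rule Neg.IH; use Neg.prems in simp)
  then show ?case by simp
next
  case (Conj \<phi> \<psi>)
  have "sat M e S \<phi> = sat M e' S \<phi>" "sat M e S \<psi> = sat M e' S \<psi>"
    by (rule Conj.IH; use Conj.prems in simp)+
  then show ?case by simp
next
  case (Disj \<phi> \<psi>)
  have "sat M e S \<phi> = sat M e' S \<phi>" "sat M e S \<psi> = sat M e' S \<psi>"
    by (rule Disj.IH; use Disj.prems in simp)+
  then show ?case by simp
next
  case (Imp \<phi> \<psi>)
  have "sat M e S \<phi> = sat M e' S \<phi>" "sat M e S \<psi> = sat M e' S \<psi>"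
    by (rule Imp.IH; use Imp.prems in simp)+
  then show ?case by simp
next
  case (AllN x \<phi>)
  have "sat M (e(x := a)) S \<phi> = sat M (e'(x := a)) S \<phi>" for a
    by (rule AllN.IH) (use AllN.prems in auto)
  then show ?case by simp
next
  case (ExN x \<phi>)
  have "sat M (e(x := a)) S \<phi> = sat M (e'(x := a)) S \<phi>" for a
    by (rule ExN.IH) (use ExN.prems in auto)
  then show ?case by simp
next
  case (AllS X \<phi>)
  have "sat M e (S(X := A)) \<phi> = sat M e' (S(X := A)) \<phi>" for A
    by (rule AllS.IH) (use AllS.prems in auto)
  then show ?case by simp
next
  case (ExS X \<phi>)
  have "sat M e (S(X := A)) \<phi> = sat M e' (S(X := A)) \<phi>" for A
    by (rule ExS.IH) (use ExS.prems in auto)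
  then show ?case by simp
qed

text \<open>Injectivity rules out capture: an update at \<open>r x\<close>, read through
  \<open>r\<close>, changes the value at \<open>x\<close> alone. The same goes for set variables and
  \<open>q\<close>.\<close>

lemma sat_ren:
  assumes "inj r" "inj q"
  shows "sat M e S (ren r q \<phi>) = sat M (e \<circ> r) (S \<circ> q) \<phi>"
proof (induction \<phi> arbitrary: e S)
  case (AllN x \<phi>)
  have "(e(r x := a)) \<circ> r = (e \<circ> r)(x := a)" for a
    using assms(1) by (auto simp: fun_eq_iff inj_eq)
  then show ?case by (simp only: ren.simps sat.simps AllN)
next
  case (ExN x \<phi>)
  have "(e(r x := a)) \<circ> r = (e \<circ> r)(x := a)" for a
    using assms(1) by (auto simp: fun_eq_iff inj_eq)
  then show ?case by (simp only: ren.simps sat.simps ExN)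
next
  case (AllS X \<phi>)
  have "(S(q X := A)) \<circ> q = (S \<circ> q)(X := A)" for A
    using assms(2) by (auto simp: fun_eq_iff inj_eq)
  then show ?case by (simp only: ren.simps sat.simps AllS)
next
  case (ExS X \<phi>)
  have "(S(q X := A)) \<circ> q = (S \<circ> q)(X := A)" for A
    using assms(2) by (auto simp: fun_eq_iff inj_eq)
  then show ?case by (simp only: ren.simps sat.simps ExS)
qed (auto simp: tm_val_ren_tm)

lemma bounded_fm_ren: "bounded_fm \<phi> \<Longrightarrow> inj r \<Longrightarrow> bounded_fm (ren r q \<phi>)"
  by (induction rule: bounded_fm.induct)
    (auto simp: tm_vars_ren_tm inj_image_mem_iff intro: bounded_fm.intros)

text \<open>These renamings fix the arguments and send the parameters to disjoint slots, so that two
  formulas can be made to share one list of parameters.\<close>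

definition even_slot :: "nat \<Rightarrow> nat" where
  "even_slot i = (if even i then i else 4 * (i div 2) + 1)"

definition odd_slot :: "nat \<Rightarrow> nat" where
  "odd_slot i = (if even i then i else 4 * (i div 2) + 3)"

lemma inj_even_slot: "inj even_slot"
proof (rule injI)
  fix i j assume "even_slot i = even_slot j"
  then show "i = j" unfolding even_slot_def by (auto split: if_splits; presburger)
qed

lemma inj_odd_slot: "inj odd_slot"
proof (rule injI)
  fix i j assume "odd_slot i = odd_slot j"
  then show "i = j" unfolding odd_slot_def by (auto split: if_splits; presburger)
qed

lemma mix_slot:
  "mix (mix p p') e \<circ> even_slot = mix p' e"
  "mix (mix p p') e \<circ> odd_slot = mix p e"
proof -
  have 1: "(4 * k + 1) div 2 = 2 * k" "(4 * k + 3) div 2 = 2 * k + 1" for k :: nat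
    by presburger+
  have 2: "(2 * k + 1) div 2 = k" for k :: nat by presburger
  show "mix (mix p p') e \<circ> even_slot = mix p' e" "mix (mix p p') e \<circ> odd_slot = mix p e"
    by (auto simp: fun_eq_iff mix_def even_slot_def odd_slot_def 1 2 elim!: oddE)
qed

lemma merge_sets:
  assumes "range S \<subseteq> A" "range T \<subseteq> A"
  shows "range (mix S T) \<subseteq> A" "mix S T \<circ> (\<lambda>i. 2 * i) = T" "mix S T \<circ> (\<lambda>i. 2 * i + 1) = S"
  using assms by (auto simp: mix_def fun_eq_iff)

text \<open>Moves argument 0 to argument \<open>n\<close> and shifts the arguments below down by one.  For large \<open>n\<close> this
  turns argument 0 into a fresh variable, which can then be bound.\<close>

definition cyc :: "nat \<Rightarrow> nat \<Rightarrow> nat" where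
  "cyc n i = (if odd i then i else if i = 0 then 2 * n else if i \<le> 2 * n then i - 2 else i)"

lemma inj_cyc: "inj (cyc n)"
proof (rule injI)
  fix i j assume "cyc n i = cyc n j"
  then show "i = j" unfolding cyc_def by (auto split: if_splits; presburger)
qed

text \<open>This is the de Bruijn shift: for slots below \<open>2 * n\<close>, giving variable
  \<open>2 * n\<close> the value \<open>a\<close> amounts to inserting \<open>a\<close> as argument
  0.\<close>

lemma mix_cyc:
  assumes "i < 2 * n"
  shows "((mix p e)(2 * n := a)) (cyc n i) = mix p (case_nat a e) i"
proof (cases "even i \<and> i \<noteq> 0")
  case True
  then obtain k where k: "i = 2 * Suc k" by (metis evenE not0_implies_Suc mult_0_right)
  show ?thesis using assms unfolding k mix_def cyc_def by auto
next
  case False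
  then show ?thesis using assms by (auto simp: mix_def cyc_def)
qed

section \<open>Closure properties of bounded definability\<close>

locale henkin =
  fixes M :: "'a L2"
  assumes nonempty: "Sets M \<noteq> {}"
begin

definition tdef :: "((nat \<Rightarrow> 'a) \<Rightarrow> 'a) \<Rightarrow> bool" where
  "tdef t \<longleftrightarrow> (\<exists>p s. \<forall>e. t e = tm_val M (mix p e) s)"

text \<open>Only bounded quantifiers are available here; in the presence of arithmetical comprehension the class
  is closed under number quantifiers.\<close>

definition definable :: "((nat \<Rightarrow> 'a) \<Rightarrow> bool) \<Rightarrow> bool" where
  "definable P \<longleftrightarrow> (\<exists>p S \<phi>. bounded_fm \<phi> \<and> range S \<subseteq> Sets M \<and> (\<forall>e. P e \<longleftrightarrow> sat M (mix p e) S \<phi>))"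

lemma definableI:
  "bounded_fm \<phi> \<Longrightarrow> range S \<subseteq> Sets M \<Longrightarrow> (\<And>e. P e \<longleftrightarrow> sat M (mix p e) S \<phi>) \<Longrightarrow> definable P"
  unfolding definable_def by blast

lemma tdef_const: "tdef (\<lambda>e. c)"
  unfolding tdef_def by (rule exI[of _ "\<lambda>_. c"], rule exI[of _ "NVar 1"]) (simp add: mix_def)

lemma tdef_var: "tdef (\<lambda>e. e n)"
  unfolding tdef_def by (rule exI, rule exI[of _ "NVar (2 * n)"]) (simp add: mix_def)

lemma tdef_merge:
  assumes "tdef t" "tdef u"
  obtains p s r where "\<And>e. t e = tm_val M (mix p e) s" "\<And>e. u e = tm_val M (mix p e) r"
proof -
  obtain p s where 1: "\<And>e. t e = tm_val M (mix p e) s" using assms(1) unfolding tdef_def by blast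
  obtain q r where 2: "\<And>e. u e = tm_val M (mix q e) r" using assms(2) unfolding tdef_def by blast
  have "t e = tm_val M (mix (mix q p) e) (ren_tm even_slot s)" for e
    by (simp add: tm_val_ren_tm mix_slot 1)
  moreover have "u e = tm_val M (mix (mix q p) e) (ren_tm odd_slot r)" for e
    by (simp add: tm_val_ren_tm mix_slot 2)
  ultimately show ?thesis using that by blast
qed

lemma tdef_add: "tdef t \<Longrightarrow> tdef u \<Longrightarrow> tdef (\<lambda>e. add M (t e) (u e))"
proof (erule (1) tdef_merge)
  fix p s r assume "\<And>e. t e = tm_val M (mix p e) s" "\<And>e. u e = tm_val M (mix p e) r"
  then have "\<forall>e. add M (t e) (u e) = tm_val M (mix p e) (Plus s r)" by simp
  then show ?thesis unfolding tdef_def by blast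
qed

lemma tdef_mul: "tdef t \<Longrightarrow> tdef u \<Longrightarrow> tdef (\<lambda>e. mul M (t e) (u e))"
proof (erule (1) tdef_merge)
  fix p s r assume "\<And>e. t e = tm_val M (mix p e) s" "\<And>e. u e = tm_val M (mix p e) r"
  then have "\<forall>e. mul M (t e) (u e) = tm_val M (mix p e) (Times s r)" by simp
  then show ?thesis unfolding tdef_def by blast
qed

lemma tdef_pair: "tdef t \<Longrightarrow> tdef u \<Longrightarrow> tdef (\<lambda>e. pair M (t e) (u e))"
  unfolding pair_def by (intro tdef_add tdef_mul)

lemmas tdef_intros = tdef_var tdef_const tdef_add tdef_mul tdef_pair

lemma definable_eq: "tdef t \<Longrightarrow> tdef u \<Longrightarrow> definable (\<lambda>e. t e = u e)"
proof (erule (1) tdef_merge)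
  fix p s r assume *: "\<And>e. t e = tm_val M (mix p e) s" "\<And>e. u e = tm_val M (mix p e) r"
  obtain A where "A \<in> Sets M" using nonempty by blast
  then show ?thesis
    by (intro definableI[of "Eq s r" "\<lambda>_. A" _ p]) (auto simp: * intro: bounded_fm.intros)
qed

lemma definable_lt: "tdef t \<Longrightarrow> tdef u \<Longrightarrow> definable (\<lambda>e. lt M (t e) (u e))"
proof (erule (1) tdef_merge)
  fix p s r assume *: "\<And>e. t e = tm_val M (mix p e) s" "\<And>e. u e = tm_val M (mix p e) r"
  obtain A where "A \<in> Sets M" using nonempty by blast
  then show ?thesis
    by (intro definableI[of "Less s r" "\<lambda>_. A" _ p]) (auto simp: * intro: bounded_fm.intros)
qed

lemma definable_mem: "A \<in> Sets M \<Longrightarrow> tdef t \<Longrightarrow> definable (\<lambda>e. t e \<in> A)"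
proof -
  assume A: "A \<in> Sets M" and "tdef t"
  then obtain p s where "\<And>e. t e = tm_val M (mix p e) s" unfolding tdef_def by blast
  then show ?thesis
    using A by (intro definableI[of "Mem s 0" "\<lambda>_. A" _ p]) (auto intro: bounded_fm.intros)
qed

lemma definable_neg: "definable P \<Longrightarrow> definable (\<lambda>e. \<not> P e)"
proof -
  assume "definable P"
  then obtain p S \<phi> where *: "bounded_fm \<phi>" "range S \<subseteq> Sets M"
    "\<And>e. P e \<longleftrightarrow> sat M (mix p e) S \<phi>" unfolding definable_def by blast
  then show ?thesis by (intro definableI[of "Neg \<phi>" S _ p]) (auto intro: bounded_fm.intros)
qed

lemma definable_merge:
  assumes "definable P" "definable Q"
  obtains p S \<phi> \<psi> where "bounded_fm \<phi>" "bounded_fm \<psi>" "range S \<subseteq> Sets M"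
    "\<And>e. P e \<longleftrightarrow> sat M (mix p e) S \<phi>" "\<And>e. Q e \<longleftrightarrow> sat M (mix p e) S \<psi>"
proof -
  obtain p S \<phi> where 1: "bounded_fm \<phi>" "range S \<subseteq> Sets M"
    "\<And>e. P e \<longleftrightarrow> sat M (mix p e) S \<phi>" using assms(1) unfolding definable_def by blast
  obtain q T \<psi> where 2: "bounded_fm \<psi>" "range T \<subseteq> Sets M"
    "\<And>e. Q e \<longleftrightarrow> sat M (mix q e) T \<psi>" using assms(2) unfolding definable_def by blast
  have i: "inj (\<lambda>i::nat. 2 * i)" "inj (\<lambda>i::nat. 2 * i + 1)" by (auto intro!: injI)
  note ms = merge_sets[OF 1(2) 2(2)]
  show ?thesis
  proof (rule that)
    show "bounded_fm (ren even_slot (\<lambda>i::nat. 2 * i + 1) \<phi>)"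
      using 1(1) inj_even_slot by (rule bounded_fm_ren)
    show "bounded_fm (ren odd_slot (\<lambda>i::nat. 2 * i) \<psi>)"
      using 2(1) inj_odd_slot by (rule bounded_fm_ren)
    show "range (mix S T) \<subseteq> Sets M" by (rule ms)
    show "P e \<longleftrightarrow> sat M (mix (mix q p) e) (mix S T) (ren even_slot (\<lambda>i::nat. 2 * i + 1) \<phi>)" for e
      by (simp only: sat_ren[OF inj_even_slot i(2)] mix_slot ms 1(3))
    show "Q e \<longleftrightarrow> sat M (mix (mix q p) e) (mix S T) (ren odd_slot (\<lambda>i::nat. 2 * i) \<psi>)" for e
      by (simp only: sat_ren[OF inj_odd_slot i(1)] mix_slot ms 2(3))
  qed
qed

lemma definable_conj: "definable P \<Longrightarrow> definable Q \<Longrightarrow> definable (\<lambda>e. P e \<and> Q e)"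
proof (erule (1) definable_merge)
  fix p S \<phi> \<psi>
  assume *: "bounded_fm \<phi>" "bounded_fm \<psi>" "range S \<subseteq> Sets M"
    "\<And>e. P e \<longleftrightarrow> sat M (mix p e) S \<phi>" "\<And>e. Q e \<longleftrightarrow> sat M (mix p e) S \<psi>"
  then show ?thesis by (intro definableI[of "Conj \<phi> \<psi>" S _ p]) (auto intro: bounded_fm.intros)
qed

lemma definable_disj:
  assumes "definable P" "definable Q"
  shows "definable (\<lambda>e. P e \<or> Q e)"
  using definable_neg[OF definable_conj[OF assms[THEN definable_neg]]] by (simp only: de_Morgan_conj not_not)

lemma definable_imp:
  assumes "definable P" "definable Q"
  shows "definable (\<lambda>e. P e \<longrightarrow> Q e)"
  using definable_disj[OF definable_neg[OF assms(1)] assms(2)] by (simp only: imp_conv_disj)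

lemma definable_iff:
  assumes "definable P" "definable Q"
  shows "definable (\<lambda>e. P e \<longleftrightarrow> Q e)"
  using definable_conj[OF definable_imp[OF assms] definable_imp[OF assms(2,1)]] by (simp only: iff_conv_conj_imp)

lemma definable_const: "definable (\<lambda>e. C)"
proof (cases C)
  case True
  then show ?thesis using definable_eq[OF tdef_const[of undefined] tdef_const[of undefined]] by simp
next
  case False
  then show ?thesis using definable_neg[OF definable_eq[OF tdef_const[of undefined] tdef_const[of undefined]]] by simp
qed

text \<open>Quantifiers are handled as with de Bruijn indices: the bound variable is \<open>e 0\<close> and the outer
  arguments are shifted.\<close>

lemma definable_bex:
  assumes "tdef t" "definable (\<lambda>e. Q (e 0) (\<lambda>i. e (Suc i)))"
  shows "definable (\<lambda>e. \<exists>a. lt M a (t e) \<and> Q a e)"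
proof -
  obtain p S \<phi> where 1: "bounded_fm \<phi>" "range S \<subseteq> Sets M"
    "\<And>e. Q (e 0) (\<lambda>i. e (Suc i)) \<longleftrightarrow> sat M (mix p e) S \<phi>" using assms(2) unfolding definable_def by blast
  obtain q s where 2: "\<And>e. t e = tm_val M (mix q e) s" using assms(1) unfolding tdef_def by blast
  define \<psi> where "\<psi> = ren even_slot id \<phi>"
  define r where "r = ren_tm odd_slot s"
  define u where "u = mix q p"
  have r: "t e = tm_val M (mix u e) r" for e
    by (simp add: tm_val_ren_tm mix_slot 2 r_def u_def)
  have psi: "Q a e \<longleftrightarrow> sat M (mix u (case_nat a e)) S \<psi>" for a e
    using 1(3)[of "case_nat a e"]
    by (simp add: \<psi>_def u_def sat_ren[OF inj_even_slot] mix_slot)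
  have "finite (nvars \<psi> \<union> tm_vars r)" by simp
  then obtain m where "\<forall>i \<in> nvars \<psi> \<union> tm_vars r. i < m"
    unfolding finite_nat_set_iff_bounded ..
  then have m: "\<And>i. i \<in> nvars \<psi> \<union> tm_vars r \<Longrightarrow> i < m" by (rule bspec)
  \<comment> \<open>\<open>m\<close> exceeds every variable of \<open>\<psi>\<close> and
    \<open>r\<close>. So variable \<open>2 * m\<close> does not occur in the bound, and on the
    variables of \<open>\<psi>\<close> the renaming \<open>cyc m\<close> acts as the shift of
    \<open>mix_cyc\<close>.\<close>
  let ?\<theta> = "ExN (2*m) (Conj (Less (NVar (2*m)) r) (ren (cyc m) id \<psi>))"
  have nr: "2 * m \<notin> tm_vars r" using m[of "2*m"] by auto
  have "bounded_fm ?\<theta>"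
    unfolding \<psi>_def using 1(1) nr
    by (intro bounded_fm.intros bounded_fm_ren inj_cyc inj_even_slot)
  moreover have "(\<exists>a. lt M a (t e) \<and> Q a e) \<longleftrightarrow> sat M (mix u e) S ?\<theta>" for e
  proof -
    have a: "tm_val M ((mix u e)(2*m := a)) r = t e" for a
      unfolding r by (rule tm_val_cong) (use nr in auto)
    have b: "sat M ((mix u e)(2*m := a)) S (ren (cyc m) id \<psi>) = Q a e" for a
    proof -
      have "sat M ((mix u e)(2*m := a)) S (ren (cyc m) id \<psi>)
        = sat M ((mix u e)(2*m := a) \<circ> cyc m) S \<psi>"
        by (simp add: sat_ren[OF inj_cyc])
      also have "\<dots> = sat M (mix u (case_nat a e)) S \<psi>"
      proof (rule sat_cong)
        fix x assume "x \<in> nvars \<psi>"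
        then have "x < 2 * m" using m[of x] by auto
        then show "((mix u e)(2*m := a) \<circ> cyc m) x = mix u (case_nat a e) x"
          using mix_cyc by (simp del: fun_upd_apply)
      qed
      finally show ?thesis using psi by simp
    qed
    show ?thesis by (simp add: a b del: fun_upd_apply) simp
  qed
  ultimately show ?thesis using 1(2) by (intro definableI)
qed

lemma definable_ball:
  assumes "tdef t" "definable (\<lambda>e. Q (e 0) (\<lambda>i. e (Suc i)))"
  shows "definable (\<lambda>e. \<forall>a. lt M a (t e) \<longrightarrow> Q a e)"
  using definable_neg[OF definable_bex[OF assms(1) definable_neg[OF assms(2)]]] by (simp add: not_ex)

lemmas definable_intros = definable_conj definable_disj definable_imp definable_iff definable_bex definable_ball definable_neg definable_eq definable_lt definable_mem definable_const
  tdef_intros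

text \<open>The renaming moves even slots only, so the number parameters in the odd slots stay in
  place.\<close>

lemma definable_subst:
  assumes "definable P" "inj r"
  shows "definable (\<lambda>e. P (\<lambda>i. e (r i)))"
proof -
  obtain p S \<phi> where 1: "bounded_fm \<phi>" "range S \<subseteq> Sets M"
    "\<And>e. P e \<longleftrightarrow> sat M (mix p e) S \<phi>" using assms unfolding definable_def by blast
  define q where "q i = (if even i then 2 * r (i div 2) else i)" for i
  have "inj q"
  proof (rule injI)
    fix i j assume *: "q i = q j"
    have "even (q k) = even k" for k by (auto simp: q_def)
    then have "even i = even j" using * by metis
    then show "i = j" using * assms(2)
      by (auto simp: q_def inj_eq split: if_splits elim!: evenE)
  qed
  moreover have "mix p e \<circ> q = mix p (\<lambda>i. e (r i))" for e
    by (auto simp: fun_eq_iff mix_def q_def)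
  then have "P (\<lambda>i. e (r i)) \<longleftrightarrow> sat M (mix p e) S (ren q id \<phi>)" for e
    by (simp only: 1(3) sat_ren[OF \<open>inj q\<close> inj_on_id] comp_id)
  ultimately show ?thesis
    using 1 by (intro definableI[of "ren q id \<phi>" S _ p] bounded_fm_ren)
qed

end

section \<open>The axiom schemes in terms of definable predicates\<close>

locale rca = henkin +
  assumes rca0: "RCA0 M"
begin

abbreviation zero ("\<zero>") where "\<zero> \<equiv> zer M"
abbreviation unit ("\<one>") where "\<one> \<equiv> one M"
abbreviation plus (infixl "\<oplus>" 65) where "x \<oplus> y \<equiv> add M x y"
abbreviation times (infixl "\<otimes>" 70) where "x \<otimes> y \<equiv> mul M x y"
abbreviation less (infix "\<prec>" 50) where "x \<prec> y \<equiv> lt M x y"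

lemma delta1_comprehension:
  assumes "definable (\<lambda>e. Q (e 0) (e 1))" "definable (\<lambda>e. R (e 0) (e 1))"
    and "\<And>n. (\<exists>a. Q a n) \<longleftrightarrow> (\<forall>a. R a n)"
  shows "{n. \<exists>a. Q a n} \<in> Sets M"
proof -
  obtain p S \<phi> \<psi> where 1: "bounded_fm \<phi>" "bounded_fm \<psi>" "range S \<subseteq> Sets M"
    "\<And>e. Q (e 0) (e 1) \<longleftrightarrow> sat M (mix p e) S \<phi>" "\<And>e. R (e 0) (e 1) \<longleftrightarrow> sat M (mix p e) S \<psi>"
    using definable_merge[OF assms(1,2)] by (metis (no_types, lifting))
  \<comment> \<open>Slot 0 holds the witness and slot 2 the argument \<open>n\<close>. The second
    \<open>p\<close> fills the other even slots, so that the assignment becomes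
    \<open>p(0 := a, 1 := n)\<close>.\<close>
  let ?e = "mix p p"
  have m: "?e(2 := n, 0 := a) = mix p (p(0 := a, 1 := n))" for a n
    by (auto simp: fun_eq_iff mix_def elim!: evenE)
  have a: "sat M (?e(2 := n)) S (ExN 0 \<phi>) \<longleftrightarrow> (\<exists>a. Q a n)" for n
    using 1(4)[of "p(0 := _, 1 := n)"] by (simp add: m)
  have b: "sat M (?e(2 := n)) S (AllN 0 \<psi>) \<longleftrightarrow> (\<forall>a. R a n)" for n
    using 1(5)[of "p(0 := _, 1 := n)"] by (simp add: m)
  have "recursive_comprehension M" using rca0 unfolding RCA0_def by simp
  note * = this[unfolded recursive_comprehension_def, THEN spec[of _ "ExN 0 \<phi>"],
      THEN spec[of _ "AllN 0 \<psi>"], THEN spec[of _ 2], THEN spec[of _ ?e], THEN spec[of _ S]]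
  have "{n. sat M (?e(2 := n)) S (ExN 0 \<phi>)} \<in> Sets M"
  proof (rule *[THEN mp], intro conjI allI)
    show "Sigma01 (ExN 0 \<phi>)" using 1(1) unfolding Sigma01_def by blast
    show "Pi01 (AllN 0 \<psi>)" using 1(2) unfolding Pi01_def by blast
    show "range S \<subseteq> Sets M" by (rule 1)
    show "sat M (?e(2 := n)) S (ExN 0 \<phi>) \<longleftrightarrow> sat M (?e(2 := n)) S (AllN 0 \<psi>)" for n
      unfolding a b by (rule assms(3))
  qed
  then show ?thesis unfolding a .
qed

lemma comprehension:
  assumes "definable (\<lambda>e. P (e 0))"
  shows "{n. P n} \<in> Sets M"
proof -
  have "definable (\<lambda>e. P (e 1))" using definable_subst[OF assms, of Suc] by simp
  from delta1_comprehension[OF this this] show ?thesis by simp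
qed

lemma sigma1_induct:
  assumes "definable (\<lambda>e. Q (e 0) (e 1))"
    and "\<exists>a. Q a \<zero>" and "\<And>n. \<exists>a. Q a n \<Longrightarrow> \<exists>a. Q a (n \<oplus> \<one>)"
  shows "\<exists>a. Q a n"
proof -
  obtain p S \<phi> where 1: "bounded_fm \<phi>" "range S \<subseteq> Sets M"
    "\<And>e. Q (e 0) (e 1) \<longleftrightarrow> sat M (mix p e) S \<phi>"
    using assms(1) unfolding definable_def by blast
  let ?e = "mix p p"
  have m: "?e(2 := n, 0 := a) = mix p (p(0 := a, 1 := n))" for a n
    by (auto simp: fun_eq_iff mix_def elim!: evenE)
  have a: "sat M (?e(2 := n)) S (ExN 0 \<phi>) \<longleftrightarrow> (\<exists>a. Q a n)" for n
    using 1(3)[of "p(0 := _, 1 := n)"] by (simp add: m)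
  have "Sigma01_induction M" using rca0 unfolding RCA0_def by simp
  note * = this[unfolded Sigma01_induction_def, THEN spec[of _ "ExN 0 \<phi>"],
      THEN spec[of _ 2], THEN spec[of _ ?e], THEN spec[of _ S]]
  have "\<forall>n. sat M (?e(2 := n)) S (ExN 0 \<phi>)"
  proof (rule *[THEN mp], intro conjI allI impI)
    show "Sigma01 (ExN 0 \<phi>)" using 1(1) unfolding Sigma01_def by blast
    show "range S \<subseteq> Sets M" by (rule 1)
    show "sat M (?e(2 := \<zero>)) S (ExN 0 \<phi>)" unfolding a by (rule assms(2))
    show "sat M (?e(2 := n)) S (ExN 0 \<phi>) \<Longrightarrow> sat M (?e(2 := n \<oplus> \<one>)) S (ExN 0 \<phi>)" for n
      unfolding a by (rule assms(3))
  qed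
  then show ?thesis unfolding a ..
qed

lemma definable_induct:
  assumes "definable (\<lambda>e. P (e 0))" and "P \<zero>" and "\<And>n. P n \<Longrightarrow> P (n \<oplus> \<one>)"
  shows "P n"
proof -
  have "definable (\<lambda>e. P (e 1))" using definable_subst[OF assms(1), of Suc] by simp
  from sigma1_induct[of "\<lambda>a. P", OF this] assms(2,3) show ?thesis by blast
qed

section \<open>Arithmetic in a model of \<open>RCA\<^sub>0\<close>\<close>

lemma basic:
  "n \<oplus> \<one> \<noteq> \<zero>"
  "m \<oplus> \<one> = n \<oplus> \<one> \<longleftrightarrow> m = n"
  "m \<oplus> \<zero> = m"
  "m \<oplus> (n \<oplus> \<one>) = (m \<oplus> n) \<oplus> \<one>"
  "m \<otimes> \<zero> = \<zero>"
  "m \<otimes> (n \<oplus> \<one>) = m \<otimes> n \<oplus> m"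
  "\<not> m \<prec> \<zero>"
  "m \<prec> n \<oplus> \<one> \<longleftrightarrow> m \<prec> n \<or> m = n"
  using rca0 unfolding RCA0_def basic_axioms_def by metis+

lemma zero_add: "\<zero> \<oplus> n = n"
  by (rule definable_induct[of "\<lambda>n. \<zero> \<oplus> n = n"]) (intro definable_intros, simp_all add: basic)

lemma succ_add: "(m \<oplus> \<one>) \<oplus> n = (m \<oplus> n) \<oplus> \<one>"
  by (rule definable_induct[of "\<lambda>n. (m \<oplus> \<one>) \<oplus> n = (m \<oplus> n) \<oplus> \<one>"])
    (intro definable_intros, simp_all add: basic)

lemma add_commute: "m \<oplus> n = n \<oplus> m"
  by (rule definable_induct[of "\<lambda>n. m \<oplus> n = n \<oplus> m"])
    (intro definable_intros, simp_all add: basic zero_add succ_add)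

lemma add_assoc: "(m \<oplus> n) \<oplus> k = m \<oplus> (n \<oplus> k)"
  by (rule definable_induct[of "\<lambda>k. (m \<oplus> n) \<oplus> k = m \<oplus> (n \<oplus> k)"])
    (intro definable_intros, simp_all add: basic)

lemma add_left_commute: "m \<oplus> (n \<oplus> k) = n \<oplus> (m \<oplus> k)"
  by (metis add_assoc add_commute)

lemmas add_ac = add_commute add_assoc add_left_commute

lemma zero_mul: "\<zero> \<otimes> n = \<zero>"
  by (rule definable_induct[of "\<lambda>n. \<zero> \<otimes> n = \<zero>"]) (intro definable_intros, simp_all add: basic)

lemma succ_mul: "(m \<oplus> \<one>) \<otimes> n = m \<otimes> n \<oplus> n"
proof (rule definable_induct[of "\<lambda>n. (m \<oplus> \<one>) \<otimes> n = m \<otimes> n \<oplus> n"])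
  fix n assume "(m \<oplus> \<one>) \<otimes> n = m \<otimes> n \<oplus> n"
  then show "(m \<oplus> \<one>) \<otimes> (n \<oplus> \<one>) = m \<otimes> (n \<oplus> \<one>) \<oplus> (n \<oplus> \<one>)"
    unfolding basic(6) by (simp add: add_ac)
qed (intro definable_intros, simp_all add: basic)

lemma mul_commute: "m \<otimes> n = n \<otimes> m"
  by (rule definable_induct[of "\<lambda>n. m \<otimes> n = n \<otimes> m"])
    (intro definable_intros, simp_all add: basic zero_mul succ_mul)

lemma mul_add: "m \<otimes> (n \<oplus> k) = m \<otimes> n \<oplus> m \<otimes> k"
proof (rule definable_induct[of "\<lambda>k. m \<otimes> (n \<oplus> k) = m \<otimes> n \<oplus> m \<otimes> k"])
  fix k assume "m \<otimes> (n \<oplus> k) = m \<otimes> n \<oplus> m \<otimes> k"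
  then show "m \<otimes> (n \<oplus> (k \<oplus> \<one>)) = m \<otimes> n \<oplus> m \<otimes> (k \<oplus> \<one>)"
    unfolding basic by (simp add: add_ac)
qed (intro definable_intros, simp_all add: basic)

lemma mul_assoc: "(m \<otimes> n) \<otimes> k = m \<otimes> (n \<otimes> k)"
proof (rule definable_induct[of "\<lambda>k. (m \<otimes> n) \<otimes> k = m \<otimes> (n \<otimes> k)"])
  fix k assume "(m \<otimes> n) \<otimes> k = m \<otimes> (n \<otimes> k)"
  then show "(m \<otimes> n) \<otimes> (k \<oplus> \<one>) = m \<otimes> (n \<otimes> (k \<oplus> \<one>))"
    unfolding basic by (simp add: mul_add)
qed (intro definable_intros, simp_all add: basic)

lemma one_mul: "\<one> \<otimes> m = m"
  using basic(6)[of m "\<zero>"] by (simp add: zero_add basic mul_commute)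

lemma add_cancel: "m \<oplus> k = n \<oplus> k \<longleftrightarrow> m = n"
proof (rule definable_induct[of "\<lambda>k. m \<oplus> k = n \<oplus> k \<longleftrightarrow> m = n"])
  fix k assume "m \<oplus> k = n \<oplus> k \<longleftrightarrow> m = n"
  then show "m \<oplus> (k \<oplus> \<one>) = n \<oplus> (k \<oplus> \<one>) \<longleftrightarrow> m = n"
    unfolding basic .
qed (intro definable_intros, simp_all add: basic)

lemma zero_least: "\<zero> = n \<or> \<zero> \<prec> n"
  by (rule definable_induct[of "\<lambda>n. \<zero> = n \<or> \<zero> \<prec> n"])
    (intro definable_intros, auto simp add: basic)

lemma lt_trans: "a \<prec> b \<Longrightarrow> b \<prec> c \<Longrightarrow> a \<prec> c"
proof -
  have "a \<prec> b \<longrightarrow> b \<prec> c \<longrightarrow> a \<prec> c"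
    by (rule definable_induct[of "\<lambda>c. a \<prec> b \<longrightarrow> b \<prec> c \<longrightarrow> a \<prec> c"])
      (intro definable_intros, auto simp add: basic)
  then show "a \<prec> b \<Longrightarrow> b \<prec> c \<Longrightarrow> a \<prec> c" by blast
qed

lemma lt_irrefl: "\<not> n \<prec> n"
proof (rule definable_induct[of "\<lambda>n. \<not> n \<prec> n"])
  fix n assume "\<not> n \<prec> n"
  then show "\<not> n \<oplus> \<one> \<prec> n \<oplus> \<one>"
    using lt_trans[of n "n \<oplus> \<one>" n] basic(8)[of n n] basic(8)[of "n \<oplus> \<one>" n] by auto
qed (intro definable_intros, simp_all add: basic)

lemma lt_succ_cases: "n \<prec> m \<Longrightarrow> n \<oplus> \<one> \<prec> m \<or> n \<oplus> \<one> = m"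
proof -
  have "n \<prec> m \<longrightarrow> n \<oplus> \<one> \<prec> m \<or> n \<oplus> \<one> = m"
    by (rule definable_induct[of "\<lambda>m. n \<prec> m \<longrightarrow> n \<oplus> \<one> \<prec> m \<or> n \<oplus> \<one> = m"])
      (intro definable_intros, auto simp add: basic)
  then show "n \<prec> m \<Longrightarrow> n \<oplus> \<one> \<prec> m \<or> n \<oplus> \<one> = m" by blast
qed

lemma lt_total: "m \<prec> n \<or> m = n \<or> n \<prec> m"
proof (rule definable_induct[of "\<lambda>n. m \<prec> n \<or> m = n \<or> n \<prec> m"])
  show "m \<prec> \<zero> \<or> m = \<zero> \<or> \<zero> \<prec> m" using zero_least[of m] by auto
  fix n assume "m \<prec> n \<or> m = n \<or> n \<prec> m"
  then show "m \<prec> n \<oplus> \<one> \<or> m = n \<oplus> \<one> \<or> n \<oplus> \<one> \<prec> m"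
    using lt_succ_cases[of n m] by (auto simp: basic)
qed (intro definable_intros)

lemma lt_add_succ: "a \<prec> a \<oplus> (k \<oplus> \<one>)"
  by (rule definable_induct[of "\<lambda>k. a \<prec> a \<oplus> (k \<oplus> \<one>)"])
    (intro definable_intros, auto simp add: basic zero_add)

lemma lt_iff_add: "a \<prec> b \<longleftrightarrow> (\<exists>k. b = a \<oplus> (k \<oplus> \<one>))"
proof
  \<comment> \<open>The witness stands in front of the implication, so the induction formula is one
    existential quantifier before a bounded formula.\<close>
  have "\<exists>k. a \<prec> b \<longrightarrow> b = a \<oplus> (k \<oplus> \<one>)"
  proof (rule sigma1_induct[of "\<lambda>k b. a \<prec> b \<longrightarrow> b = a \<oplus> (k \<oplus> \<one>)"])
    fix n assume *: "\<exists>k. a \<prec> n \<longrightarrow> n = a \<oplus> (k \<oplus> \<one>)"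
    show "\<exists>k. a \<prec> n \<oplus> \<one> \<longrightarrow> n \<oplus> \<one> = a \<oplus> (k \<oplus> \<one>)"
    proof (cases "a = n")
      case True
      then have "n \<oplus> \<one> = a \<oplus> (\<zero> \<oplus> \<one>)" by (simp add: zero_add)
      then show ?thesis by blast
    next
      case False
      with * show ?thesis by (metis basic(4,8))
    qed
  qed (intro definable_intros, auto simp: basic)
  then show "a \<prec> b \<Longrightarrow> \<exists>k. b = a \<oplus> (k \<oplus> \<one>)" by blast
qed (use lt_add_succ in blast)

text \<open>Truncated subtraction completes the signature of \<open>linordered_semidom\<close>;
  later it also re-indexes walks that are reversed or concatenated.\<close>

definition msub (infixl "\<ominus>" 65) where
  "x \<ominus> y = (if x \<prec> y then \<zero> else THE k. k \<oplus> y = x)"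

definition le (infix "\<preceq>" 50) where
  "x \<preceq> y \<longleftrightarrow> x \<prec> y \<or> x = y"

lemma le_iff_add: "a \<preceq> b \<longleftrightarrow> (\<exists>k. b = a \<oplus> k)"
proof
  assume "a \<preceq> b"
  then show "\<exists>k. b = a \<oplus> k" unfolding le_def lt_iff_add using basic(3) by metis
next
  assume "\<exists>k. b = a \<oplus> k"
  then obtain k where k: "b = a \<oplus> k" ..
  show "a \<preceq> b"
  proof (cases "k = \<zero>")
    case True
    then show ?thesis by (simp add: k basic le_def)
  next
    case False
    then obtain j where "k = j \<oplus> \<one>" using zero_least[of k] lt_iff_add[of \<zero> k] zero_add by auto
    then show ?thesis using lt_add_succ by (simp add: k le_def)
  qed
qed

lemma msub_add: "(a \<oplus> k) \<ominus> a = k"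
proof -
  have 1: "\<not> a \<oplus> k \<prec> a"
    using le_iff_add[of a "a \<oplus> k"] lt_irrefl lt_trans unfolding le_def by metis
  have "(THE j. j \<oplus> a = a \<oplus> k) = k"
    by (rule the_equality) (use add_cancel add_commute in metis)+
  then show ?thesis unfolding msub_def using 1 by simp
qed

lemma msub_lt: "a \<prec> b \<Longrightarrow> a \<ominus> b = \<zero>"
  unfolding msub_def by simp

lemma add_mono_lt: "a \<prec> b \<Longrightarrow> c \<oplus> a \<prec> c \<oplus> b"
  unfolding lt_iff_add using add_assoc by metis

lemma mul_mono_lt: "a \<prec> b \<Longrightarrow> \<zero> \<prec> c \<Longrightarrow> c \<otimes> a \<prec> c \<otimes> b"
proof -
  assume "a \<prec> b" "\<zero> \<prec> c"
  then obtain k j where "b = a \<oplus> (k \<oplus> \<one>)" "c = j \<oplus> \<one>" unfolding lt_iff_add zero_add by auto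
  then have "c \<otimes> b = c \<otimes> a \<oplus> ((c \<otimes> k \<oplus> j) \<oplus> \<one>)"
    by (metis mul_add mul_commute one_mul add_assoc)
  then show ?thesis unfolding lt_iff_add by blast
qed

lemma msub_zero_iff: "b = a \<oplus> k \<Longrightarrow> a \<ominus> b = \<zero>"
proof -
  assume "b = a \<oplus> k"
  then have "a \<preceq> b" unfolding le_iff_add ..
  then consider "a \<prec> b" | "a = b" unfolding le_def by blast
  then show "a \<ominus> b = \<zero>"
  proof cases
    case 2
    then show ?thesis using msub_add[of a \<zero>] by (simp add: basic(3))
  qed (rule msub_lt)
qed

sublocale ar: linordered_semidom where one = \<one> and times = "(\<otimes>)" and plus = "(\<oplus>)"
  and zero = \<zero> and minus = "(\<ominus>)" and less_eq = "(\<preceq>)" and less = "(\<prec>)"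
proof
  note ac = add_ac
  fix a b c
  show "a \<otimes> b \<otimes> c = a \<otimes> (b \<otimes> c)" by (rule mul_assoc)
  show "\<one> \<otimes> a = a" by (rule one_mul)
  show "a \<otimes> b = b \<otimes> a" by (rule mul_commute)
  show "a \<oplus> b \<oplus> c = a \<oplus> (b \<oplus> c)" by (rule add_assoc)
  show "a \<oplus> b = b \<oplus> a" by (rule add_commute)
  show "\<zero> \<oplus> a = a" by (rule zero_add)
  show "(a \<oplus> b) \<ominus> a = b" by (rule msub_add)
  show dda: "a \<ominus> b \<ominus> c = a \<ominus> (b \<oplus> c)" for a b c
  proof (cases "b \<preceq> a")
    case True
    then obtain k where k: "a = b \<oplus> k" unfolding le_iff_add ..
    show ?thesis
    proof (cases "c \<preceq> k")
      case True
      then obtain j where j: "k = c \<oplus> j" unfolding le_iff_add ..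
      show ?thesis unfolding k msub_add unfolding j msub_add unfolding add_assoc[symmetric] msub_add ..
    next
      case False
      then have "k \<prec> c" using lt_total le_def by metis
      then have "k \<ominus> c = \<zero>" "b \<oplus> k \<ominus> (b \<oplus> c) = \<zero>" using msub_lt add_mono_lt by auto
      then show ?thesis unfolding k msub_add by simp
    qed
  next
    case False
    then have "a \<prec> b" using lt_total le_def by metis
    then obtain j where "b = a \<oplus> j" using lt_iff_add by blast
    then have "a \<ominus> (b \<oplus> c) = \<zero>" "a \<ominus> b = \<zero>" "\<zero> \<ominus> c = \<zero>"
      using msub_zero_iff[of "b \<oplus> c" a "j \<oplus> c"] msub_zero_iff[of b a j]
        msub_zero_iff[OF zero_add[symmetric]]
      by (simp_all add: ac)
    then show ?thesis by simp
  qed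
  show "(a \<oplus> b) \<otimes> c = a \<otimes> c \<oplus> b \<otimes> c" by (metis mul_add mul_commute)
  show "\<zero> \<otimes> a = \<zero>" by (rule zero_mul)
  show "\<zero> \<noteq> \<one>" using basic(1) zero_add by metis
  show "a \<otimes> (b \<ominus> c) = a \<otimes> b \<ominus> a \<otimes> c"
  proof (cases "c \<preceq> b")
    case True
    then obtain k where k: "b = c \<oplus> k" unfolding le_iff_add ..
    show ?thesis unfolding k mul_add msub_add ..
  next
    case False
    then have "b \<prec> c" using lt_total le_def by metis
    then obtain j where j: "c = b \<oplus> j" using lt_iff_add by blast
    have "b \<ominus> c = \<zero>" "a \<otimes> b \<ominus> a \<otimes> c = \<zero>" using msub_zero_iff j mul_add by metis+
    then show ?thesis by (simp add: basic)
  qed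
  show "a \<noteq> \<zero> \<Longrightarrow> b \<noteq> \<zero> \<Longrightarrow> a \<otimes> b \<noteq> \<zero>"
    using mul_mono_lt[of \<zero> b a] zero_least[of a] zero_least[of b] lt_irrefl basic(5) by metis
  show "a \<preceq> a" by (simp add: le_def)
  show "a \<preceq> b \<Longrightarrow> b \<preceq> c \<Longrightarrow> a \<preceq> c" unfolding le_def using lt_trans by blast
  show "a \<preceq> b \<Longrightarrow> b \<preceq> a \<Longrightarrow> a = b" unfolding le_def using lt_trans lt_irrefl by blast
  show "(a \<prec> b) = (a \<preceq> b \<and> \<not> b \<preceq> a)" unfolding le_def using lt_trans lt_irrefl by blast
  show "a \<preceq> b \<or> b \<preceq> a" unfolding le_def using lt_total by blast
  show "a \<preceq> b \<Longrightarrow> c \<oplus> a \<preceq> c \<oplus> b" unfolding le_def using add_mono_lt by blast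
  show "a \<prec> b \<Longrightarrow> \<zero> \<prec> c \<Longrightarrow> c \<otimes> a \<prec> c \<otimes> b" by (rule mul_mono_lt)
  show "\<zero> \<prec> \<one>" using lt_add_succ[of \<zero> \<zero>] by (simp add: zero_add)
  show "b \<preceq> a \<Longrightarrow> a \<ominus> b \<oplus> b = a"
    unfolding le_iff_add using msub_add add_commute by metis
qed (simp_all add: basic(5) mul_add)

lemma lt_succ [simp]: "a \<prec> b \<oplus> \<one> \<longleftrightarrow> a \<preceq> b"
  by (simp add: basic le_def)

lemma succ_le [simp]: "a \<oplus> \<one> \<preceq> b \<longleftrightarrow> a \<prec> b"
  using lt_succ_cases[of a b] lt_succ[of a a] unfolding le_def by (metis lt_trans)

lemma zero_le [simp]: "\<zero> \<preceq> a"
  using zero_least[of a] by (auto simp: le_def)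

lemma not_lt_zero [simp]: "\<not> a \<prec> \<zero>"
  by (rule basic)

lemma le_zero [simp]: "a \<preceq> \<zero> \<longleftrightarrow> a = \<zero>"
  using ar.order.antisym[of a \<zero>] by auto

lemma succ_ne_zero [simp]: "a \<oplus> \<one> \<noteq> \<zero>" "\<zero> \<noteq> a \<oplus> \<one>"
  using basic(1) by metis+

lemma gt_zero_iff: "\<zero> \<prec> a \<longleftrightarrow> a \<noteq> \<zero>"
  using zero_least[of a] by auto

lemma num_cases: obtains "a = \<zero>" | k where "a = k \<oplus> \<one>"
  using zero_least[of a] lt_iff_add[of \<zero> a] by auto

lemma le_succ_iff: "a \<preceq> b \<oplus> \<one> \<longleftrightarrow> a \<preceq> b \<or> a = b \<oplus> \<one>"
  using lt_succ[of a b] by (auto simp: le_def)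

lemma definable_le: "tdef t \<Longrightarrow> tdef u \<Longrightarrow> definable (\<lambda>e. t e \<preceq> u e)"
  unfolding le_def by (intro definable_intros)

lemma le_add [simp]: "a \<preceq> a \<oplus> b" "a \<preceq> b \<oplus> a"
  by (auto simp: le_iff_add add_ac)

section \<open>Pairing\<close>

abbreviation pr ("\<langle>_, _\<rangle>") where "\<langle>i, j\<rangle> \<equiv> pair M i j"

text \<open>Pairs with sum \<open>s\<close> have codes from \<open>s * s\<close> to
  \<open>s * s + s\<close>. The inequality separates these blocks, so a code determines the sum and
  then the first component.\<close>

lemma square_lt: "s \<prec> t \<Longrightarrow> s \<otimes> s \<oplus> s \<prec> t \<otimes> t"
proof -
  assume "s \<prec> t"
  then have "s \<oplus> \<one> \<preceq> t" by simp
  then have "(s \<oplus> \<one>) \<otimes> (s \<oplus> \<one>) \<preceq> t \<otimes> t" by (intro ar.mult_mono) auto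
  moreover have "(s \<oplus> \<one>) \<otimes> (s \<oplus> \<one>) = (s \<otimes> s \<oplus> s) \<oplus> s \<oplus> \<one>"
    by (simp add: ar.distrib_left ar.distrib_right add_ac)
  moreover have "s \<otimes> s \<oplus> s \<preceq> (s \<otimes> s \<oplus> s) \<oplus> s" by simp
  ultimately show ?thesis using succ_le by (metis ar.order.strict_trans1)
qed

lemma pair_eq [simp]: "\<langle>i, j\<rangle> = \<langle>i', j'\<rangle> \<longleftrightarrow> i = i' \<and> j = j'"
proof
  assume *: "\<langle>i, j\<rangle> = \<langle>i', j'\<rangle>"
  have lt: "\<langle>i, j\<rangle> \<prec> \<langle>i', j'\<rangle>" if "i \<oplus> j \<prec> i' \<oplus> j'" for i j i' j'
  proof -
    have "\<langle>i, j\<rangle> \<preceq> (i \<oplus> j) \<otimes> (i \<oplus> j) \<oplus> (i \<oplus> j)" unfolding pair_def by simp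
    also have "\<dots> \<prec> (i' \<oplus> j') \<otimes> (i' \<oplus> j')" by (rule square_lt[OF that])
    also have "\<dots> \<preceq> \<langle>i', j'\<rangle>" unfolding pair_def by simp
    finally show ?thesis .
  qed
  have "i \<oplus> j = i' \<oplus> j'" using lt[of i j i' j'] lt[of i' j' i j] * by (metis ar.less_irrefl ar.linorder_cases)
  then show "i = i' \<and> j = j'" using * unfolding pair_def by simp
qed simp

lemma le_pair [simp]: "i \<preceq> \<langle>i, j\<rangle>" "j \<preceq> \<langle>i, j\<rangle>"
proof -
  show "i \<preceq> \<langle>i, j\<rangle>" unfolding pair_def by simp
  have "s \<preceq> s \<otimes> s" for s
  proof (cases s rule: num_cases)
    case (2 k)
    have "s \<preceq> s \<oplus> s \<otimes> k" by simp
    also have "\<dots> = s \<otimes> s" unfolding 2 by (simp add: ar.distrib_left add_ac)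
    finally show ?thesis .
  qed simp
  then have "j \<preceq> (i \<oplus> j) \<otimes> (i \<oplus> j)" using le_add(2)[of j i] ar.order.trans by blast
  then show "j \<preceq> \<langle>i, j\<rangle>" unfolding pair_def using le_add(1) ar.order.trans by blast
qed

lemma pair_mono: "i \<preceq> a \<Longrightarrow> j \<preceq> b \<Longrightarrow> \<langle>i, j\<rangle> \<preceq> \<langle>a, b\<rangle>"
  unfolding pair_def by (intro ar.add_mono ar.mult_mono) auto

section \<open>Divisibility, the beta function and bounding\<close>

abbreviation divides (infix "divides" 50) where "a divides b \<equiv> ar.dvd a b"

text \<open>Divisibility with a bounded quotient is a bounded formula; a multiple of a nonzero
  number is at least as large as the quotient.\<close>

definition bdiv where "bdiv p c \<longleftrightarrow> (\<exists>k. k \<prec> c \<oplus> \<one> \<and> c = p \<otimes> k)"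

lemma bdiv_iff: "p \<noteq> \<zero> \<Longrightarrow> bdiv p c \<longleftrightarrow> p divides c"
proof -
  assume "p \<noteq> \<zero>"
  then obtain q where "p = q \<oplus> \<one>" by (cases p rule: num_cases) auto
  then have "k \<preceq> p \<otimes> k" for k by (simp add: ar.distrib_right)
  then show ?thesis unfolding bdiv_def ar.dvd_def by auto
qed

lemma definable_bdiv: "tdef t \<Longrightarrow> tdef u \<Longrightarrow> definable (\<lambda>e. bdiv (t e) (u e))"
proof -
  assume tu: "tdef t" "tdef u"
  then obtain p s r where *: "\<And>e. t e = tm_val M (mix p e) s" "\<And>e. u e = tm_val M (mix p e) r"
    by (erule tdef_merge)
  have sh: "tdef v \<Longrightarrow> tdef (\<lambda>e. v (\<lambda>i. e (Suc i)))" for v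
  proof -
    assume "tdef v"
    then obtain q w where v: "\<And>e. v e = tm_val M (mix q e) w" unfolding tdef_def by blast
    define f where "f i = (if even i then i + 2 else i)" for i :: nat
    have "mix q e \<circ> f = mix q (\<lambda>i. e (Suc i))" for e
      by (auto simp: fun_eq_iff mix_def f_def)
    then have "\<forall>e. v (\<lambda>i. e (Suc i)) = tm_val M (mix q e) (ren_tm f w)"
      unfolding tm_val_ren_tm v by simp
    then show ?thesis unfolding tdef_def by blast
  qed
  show ?thesis unfolding bdiv_def by (intro definable_intros sh tu)
qed

text \<open>The moduli of Goedel's beta function.\<close>

definition modulus where "modulus b i = \<one> \<oplus> (i \<oplus> \<one>) \<otimes> b"

lemma modulus_ne_zero [simp]: "modulus b i \<noteq> \<zero>"
  unfolding modulus_def add_commute[of \<one>] by (rule basic(1))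

lemma tdef_modulus: "tdef t \<Longrightarrow> tdef u \<Longrightarrow> tdef (\<lambda>e. modulus (t e) (u e))"
  unfolding modulus_def by (intro tdef_intros)

text \<open>Takes the place of the factorial of \<open>N\<close>. With such a \<open>b\<close> the
  moduli of indices up to \<open>N\<close> are pairwise coprime.\<close>

lemma common_multiple: "\<exists>b. b \<noteq> \<zero> \<and> (\<forall>d. d \<preceq> N \<longrightarrow> d \<noteq> \<zero> \<longrightarrow> d divides b)"
proof -
  have "\<exists>b. b \<noteq> \<zero> \<and> (\<forall>d. d \<prec> N \<oplus> \<one> \<longrightarrow> d \<noteq> \<zero> \<longrightarrow> bdiv d b)"
  proof (rule sigma1_induct[of "\<lambda>b N. b \<noteq> \<zero> \<and> (\<forall>d. d \<prec> N \<oplus> \<one> \<longrightarrow> d \<noteq> \<zero> \<longrightarrow> bdiv d b)"])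
    fix n assume "\<exists>b. b \<noteq> \<zero> \<and> (\<forall>d. d \<prec> n \<oplus> \<one> \<longrightarrow> d \<noteq> \<zero> \<longrightarrow> bdiv d b)"
    then obtain b where b: "b \<noteq> \<zero>" "\<And>d. d \<preceq> n \<Longrightarrow> d \<noteq> \<zero> \<Longrightarrow> d divides b" by (auto simp: bdiv_iff)
    have "d divides (b \<otimes> (n \<oplus> \<one>))" if "d \<preceq> n \<oplus> \<one>" "d \<noteq> \<zero>" for d
      using that b(2)[of d] by (auto simp: le_succ_iff)
    then show "\<exists>b. b \<noteq> \<zero> \<and> (\<forall>d. d \<prec> (n \<oplus> \<one>) \<oplus> \<one> \<longrightarrow> d \<noteq> \<zero> \<longrightarrow> bdiv d b)"
      using b(1) by (intro exI[of _ "b \<otimes> (n \<oplus> \<one>)"]) (auto simp: bdiv_iff simp del: succ_le)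
  next
    have "d = \<zero>" if "d \<prec> \<zero> \<oplus> \<one>" for d using that unfolding lt_succ by simp
    then show "\<exists>b. b \<noteq> \<zero> \<and> (\<forall>d. d \<prec> \<zero> \<oplus> \<one> \<longrightarrow> d \<noteq> \<zero> \<longrightarrow> bdiv d b)"
      by (intro exI[of _ \<one>]) auto
  qed (intro definable_intros definable_bdiv)
  then show ?thesis by (auto simp: bdiv_iff)
qed

lemma common_multiple_modulus: "\<exists>c. c \<noteq> \<zero> \<and> (\<forall>i. i \<prec> N \<longrightarrow> modulus b i divides c)"
proof -
  have "\<exists>c. c \<noteq> \<zero> \<and> (\<forall>i. i \<prec> N \<longrightarrow> bdiv (modulus b i) c)"
  proof (rule sigma1_induct[of "\<lambda>c N. c \<noteq> \<zero> \<and> (\<forall>i. i \<prec> N \<longrightarrow> bdiv (modulus b i) c)"])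
    fix n assume "\<exists>c. c \<noteq> \<zero> \<and> (\<forall>i. i \<prec> n \<longrightarrow> bdiv (modulus b i) c)"
    then obtain c where c: "c \<noteq> \<zero>" "\<And>i. i \<prec> n \<Longrightarrow> modulus b i divides c" by (auto simp: bdiv_iff)
    then show "\<exists>c. c \<noteq> \<zero> \<and> (\<forall>i. i \<prec> n \<oplus> \<one> \<longrightarrow> bdiv (modulus b i) c)"
      by (intro exI[of _ "c \<otimes> modulus b n"]) (auto simp: bdiv_iff le_def)
  qed (intro definable_intros definable_bdiv tdef_modulus, auto intro!: exI[of _ \<one>])
  then show ?thesis by (auto simp: bdiv_iff)
qed

text \<open>\<open>a\<close> times the modulus exceeds \<open>a\<close> times
  \<open>(i + 1) * b\<close> by exactly \<open>a\<close>.\<close>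

lemma modulus_cancel:
  assumes "modulus b i divides a \<otimes> ((i \<oplus> \<one>) \<otimes> b)"
  shows "modulus b i divides a"
proof -
  have "modulus b i divides a \<otimes> ((i \<oplus> \<one>) \<otimes> b) \<oplus> a"
    unfolding modulus_def by (rule ar.dvdI[of _ _ a]) (simp add: ar.distrib_left ar.distrib_right add_ac ar.mult_ac)
  then show ?thesis using assms ar.dvd_add_right_iff by blast
qed

text \<open>Two moduli differ by \<open>d * b\<close>, where \<open>d\<close> is the distance of
  their indices, so the modulus divides \<open>a * d * b\<close>. Cancelling \<open>b\<close> leaves
  \<open>a * d\<close>. Since \<open>d\<close> divides \<open>b\<close>, the modulus then also
  divides \<open>a * ((i + 1) * b)\<close>, and a second cancellation leaves
  \<open>a\<close>.\<close>

lemma modulus_coprime: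
  assumes b: "\<And>d. d \<preceq> N \<Longrightarrow> d \<noteq> \<zero> \<Longrightarrow> d divides b"
    and ij: "i \<noteq> j" "i \<preceq> N" "j \<preceq> N" and dv: "modulus b i divides a \<otimes> modulus b j"
  shows "modulus b i divides a"
proof -
  let ?p = "modulus b i"
  have "\<exists>d. d \<noteq> \<zero> \<and> d \<preceq> N \<and> ?p divides a \<otimes> (d \<otimes> b)"
  proof (cases "i \<prec> j")
    case True
    then obtain d where d: "j = i \<oplus> d" "d \<noteq> \<zero>" using lt_iff_add by auto
    have "a \<otimes> modulus b j = a \<otimes> ?p \<oplus> a \<otimes> (d \<otimes> b)"
      unfolding modulus_def d by (simp add: ar.distrib_left ar.distrib_right add_ac)
    then have "?p divides a \<otimes> (d \<otimes> b)" using dv by (simp add: ar.mult_ac)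
    moreover have "d \<preceq> N" using ij(3) le_add(2)[of d i] d ar.order.trans by metis
    ultimately show ?thesis using d by blast
  next
    case False
    then have "j \<prec> i" using ij by order
    then obtain d where d: "i = j \<oplus> d" "d \<noteq> \<zero>" using lt_iff_add by auto
    have "a \<otimes> ?p = a \<otimes> modulus b j \<oplus> a \<otimes> (d \<otimes> b)"
      unfolding modulus_def d by (simp add: ar.distrib_left ar.distrib_right add_ac)
    moreover have "?p divides a \<otimes> ?p" by simp
    ultimately have "?p divides a \<otimes> (d \<otimes> b)" using dv ar.dvd_add_right_iff by metis
    moreover have "d \<preceq> N" using ij(2) le_add(2)[of d j] d ar.order.trans by metis
    ultimately show ?thesis using d by blast
  qed
  then obtain d where d: "d \<noteq> \<zero>" "d \<preceq> N" "?p divides a \<otimes> (d \<otimes> b)" by blast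
  from d(3) have "?p divides (a \<otimes> d) \<otimes> ((i \<oplus> \<one>) \<otimes> b)"
    using ar.dvd_mult2[of ?p "a \<otimes> (d \<otimes> b)" "i \<oplus> \<one>"] by (simp only: ar.mult_ac)
  then have *: "?p divides a \<otimes> d" by (rule modulus_cancel)
  obtain m where "b = d \<otimes> m" using b[OF d(2,1)] by (auto elim: ar.dvdE)
  then have "a \<otimes> ((i \<oplus> \<one>) \<otimes> b) = (a \<otimes> d) \<otimes> ((i \<oplus> \<one>) \<otimes> m)" by (simp add: ar.mult_ac)
  then have "?p divides a \<otimes> ((i \<oplus> \<one>) \<otimes> b)" using * by simp
  then show ?thesis by (rule modulus_cancel)
qed

text \<open>If every such number had a smaller one, \<Sigma>1 induction on \<open>k\<close> would
  descend \<open>k\<close> times and give some \<open>j\<close> with \<open>j + k \<le> c\<close>,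
  which is absurd for \<open>k = c + 1\<close>. Bounding \<open>j\<close> by \<open>c\<close> leaves
  the witness as the only unbounded quantifier.\<close>

lemma sigma1_least:
  assumes Q: "definable (\<lambda>e. Q (e 0) (e 1))" and ex: "\<exists>a. Q a c"
  shows "\<exists>c a. Q a c \<and> (\<forall>c' a. c' \<prec> c \<longrightarrow> \<not> Q a c')"
proof (rule ccontr)
  assume no: "\<not> ?thesis"
  \<comment> \<open>The quantifier over \<open>j\<close> lies inside the one over the witness, so
    the arguments of \<open>Q\<close> occur in the opposite order; \<open>?r\<close> swaps
    them.\<close>
  let ?r = "\<lambda>i::nat. if i = 0 then 1 else if i = 1 then 0 else i"
  have "inj ?r" by (rule injI) (auto split: if_splits)
  from definable_subst[OF Q this] have Q': "definable (\<lambda>e. Q (e (Suc 0)) (e 0))" by simp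
  have "\<exists>a j. j \<prec> c \<oplus> \<one> \<and> j \<oplus> (c \<oplus> \<one>) \<prec> c \<oplus> \<one> \<and> Q a j"
  proof (rule sigma1_induct[of "\<lambda>a k. \<exists>j. j \<prec> c \<oplus> \<one> \<and> j \<oplus> k \<prec> c \<oplus> \<one> \<and> Q a j"])
    fix n assume "\<exists>a j. j \<prec> c \<oplus> \<one> \<and> j \<oplus> n \<prec> c \<oplus> \<one> \<and> Q a j"
    then obtain a j where j: "j \<preceq> c" "j \<oplus> n \<preceq> c" "Q a j" by auto
    then obtain a' j' where "j' \<prec> j" "Q a' j'" using no by blast
    moreover from this(1) have "j' \<oplus> n \<prec> j \<oplus> n" by simp
    then have "j' \<oplus> n \<prec> c" using j(2) by order
    ultimately show "\<exists>a j. j \<prec> c \<oplus> \<one> \<and> j \<oplus> (n \<oplus> \<one>) \<prec> c \<oplus> \<one> \<and> Q a j"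
      using j by - (rule exI[of _ a'], rule exI[of _ j'], auto simp flip: add_assoc)
  next
    obtain a where "Q a c" using ex ..
    then show "\<exists>a j. j \<prec> c \<oplus> \<one> \<and> j \<oplus> \<zero> \<prec> c \<oplus> \<one> \<and> Q a j"
      by - (rule exI[of _ a], rule exI[of _ c], simp)
  qed (intro definable_intros, simp add: Q')
  then obtain a j where "j \<oplus> (c \<oplus> \<one>) \<preceq> c" by auto
  then have "j \<oplus> c \<prec> c" by (simp flip: add_assoc)
  then show False using le_add(2)[of c j] by order
qed

text \<open>Take \<open>c\<close> least such that some \<open>B\<close> bounds witnesses for all \<open>i\<close> with \<open>modulus b i\<close> not dividing \<open>c\<close>.
  If \<open>Q x i\<close> and \<open>modulus b i\<close> divided \<open>c\<close>, then dividing it out would give a smaller such number.\<close>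

lemma sigma1_bounded_code:
  assumes Q: "definable (\<lambda>e. Q (e 0) (e 1))"
  obtains b c B where "\<And>i. i \<prec> N \<Longrightarrow> (\<exists>x. Q x i) \<longleftrightarrow> \<not> modulus b i divides c"
    and "\<And>i x. i \<prec> N \<Longrightarrow> Q x i \<Longrightarrow> \<exists>x. x \<prec> B \<and> Q x i"
proof -
  obtain b where b: "b \<noteq> \<zero>" "\<And>d. d \<preceq> N \<Longrightarrow> d \<noteq> \<zero> \<Longrightarrow> d divides b"
    using common_multiple[of N] by blast
  \<comment> \<open>A single \<open>B\<close> for all indices keeps this \<Sigma>1. An index is
    excused from having a witness if its modulus divides \<open>c\<close>, and minimality of
    \<open>c\<close> will allow as few excuses as possible.\<close>
  let ?R = "\<lambda>B c. c \<noteq> \<zero> \<and> (\<forall>i. i \<prec> N \<longrightarrow> bdiv (modulus b i) c \<or> (\<exists>x. x \<prec> B \<and> Q x i))"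
  have dR: "definable (\<lambda>e. ?R (e 0) (e 1))"
    by (intro definable_intros definable_bdiv tdef_modulus) (use Q in simp)
  obtain c0 where "c0 \<noteq> \<zero>" "\<And>i. i \<prec> N \<Longrightarrow> modulus b i divides c0"
    using common_multiple_modulus[of N b] by blast
  then have "\<exists>B. ?R B c0" by (auto simp: bdiv_iff)
  from sigma1_least[of ?R, OF dR this] obtain c B where
    c: "c \<noteq> \<zero>" "\<And>i. i \<prec> N \<Longrightarrow> modulus b i divides c \<or> (\<exists>x. x \<prec> B \<and> Q x i)"
    and least: "\<And>c' B. c' \<prec> c \<Longrightarrow> \<not> ?R B c'" unfolding bdiv_iff[OF modulus_ne_zero] by blast
  have key: "\<not> modulus b i divides c" if i: "i \<prec> N" and x: "Q x i" for i x
  proof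
    assume "modulus b i divides c"
    then obtain c' where c': "c = modulus b i \<otimes> c'" by (auto elim: ar.dvdE)
    have "c' \<noteq> \<zero>" using c(1) c' by auto
    have "c' \<prec> c' \<oplus> (i \<oplus> \<one>) \<otimes> b \<otimes> c'"
      using \<open>c' \<noteq> \<zero>\<close> b(1) ar.mult_eq_0_iff gt_zero_iff by simp
    then have "c' \<prec> c" unfolding c' modulus_def by (simp add: ar.distrib_right)
    \<comment> \<open>Large enough for the previous witnesses and for the new witness
      \<open>x\<close>.\<close>
    define B' where "B' = B \<oplus> (x \<oplus> \<one>)"
    have "bdiv (modulus b j) c' \<or> (\<exists>x. x \<prec> B' \<and> Q x j)" if j: "j \<prec> N" for j
    proof (cases "j = i")
      case True
      have "x \<prec> B'" unfolding B'_def by (simp flip: add_assoc)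
      then show ?thesis using x True by blast
    next
      case False
      from c(2)[OF j] show ?thesis
      proof
        assume "modulus b j divides c"
        then have "modulus b j divides c' \<otimes> modulus b i" unfolding c' by (simp add: ar.mult_ac)
        then have "modulus b j divides c'"
          using modulus_coprime[of N b j i c'] b(2) False i j ar.less_imp_le by blast
        then show ?thesis by (simp add: bdiv_iff)
      next
        assume "\<exists>x. x \<prec> B \<and> Q x j"
        then obtain y where "y \<prec> B" "Q y j" by blast
        moreover from this(1) have "y \<prec> B'" unfolding B'_def
          using le_add(1)[of B "x \<oplus> \<one>"] by order
        ultimately show ?thesis by blast
      qed
    qed
    then show False using least[OF \<open>c' \<prec> c\<close>, of B'] \<open>c' \<noteq> \<zero>\<close> by blast
  qed
  show ?thesis by (rule that[of b c B]) (use key c(2) in blast)+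
qed

text \<open>Strong in that only the indices having a witness are bounded, without the set of these
  indices being given. In this form it later bounds values of functions and sizes of
  components.\<close>

lemma strong_bounding:
  assumes "definable (\<lambda>e. Q (e 0) (e 1))"
  shows "\<exists>B. \<forall>i. i \<prec> N \<longrightarrow> (\<exists>x. Q x i) \<longrightarrow> (\<exists>x. x \<prec> B \<and> Q x i)"
  by (rule sigma1_bounded_code[OF assms, of N]) blast

lemma definable_least:
  assumes "definable (\<lambda>e. P (e 0))" "P n"
  shows "\<exists>n. P n \<and> (\<forall>m. m \<prec> n \<longrightarrow> \<not> P m)"
proof -
  have "definable (\<lambda>e. P (e 1))" using definable_subst[OF assms(1), of Suc] by simp
  from sigma1_least[of "\<lambda>a. P", OF this] assms(2) show ?thesis by blast
qed

end

section \<open>Arithmetical comprehension as closure under projection\<close>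

context henkin
begin

text \<open>A formula has finitely many variables, so the relevant part of an assignment fits into
  one tuple of standard length.\<close>

lemma definable_support:
  assumes "definable P"
  obtains m where "\<And>e e'. (\<And>i. i < m \<Longrightarrow> e i = e' i) \<Longrightarrow> P e \<longleftrightarrow> P e'"
proof -
  obtain p S \<phi> where 1: "\<And>e. P e \<longleftrightarrow> sat M (mix p e) S \<phi>" using assms unfolding definable_def by blast
  have "finite (nvars \<phi>)" by simp
  then obtain m where m: "\<forall>i \<in> nvars \<phi>. i < m"
    unfolding finite_nat_set_iff_bounded ..
  have "P e \<longleftrightarrow> P e'" if "\<And>i. i < m \<Longrightarrow> e i = e' i" for e e'
    unfolding 1 using that m by (intro sat_cong) (auto simp: mix_def)
  then show ?thesis using that by blast
qed

lemma definable_section: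
  assumes "definable P"
  shows "definable (\<lambda>e. P (c(x := e 0)))"
proof -
  obtain p S \<phi> where 1: "bounded_fm \<phi>" "range S \<subseteq> Sets M"
    "\<And>e. P e \<longleftrightarrow> sat M (mix p e) S \<phi>" using assms unfolding definable_def by blast
  \<comment> \<open>Argument \<open>x\<close> becomes argument 0. Every other slot, whether argument
    or parameter, moves to an odd slot, where \<open>c\<close> and \<open>p\<close> supply fixed
    values.\<close>
  define r where "r i = (if i = 2 * x then 0 else 2 * i + 1)" for i
  have "inj r" by (rule injI) (auto simp: r_def split: if_splits)
  have "mix (mix p c) e \<circ> r = mix p (c(x := e 0))" for e
    by (auto simp: fun_eq_iff r_def mix_def)
  then have "P (c(x := e 0)) \<longleftrightarrow> sat M (mix (mix p c) e) S (ren r id \<phi>)" for e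
    by (simp only: 1(3) sat_ren[OF \<open>inj r\<close> inj_on_id] comp_id)
  then show ?thesis
    using 1 \<open>inj r\<close> by (intro definableI[of "ren r id \<phi>" S _ "mix p c"] bounded_fm_ren)
qed

fun tup :: "nat \<Rightarrow> (nat \<Rightarrow> 'a) \<Rightarrow> 'a" where
  "tup 0 e = zer M"
| "tup (Suc m) e = pair M (e m) (tup m e)"

lemma tdef_tup: "tdef (\<lambda>e. tup m (\<lambda>i. e (i + k)))"
  by (induction m) (auto intro: tdef_intros)

lemma tdef_tm_val: "tdef (\<lambda>e. tm_val M e t)"
  by (induction t) (auto intro: tdef_intros)

text \<open>Here \<open>m\<close> is a number of the metatheory, and the block of quantifiers comes
  from \<open>m\<close> uses of \<open>definable_bex\<close>. The common bound is
  \<open>e 0\<close>, which will be the code of the tuple and as such dominates its entries.\<close>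

lemma definable_bex_tuple:
  "definable P \<Longrightarrow> definable (\<lambda>e. \<exists>f. (\<forall>i<m. lt M (f i) (add M (e 0) (one M))) \<and>
     P (\<lambda>i. if i < m then f i else e (i - m)))"
proof (induction m arbitrary: P)
  case (Suc m)
  have "definable (\<lambda>e. \<exists>a. lt M a (add M (e m) (one M)) \<and> P (case_nat a e))"
  proof (intro definable_bex tdef_intros)
    have "case_nat (e 0) (\<lambda>i. e (Suc i)) = e" for e :: "nat \<Rightarrow> 'a"
      by (auto simp: fun_eq_iff split: nat.splits)
    then show "definable (\<lambda>e. P (case_nat (e 0) (\<lambda>i. e (Suc i))))" using Suc.prems by simp
  qed
  from Suc.IH[OF this] show ?case
  proof (rule back_subst[of definable], intro ext)
    fix e :: "nat \<Rightarrow> 'a"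
    have cn: "case_nat a (\<lambda>i. if i < m then f i else e (i - m)) =
      (\<lambda>i. if i < Suc m then case_nat a f i else e (i - Suc m))" for a f
      by (auto simp: fun_eq_iff split: nat.splits)
    show "(\<exists>f. (\<forall>i<m. lt M (f i) (add M (e 0) (one M))) \<and>
           (\<exists>a. lt M a (add M (if m < m then f m else e (m - m)) (one M)) \<and>
           P (case_nat a (\<lambda>i. if i < m then f i else e (i - m))))) =
      (\<exists>f. (\<forall>i<Suc m. lt M (f i) (add M (e 0) (one M))) \<and>
         P (\<lambda>i. if i < Suc m then f i else e (i - Suc m)))" (is "?L = ?R")
    proof
      assume ?L
      then obtain f a where *: "\<forall>i<m. lt M (f i) (add M (e 0) (one M))" "lt M a (add M (e 0) (one M))"
        "P (\<lambda>i. if i < Suc m then case_nat a f i else e (i - Suc m))" unfolding cn by auto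
      then show ?R by (intro exI[of _ "case_nat a f"]) (auto split: nat.splits)
    next
      assume ?R
      then obtain f where *: "\<forall>i<Suc m. lt M (f i) (add M (e 0) (one M))"
        "P (\<lambda>i. if i < Suc m then f i else e (i - Suc m))" by blast
      have f: "(case i of 0 \<Rightarrow> f 0 | Suc j \<Rightarrow> f (Suc j)) = f i" for i by (cases i) auto
      show ?L unfolding cn
        by (rule exI[of _ "\<lambda>i. f (Suc i)"], intro conjI exI[of _ "f 0"]) (use * f in \<open>auto cong: if_cong\<close>)
    qed
  qed
qed simp

end

context rca
begin

lemma tup_inj: "tup m e = tup m e' \<Longrightarrow> i < m \<Longrightarrow> e i = e' i"
  by (induction m) (auto simp: less_Suc_eq)

lemma le_tup: "i < m \<Longrightarrow> e i \<preceq> tup m e"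
proof (induction m)
  case (Suc m)
  then show ?case using le_pair(2)[of "tup m e" "e m"] ar.order.trans
    by (auto simp: less_Suc_eq)
qed simp

definition projective where
  "projective \<longleftrightarrow> (\<forall>Z\<in>Sets M. {n. \<exists>x. \<langle>n, x\<rangle> \<in> Z} \<in> Sets M)"

text \<open>Let \<open>Z\<close> pair the code of the relevant arguments with a witness. Decoding is
  a bounded search, so \<open>Z\<close> is a set; its domain is a set by \<open>projective\<close>,
  and the quantified predicate says that the code of the arguments lies in this domain.\<close>

lemma definable_ex_projective:
  assumes projective and "definable (\<lambda>e. Q (e 0) (\<lambda>i. e (Suc i)))"
  shows "definable (\<lambda>e. \<exists>a. Q a e)"
proof -
  define P where "P e = Q (e 0) (\<lambda>i. e (Suc i))" for e
  have P: "definable P" using assms(2) unfolding P_def .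
  obtain m where "\<And>e e'. (\<And>i. i < m \<Longrightarrow> e i = e' i) \<Longrightarrow> P e \<longleftrightarrow> P e'"
    using definable_support[OF P] by blast
  \<comment> \<open>Weakened to \<open>Suc m\<close> arguments: argument 0 is the witness and the
    next \<open>m\<close> arguments make up the tuple.\<close>
  then have m: "P e \<longleftrightarrow> P e'" if "\<And>i. i < Suc m \<Longrightarrow> e i = e' i" for e e' using that less_SucI by blast
  define Z where "Z = {z. \<exists>f. (\<forall>i<Suc m. f i \<prec> z \<oplus> \<one>) \<and> z = \<langle>tup m (\<lambda>i. f (i + 1)), f 0\<rangle> \<and> P f}"
  have "definable (\<lambda>e. e (Suc m) = \<langle>tup m (\<lambda>i. e (i + 1)), e 0\<rangle> \<and> P e)"
    by (intro definable_intros tdef_tup P)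
  from definable_bex_tuple[OF this, of "Suc m"]
  have "definable (\<lambda>e. \<exists>f. (\<forall>i<Suc m. f i \<prec> e 0 \<oplus> \<one>) \<and>
     e 0 = \<langle>tup m (\<lambda>i. if i + 1 < Suc m then f (i + 1) else e (i + 1 - Suc m)), f 0\<rangle> \<and>
     P (\<lambda>i. if i < Suc m then f i else e (i - Suc m)))" by simp
  moreover have "tup k (\<lambda>i. if i + 1 < Suc m then f (i + 1) else e (i + 1 - Suc m)) = tup k (\<lambda>i. f (i + 1))"
    if "k \<le> m" for k f e using that by (induction k) auto
  moreover have "P (\<lambda>i. if i < Suc m then f i else e (i - Suc m)) = P f" for f e
    by (rule m) simp
  ultimately have "definable (\<lambda>e. \<exists>f. (\<forall>i<Suc m. f i \<prec> e 0 \<oplus> \<one>) \<and>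
     e 0 = \<langle>tup m (\<lambda>i. f (i + 1)), f 0\<rangle> \<and> P f)" by simp
  then have "Z \<in> Sets M" unfolding Z_def by (rule comprehension)
  then have R: "{n. \<exists>x. \<langle>n, x\<rangle> \<in> Z} \<in> Sets M" using assms(1) unfolding projective_def by blast
  have "(\<exists>a. Q a e) \<longleftrightarrow> tup m (\<lambda>i. e (i + 0)) \<in> {n. \<exists>x. \<langle>n, x\<rangle> \<in> Z}" for e
  proof
    assume "\<exists>a. Q a e"
    then obtain a where "Q a e" ..
    then have "P (case_nat a e)" unfolding P_def by simp
    moreover have "e i \<preceq> \<langle>tup m e, a\<rangle>" if "i < m" for i
      using le_tup[OF that, of e] le_pair(1)[of "tup m e" a] by (rule ar.order.trans)
    then have "\<forall>i<Suc m. case_nat a e i \<prec> \<langle>tup m e, a\<rangle> \<oplus> \<one>"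
      by (auto split: nat.splits)
    ultimately have "\<langle>tup m e, a\<rangle> \<in> Z"
      unfolding Z_def by (intro CollectI exI[of _ "case_nat a e"]) simp
    then show "tup m (\<lambda>i. e (i + 0)) \<in> {n. \<exists>x. \<langle>n, x\<rangle> \<in> Z}" by auto
  next
    assume "tup m (\<lambda>i. e (i + 0)) \<in> {n. \<exists>x. \<langle>n, x\<rangle> \<in> Z}"
    then obtain f where f: "tup m e = tup m (\<lambda>i. f (i + 1))" "P f" unfolding Z_def by auto
    have "P (case_nat (f 0) e) \<longleftrightarrow> P f"
      by (rule m) (use tup_inj[OF f(1)] in \<open>auto split: nat.splits\<close>)
    then show "\<exists>a. Q a e" using f(2) unfolding P_def by auto
  qed
  moreover have "definable (\<lambda>e. tup m (\<lambda>i. e (i + 0)) \<in> {n. \<exists>x. \<langle>n, x\<rangle> \<in> Z})"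
    by (rule definable_mem[OF R tdef_tup])
  ultimately show ?thesis by simp
qed

lemma definable_all_projective:
  assumes projective and "definable (\<lambda>e. Q (e 0) (\<lambda>i. e (Suc i)))"
  shows "definable (\<lambda>e. \<forall>a. Q a e)"
  using definable_neg[OF definable_ex_projective[OF assms(1) definable_neg[OF assms(2)]]] by (simp only: not_ex not_not)

lemma definable_sat:
  assumes projective "range S \<subseteq> Sets M"
  shows "arithmetical \<phi> \<Longrightarrow> definable (\<lambda>e. sat M e S \<phi>)"
proof (induction \<phi>)
  case (AllN x \<phi>)
  let ?r = "\<lambda>i. if i = x then 0 else Suc i"
  have "inj ?r" by (rule injI) (auto split: if_splits)
  have "definable (\<lambda>e. sat M (\<lambda>i. e (?r i)) S \<phi>)"
    by (rule definable_subst[OF AllN.IH \<open>inj ?r\<close>]) (use AllN.prems in simp)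
  moreover have "(\<lambda>i. e (?r i)) = (\<lambda>i. e (Suc i))(x := e 0)" for e :: "nat \<Rightarrow> 'a" by auto
  ultimately have "definable (\<lambda>e. sat M ((\<lambda>i. e (Suc i))(x := e 0)) S \<phi>)" by (simp only:)
  then show ?case unfolding sat.simps by (rule definable_all_projective[OF assms(1)])
next
  case (ExN x \<phi>)
  let ?r = "\<lambda>i. if i = x then 0 else Suc i"
  have "inj ?r" by (rule injI) (auto split: if_splits)
  have "definable (\<lambda>e. sat M (\<lambda>i. e (?r i)) S \<phi>)"
    by (rule definable_subst[OF ExN.IH \<open>inj ?r\<close>]) (use ExN.prems in simp)
  moreover have "(\<lambda>i. e (?r i)) = (\<lambda>i. e (Suc i))(x := e 0)" for e :: "nat \<Rightarrow> 'a" by auto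
  ultimately have "definable (\<lambda>e. sat M ((\<lambda>i. e (Suc i))(x := e 0)) S \<phi>)" by (simp only:)
  then show ?case unfolding sat.simps by (rule definable_ex_projective[OF assms(1)])
next
  case (Mem t X)
  have "S X \<in> Sets M" using assms(2) by auto
  then show ?case by (auto intro!: definable_mem tdef_tm_val)
qed (auto intro!: definable_intros tdef_tm_val)

theorem ACA0_iff_projective: "ACA0 M \<longleftrightarrow> projective"
proof
  assume "ACA0 M"
  then have ac: "arithmetical_comprehension M" unfolding ACA0_def by simp
  let ?\<phi> = "ExN 1 (Mem (Plus (Times (Plus (NVar 0) (NVar 1)) (Plus (NVar 0) (NVar 1))) (NVar 0)) 0)"
  show projective unfolding projective_def
  proof
    fix Z assume "Z \<in> Sets M"
    then have "arithmetical ?\<phi> \<and> range (\<lambda>_::nat. Z) \<subseteq> Sets M" by auto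
    then have "{n. sat M (e(0 := n)) (\<lambda>_::nat. Z) ?\<phi>} \<in> Sets M" for e
      using ac unfolding arithmetical_comprehension_def by blast
    then show "{n. \<exists>x. \<langle>n, x\<rangle> \<in> Z} \<in> Sets M" by (simp add: pair_def)
  qed
next
  assume pr: projective
  have "{n. sat M (e(x := n)) S \<phi>} \<in> Sets M" if "arithmetical \<phi>" "range S \<subseteq> Sets M" for \<phi> x e S
    by (rule comprehension[OF definable_section[OF definable_sat[OF pr that(2,1)]]])
  then show "ACA0 M" unfolding ACA0_def arithmetical_comprehension_def using rca0 by blast
qed

section \<open>Boundedness and reachability\<close>

lemma finite_bounded: "finite X \<Longrightarrow> finite_in M X"
proof (induction rule: finite_induct)
  case (insert x X)
  then obtain b where "\<forall>y\<in>X. y \<prec> b" unfolding finite_in_def by blast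
  then have "y \<prec> b \<oplus> (x \<oplus> \<one>)" if "y \<in> X" for y
    using that le_add(1)[of b "x \<oplus> \<one>"] ar.order.strict_trans2 by blast
  then show ?case unfolding finite_in_def
    by (intro exI[of _ "b \<oplus> (x \<oplus> \<one>)"]) (auto simp: lt_add_succ simp flip: add_assoc)
qed (simp add: finite_in_def)

text \<open>\<open>F\<close> may be the graph of a function on all of \<open>M\<close>; cutting it
  off after \<open>n\<close> yields the finite sequence that \<open>joined\<close> demands.\<close>

lemma joinedI:
  assumes F: "F \<in> Sets M" and f: "\<And>i w. i \<preceq> n \<Longrightarrow> \<langle>i, w\<rangle> \<in> F \<longleftrightarrow> w = f i"
    and "f \<zero> \<in> V" "f n \<in> V" "\<And>i. i \<prec> n \<Longrightarrow> \<langle>f i, f (i \<oplus> \<one>)\<rangle> \<in> K"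
  shows "joined M V K (f \<zero>) (f n)"
proof -
  let ?G = "{z. \<exists>i. i \<prec> n \<oplus> \<one> \<and> (\<exists>w. w \<prec> z \<oplus> \<one> \<and> z = \<langle>i, w\<rangle> \<and> z \<in> F)}"
  have "definable (\<lambda>e. \<exists>i. i \<prec> n \<oplus> \<one> \<and> (\<exists>w. w \<prec> e 0 \<oplus> \<one> \<and> e 0 = \<langle>i, w\<rangle> \<and> e 0 \<in> F))"
    by (intro definable_intros F)
  then have G: "?G \<in> Sets M" by (rule comprehension)
  then obtain G where G: "G \<in> Sets M" "G = ?G" by blast
  have *: "\<langle>i, w\<rangle> \<in> G \<longleftrightarrow> i \<preceq> n \<and> w = f i" for i w
    using f[of i] le_pair(2)[of w i] unfolding G(2) by auto
  have **: "\<exists>i w. i \<prec> n \<oplus> \<one> \<and> z = \<langle>i, w\<rangle>" if "z \<in> G" for z using that unfolding G(2) by auto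
  have "fin_seq M G (n \<oplus> \<one>)" unfolding fin_seq_def using * ** by auto
  then show ?thesis unfolding joined_def
    using assms(3-5) G(1) by (intro conjI exI[of _ n] bexI[of _ G]) (auto simp: * ar.less_imp_le)
qed

lemma joinedE:
  assumes "joined M V K u v"
  obtains F f n where "F \<in> Sets M" "\<And>i w. i \<preceq> n \<Longrightarrow> \<langle>i, w\<rangle> \<in> F \<longleftrightarrow> w = f i"
    "f \<zero> = u" "f n = v" "u \<in> V" "v \<in> V" "\<And>i. i \<prec> n \<Longrightarrow> \<langle>f i, f (i \<oplus> \<one>)\<rangle> \<in> K"
proof -
  obtain F n where F: "F \<in> Sets M" "\<And>i. i \<preceq> n \<Longrightarrow> \<exists>!w. \<langle>i, w\<rangle> \<in> F"
    "\<langle>\<zero>, u\<rangle> \<in> F" "\<langle>n, v\<rangle> \<in> F" "u \<in> V" "v \<in> V"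
    "\<And>i w w'. i \<prec> n \<Longrightarrow> \<langle>i, w\<rangle> \<in> F \<Longrightarrow> \<langle>i \<oplus> \<one>, w'\<rangle> \<in> F \<Longrightarrow> \<langle>w, w'\<rangle> \<in> K"
    using assms unfolding joined_def fin_seq_def lt_succ by blast
  define f where "f i = (THE w. \<langle>i, w\<rangle> \<in> F)" for i
  have f: "\<langle>i, w\<rangle> \<in> F \<longleftrightarrow> w = f i" if "i \<preceq> n" for i w
    unfolding f_def using theI'[OF F(2)[OF that]] F(2)[OF that] by blast
  show ?thesis
  proof (rule that[of F n f])
    show "\<langle>f i, f (i \<oplus> \<one>)\<rangle> \<in> K" if "i \<prec> n" for i
      by (rule F(7)[OF that]) (use f[of i] f[of "i \<oplus> \<one>"] that in \<open>auto simp: ar.less_imp_le\<close>)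
    show "f \<zero> = u" using f[of \<zero> u] F(3) by simp
    show "f n = v" using f[of n v] F(4) by simp
  qed (use F f in auto)
qed

lemma joined_refl: "u \<in> V \<Longrightarrow> joined M V K u u"
proof -
  assume u: "u \<in> V"
  have "definable (\<lambda>e. e 0 = \<langle>\<zero>, u\<rangle>)" by (intro definable_intros)
  then have "{z. z = \<langle>\<zero>, u\<rangle>} \<in> Sets M" by (rule comprehension)
  from joinedI[OF this, of \<zero> "\<lambda>_. u" V K] u show ?thesis by simp
qed

lemma joined_edge:
  assumes "u \<in> V" "v \<in> V" "\<langle>u, v\<rangle> \<in> K"
  shows "joined M V K u v"
proof -
  have "definable (\<lambda>e. e 0 = \<langle>\<zero>, u\<rangle> \<or> e 0 = \<langle>\<one>, v\<rangle>)" by (intro definable_intros)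
  then have "{z. z = \<langle>\<zero>, u\<rangle> \<or> z = \<langle>\<one>, v\<rangle>} \<in> Sets M" by (rule comprehension)
  moreover have "i = \<zero> \<or> i = \<one>" if "i \<preceq> \<one>" for i
    using that le_succ_iff[of i \<zero>] by auto
  moreover have "i = \<zero>" if "i \<prec> \<one>" for i
    using that lt_succ[of i \<zero>] by simp
  ultimately show ?thesis
    using joinedI[of "{z. z = \<langle>\<zero>, u\<rangle> \<or> z = \<langle>\<one>, v\<rangle>}" \<one> "\<lambda>i. if i = \<zero> then u else v" V K] assms
    by fastforce
qed

lemma joined_sym:
  assumes "joined M V K u v" and K: "\<And>u v. \<langle>u, v\<rangle> \<in> K \<Longrightarrow> \<langle>v, u\<rangle> \<in> K"
  shows "joined M V K v u"
proof -
  obtain F f n where F: "F \<in> Sets M" "\<And>i w. i \<preceq> n \<Longrightarrow> \<langle>i, w\<rangle> \<in> F \<longleftrightarrow> w = f i"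
    "f \<zero> = u" "f n = v" "u \<in> V" "v \<in> V" "\<And>i. i \<prec> n \<Longrightarrow> \<langle>f i, f (i \<oplus> \<one>)\<rangle> \<in> K"
    using assms(1) by (rule joinedE) (rule that; assumption)
  have "definable (\<lambda>e. \<exists>i. i \<prec> n \<oplus> \<one> \<and> (\<exists>w. w \<prec> e 0 \<oplus> \<one> \<and> e 0 = \<langle>i, w\<rangle> \<and>
    (\<exists>j. j \<prec> n \<oplus> \<one> \<and> i \<oplus> j = n \<and> \<langle>j, w\<rangle> \<in> F)))" by (intro definable_intros F)
  then have "{z. \<exists>i. i \<prec> n \<oplus> \<one> \<and> (\<exists>w. w \<prec> z \<oplus> \<one> \<and> z = \<langle>i, w\<rangle> \<and>
    (\<exists>j. j \<prec> n \<oplus> \<one> \<and> i \<oplus> j = n \<and> \<langle>j, w\<rangle> \<in> F))} \<in> Sets M" (is "?G \<in> _") by (rule comprehension)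
  moreover have "\<langle>i, w\<rangle> \<in> ?G \<longleftrightarrow> w = f (n \<ominus> i)" if i: "i \<preceq> n" for i w
  proof -
    obtain j where j: "n = i \<oplus> j" using i le_iff_add by blast
    then have "\<langle>i, w\<rangle> \<in> ?G \<longleftrightarrow> \<langle>j, w\<rangle> \<in> F" by auto
    also have "\<dots> \<longleftrightarrow> w = f (n \<ominus> i)" using F(2)[of j w] j by simp
    finally show ?thesis .
  qed
  moreover have "\<langle>f (n \<ominus> i), f (n \<ominus> (i \<oplus> \<one>))\<rangle> \<in> K" if "i \<prec> n" for i
  proof -
    obtain k where k: "n = i \<oplus> (k \<oplus> \<one>)" using \<open>i \<prec> n\<close> lt_iff_add by blast
    then have "n \<ominus> i = k \<oplus> \<one>" by simp
    moreover have "n \<ominus> (i \<oplus> \<one>) = k" using k msub_add[of "i \<oplus> \<one>" k] by (simp add: add_ac)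
    moreover have "k \<prec> n" unfolding k by (simp flip: add_assoc)
    ultimately show ?thesis using K F(7) by simp
  qed
  ultimately have "joined M V K (f (n \<ominus> \<zero>)) (f (n \<ominus> n))"
    using F(3-6) msub_add[of \<zero> n] msub_add[of n \<zero>] by (intro joinedI[of ?G n "\<lambda>i. f (n \<ominus> i)"]) auto
  then show ?thesis using F(3,4) by simp
qed

lemma joined_trans:
  assumes "joined M V K u v" "joined M V K v w"
  shows "joined M V K u w"
proof -
  obtain F f n where F: "F \<in> Sets M" "\<And>i w. i \<preceq> n \<Longrightarrow> \<langle>i, w\<rangle> \<in> F \<longleftrightarrow> w = f i"
    "f \<zero> = u" "f n = v" "u \<in> V" "v \<in> V" "\<And>i. i \<prec> n \<Longrightarrow> \<langle>f i, f (i \<oplus> \<one>)\<rangle> \<in> K"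
    using assms(1) by (rule joinedE) (rule that; assumption)
  obtain G g m where G: "G \<in> Sets M" "\<And>i w. i \<preceq> m \<Longrightarrow> \<langle>i, w\<rangle> \<in> G \<longleftrightarrow> w = g i"
    "g \<zero> = v" "g m = w" "v \<in> V" "w \<in> V" "\<And>i. i \<prec> m \<Longrightarrow> \<langle>g i, g (i \<oplus> \<one>)\<rangle> \<in> K"
    using assms(2) by (rule joinedE) (rule that; assumption)
  define h where "h i = (if i \<preceq> n then f i else g (i \<ominus> n))" for i
  have h: "h (n \<oplus> j) = g j" for j
    unfolding h_def using F(4) G(3) by (auto simp: le_def)
  have "definable (\<lambda>e. \<exists>i. i \<prec> e 0 \<oplus> \<one> \<and> (\<exists>w. w \<prec> e 0 \<oplus> \<one> \<and> e 0 = \<langle>i, w\<rangle> \<and>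
    ((i \<preceq> n \<and> \<langle>i, w\<rangle> \<in> F) \<or> (n \<prec> i \<and> (\<exists>k. k \<prec> i \<oplus> \<one> \<and> i = n \<oplus> k \<and> \<langle>k, w\<rangle> \<in> G)))))"
    by (intro definable_intros definable_le F G)
  then have "{z. \<exists>i. i \<prec> z \<oplus> \<one> \<and> (\<exists>w. w \<prec> z \<oplus> \<one> \<and> z = \<langle>i, w\<rangle> \<and>
    ((i \<preceq> n \<and> \<langle>i, w\<rangle> \<in> F) \<or> (n \<prec> i \<and> (\<exists>k. k \<prec> i \<oplus> \<one> \<and> i = n \<oplus> k \<and> \<langle>k, w\<rangle> \<in> G))))} \<in> Sets M"
    (is "?H \<in> _") by (rule comprehension)
  moreover have "\<langle>i, w\<rangle> \<in> ?H \<longleftrightarrow> w = h i" if i: "i \<preceq> n \<oplus> m" for i w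
  proof (cases "i \<preceq> n")
    case True
    then show ?thesis using F(2)[of i w] le_pair[of i w] by (auto simp: h_def)
  next
    case False
    then obtain k where k: "i = n \<oplus> k" using le_iff_add ar.linear by blast
    then have "k \<preceq> m" using i by simp
    then show ?thesis using False G(2)[of k w] k le_pair[of i w] by (auto simp: h gt_zero_iff)
  qed
  moreover have "\<langle>h i, h (i \<oplus> \<one>)\<rangle> \<in> K" if "i \<prec> n \<oplus> m" for i
  proof (cases "i \<prec> n")
    case True
    then show ?thesis using F(7)[of i] by (simp add: h_def ar.less_imp_le)
  next
    case False
    then obtain k where k: "i = n \<oplus> k" using le_iff_add ar.not_less by blast
    then have "k \<prec> m" using that by simp
    then show ?thesis using G(7)[of k] unfolding k add_assoc h by blast
  qed
  moreover have "h \<zero> = u" using F(3) by (simp add: h_def)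
  moreover have "h (n \<oplus> m) = w" using h G(4) by simp
  ultimately show ?thesis using joinedI[of ?H "n \<oplus> m" h V K] F(5) G(6) by simp
qed

end

section \<open>From Euler paths to arithmetical comprehension\<close>

lemma card_half:
  assumes "finite X" "X = A \<union> {x} \<union> B" "bij_betw f A B" "x \<notin> A" "x \<notin> B" "A \<inter> B = {}"
  shows "odd (card X)"
proof -
  have fin: "finite A" "finite B" using assms(1,2) by auto
  have "card A = card B" using assms(3) by (rule bij_betw_same_card)
  moreover have "X = insert x (A \<union> B)" using assms(2) by auto
  ultimately have "card X = Suc (card B + card B)" using fin assms(4-6)
    by (simp add: card_Un_disjoint)
  then show ?thesis by simp
qed

context rca
begin

text \<open>The numbers below \<open>k + k + 1\<close> consist of those below \<open>k\<close>, of
  \<open>k\<close> itself and of a rest that the shift by \<open>k + 1\<close> matches with the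
  first group. So the HOL cardinality is odd, whatever element \<open>k\<close> is.\<close>

lemma odd_card:
  assumes "finite X" "has_card M X (k \<oplus> k \<oplus> \<one>)"
  shows "odd (card X)"
proof -
  let ?n = "k \<oplus> k \<oplus> \<one>"
  obtain F where *: "fin_seq M F ?n" "\<forall>i u. \<langle>i, u\<rangle> \<in> F \<longrightarrow> u \<in> X" "\<forall>u\<in>X. \<exists>!i. \<langle>i, u\<rangle> \<in> F"
    using assms(2) unfolding has_card_def by (elim bexE conjE) (rule that)
  note F = *(1) *(2)[rule_format] *(3)[rule_format]
  define g where "g u = (THE i. \<langle>i, u\<rangle> \<in> F)" for u
  have g: "\<langle>g u, u\<rangle> \<in> F" if "u \<in> X" for u unfolding g_def by (rule theI'[OF F(3)[OF that]])
  have lt: "i \<prec> ?n" if "\<langle>i, u\<rangle> \<in> F" for i u using F(1) that unfolding fin_seq_def by fastforce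
  have un: "\<exists>!u. \<langle>i, u\<rangle> \<in> F" if "i \<prec> ?n" for i using F(1) that unfolding fin_seq_def by blast
  have bij: "bij_betw g X {i. i \<prec> ?n}"
  proof (rule bij_betwI')
    show "g u \<in> {i. i \<prec> ?n}" if "u \<in> X" for u using g[OF that] lt by blast
    show "(g u = g v) = (u = v)" if "u \<in> X" "v \<in> X" for u v
      using g[OF that(1)] g[OF that(2)] un[OF lt] by metis
    show "\<exists>u\<in>X. i = g u" if i: "i \<in> {i. i \<prec> ?n}" for i
    proof -
      obtain u where "\<langle>i, u\<rangle> \<in> F" using un[of i] i by blast
      moreover from this have "u \<in> X" by (rule F(2))
      ultimately show ?thesis using F(3) g by blast
    qed
  qed
  have fin: "finite {i. i \<prec> ?n}" using bij assms(1) bij_betw_finite by blast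
  have "odd (card {i. i \<prec> ?n})"
  proof (rule card_half[OF fin, of "{i. i \<prec> k}" k "{i. k \<prec> i \<and> i \<prec> ?n}" "\<lambda>i. k \<oplus> i \<oplus> \<one>"])
    have le: "i \<prec> ?n" if "i \<preceq> k" for i
    proof -
      have "k \<preceq> k \<oplus> k" by simp
      then show ?thesis unfolding lt_succ using that by order
    qed
    show "{i. i \<prec> ?n} = {i. i \<prec> k} \<union> {k} \<union> {i. k \<prec> i \<and> i \<prec> ?n}"
    proof (rule set_eqI)
      fix i
      consider "i \<prec> k" | "i = k" | "k \<prec> i" using lt_total[of i k] by (elim disjE) simp_all
      then show "i \<in> {i. i \<prec> ?n} \<longleftrightarrow> i \<in> {i. i \<prec> k} \<union> {k} \<union> {i. k \<prec> i \<and> i \<prec> ?n}"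
        using le[of i] by cases (simp_all add: le_def, blast)
    qed
    show "bij_betw (\<lambda>i. k \<oplus> i \<oplus> \<one>) {i. i \<prec> k} {i. k \<prec> i \<and> i \<prec> ?n}"
    proof (rule bij_betwI')
      show "\<exists>j\<in>{i. i \<prec> k}. i = k \<oplus> j \<oplus> \<one>" if i: "i \<in> {i. k \<prec> i \<and> i \<prec> ?n}" for i
      proof -
        obtain j where j: "i = k \<oplus> (j \<oplus> \<one>)" using i lt_iff_add by blast
        then have "j \<prec> k" using i by simp
        then show ?thesis using j by (auto simp: add_assoc)
      qed
    qed auto
  qed (auto intro: ar.less_asym)
  then show ?thesis using bij_betw_same_card[OF bij] by simp
qed

end

text \<open>With at most one \<open>x\<close> for each \<open>n\<close>, every vertex of the ray
  carries at most one triangle. All degrees are then at most four, so they are finite in the sense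
  of HOL too.\<close>

locale functional_relation = rca +
  fixes W
  assumes W_set: "W \<in> Sets M"
    and W_pair: "q \<in> W \<Longrightarrow> \<exists>n x. q = \<langle>n, x\<rangle>"
    and W_unique: "\<langle>n, x\<rangle> \<in> W \<Longrightarrow> \<langle>n, y\<rangle> \<in> W \<Longrightarrow> x = y"
begin

text \<open>The graph is a ray, with a triangle \<open>ray (n + 1)\<close>, \<open>apex q\<close>, \<open>apex' q\<close> for every \<open>q = (n, x)\<close> in \<open>W\<close>.
  Triangles start at \<open>ray 1\<close> so that \<open>ray 0\<close> always has degree 1.\<close>

definition "ray n = \<langle>\<zero>, n\<rangle>"
definition "apex q = \<langle>\<one>, q\<rangle>"
definition "apex' q = \<langle>\<one> \<oplus> \<one>, q\<rangle>"

text \<open>An apex carries the whole pair with its witness, so being a vertex is a bounded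
  condition on \<open>W\<close>. If apexes were labelled by \<open>n\<close> alone, the vertex set
  would already encode the domain that is to be found.\<close>

definition VG where
  "VG = {z. \<exists>m. m \<prec> z \<oplus> \<one> \<and> (z = ray m \<or> (m \<in> W \<and> (z = apex m \<or> z = apex' m)))}"

text \<open>One orientation per edge shortens case distinctions. The bounds on the quantifiers make
  this a bounded formula, and \<open>arc_iff\<close> discards them.\<close>

definition arc where
  "arc s t \<longleftrightarrow>
     (\<exists>n. n \<prec> s \<oplus> \<one> \<and> s = ray n \<and> t = ray (n \<oplus> \<one>)) \<or>
     (\<exists>n. n \<prec> s \<oplus> \<one> \<and> (\<exists>x. x \<prec> t \<oplus> \<one> \<and> s = ray (n \<oplus> \<one>) \<and> \<langle>n, x\<rangle> \<in> W \<and>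
        (t = apex \<langle>n, x\<rangle> \<or> t = apex' \<langle>n, x\<rangle>))) \<or>
     (\<exists>q. q \<prec> s \<oplus> \<one> \<and> q \<in> W \<and> s = apex q \<and> t = apex' q)"

definition EG where
  "EG = {z. \<exists>s. s \<prec> z \<oplus> \<one> \<and> (\<exists>t. t \<prec> z \<oplus> \<one> \<and> z = \<langle>s, t\<rangle> \<and> (arc s t \<or> arc t s))}"

lemma le_vertex [simp]: "n \<preceq> ray n" "q \<preceq> apex q" "q \<preceq> apex' q"
  unfolding ray_def apex_def apex'_def by simp_all

lemma one_ne [simp]: "\<one> \<noteq> \<one> \<oplus> \<one>"
  using basic(2)[of \<one> \<zero>] by (auto simp: zero_add)

lemma vertex_eq [simp]:
  "ray m = ray n \<longleftrightarrow> m = n" "apex p = apex q \<longleftrightarrow> p = q" "apex' p = apex' q \<longleftrightarrow> p = q"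
  "ray m \<noteq> apex q" "apex q \<noteq> ray m" "ray m \<noteq> apex' q" "apex' q \<noteq> ray m"
  "apex p \<noteq> apex' q" "apex' q \<noteq> apex p"
  unfolding ray_def apex_def apex'_def by auto

lemma arc_iff:
  "arc s t \<longleftrightarrow> (\<exists>n. s = ray n \<and> t = ray (n \<oplus> \<one>)) \<or>
     (\<exists>n x. s = ray (n \<oplus> \<one>) \<and> \<langle>n, x\<rangle> \<in> W \<and> (t = apex \<langle>n, x\<rangle> \<or> t = apex' \<langle>n, x\<rangle>)) \<or>
     (\<exists>q. q \<in> W \<and> s = apex q \<and> t = apex' q)"
proof -
  have "n \<preceq> ray (n \<oplus> \<one>)" for n
    by (rule ar.order.trans[OF le_add(1) le_vertex(1)])
  moreover have "x \<preceq> apex \<langle>n, x\<rangle>" "x \<preceq> apex' \<langle>n, x\<rangle>" for n x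
    using le_pair(2)[of x n] le_vertex(2,3)[of "\<langle>n, x\<rangle>"] by order+
  ultimately show ?thesis unfolding arc_def lt_succ by (auto 0 4)
qed

lemma edge_iff: "\<langle>s, t\<rangle> \<in> EG \<longleftrightarrow> arc s t \<or> arc t s"
  unfolding EG_def by auto

lemma VG_iff: "z \<in> VG \<longleftrightarrow> (\<exists>m. z = ray m) \<or> (\<exists>m. m \<in> W \<and> (z = apex m \<or> z = apex' m))"
  unfolding VG_def lt_succ using le_vertex by auto

lemma vertex_cases:
  assumes "z \<in> VG"
  obtains k where "z = ray k"
  | n x where "\<langle>n, x\<rangle> \<in> W" "z = apex \<langle>n, x\<rangle> \<or> z = apex' \<langle>n, x\<rangle>"
  using assms W_pair unfolding VG_iff by blast

lemma definable_arc: "tdef t \<Longrightarrow> tdef u \<Longrightarrow> definable (\<lambda>e. arc (t e) (u e))"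
proof (erule (1) tdef_merge)
  fix p s r assume *: "\<And>e. t e = tm_val M (mix p e) s" "\<And>e. u e = tm_val M (mix p e) r"
  have t: "tdef (\<lambda>e. tm_val M (mix p (\<lambda>i. e (i + k))) s)" for k s
  proof (induction s)
    case (NVar x)
    show ?case by (cases "even x") (auto simp: mix_def intro: tdef_intros)
  qed (auto intro: tdef_intros)
  show ?thesis unfolding * arc_def ray_def apex_def apex'_def
    using t[of 0] t[of 1] t[of 2] by (intro definable_intros W_set) (simp_all add: numeral_2_eq_2)
qed

lemma graph_sets: "VG \<in> Sets M" "EG \<in> Sets M"
proof -
  show "VG \<in> Sets M" unfolding VG_def ray_def apex_def apex'_def
    by (rule comprehension) (intro definable_intros W_set)
  show "EG \<in> Sets M" unfolding EG_def
    by (rule comprehension) (intro definable_intros definable_arc)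
qed

lemma arc_irrefl: "\<not> arc s s"
proof
  have "n \<noteq> n \<oplus> \<one>" for n using lt_succ[of n n] by (metis ar.less_irrefl ar.order.refl)
  then show "arc s s \<Longrightarrow> False" unfolding arc_iff by auto
qed

lemma graph_G: "graph M VG EG"
  unfolding graph_def
proof (intro conjI allI impI ballI graph_sets)
  fix x assume "x \<in> EG" then show "\<exists>u v. x = \<langle>u, v\<rangle>" unfolding EG_def by blast
next
  have *: "u \<in> VG \<and> v \<in> VG" if "arc u v" for u v
    using that unfolding arc_iff VG_iff by blast
  fix u v assume uv: "\<langle>u, v\<rangle> \<in> EG"
  then show "u \<in> VG" "v \<in> VG" "u \<noteq> v" "\<langle>v, u\<rangle> \<in> EG"
    unfolding edge_iff using * arc_irrefl by blast+
qed

lemma nbrs_ray_0: "nbrs M VG EG (ray \<zero>) = {ray \<one>}"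
  unfolding nbrs_def edge_iff arc_iff VG_iff by (auto simp: zero_add)

lemma nbrs_ray_succ:
  "nbrs M VG EG (ray (n \<oplus> \<one>)) =
     (\<Union>x\<in>{x. \<langle>n, x\<rangle> \<in> W}. {apex \<langle>n, x\<rangle>, apex' \<langle>n, x\<rangle>}) \<union> {ray n, ray (n \<oplus> \<one> \<oplus> \<one>)}"
  unfolding nbrs_def edge_iff arc_iff VG_iff by (auto simp: basic(2))

lemma nbrs_apex:
  "\<langle>n, x\<rangle> \<in> W \<Longrightarrow> nbrs M VG EG (apex \<langle>n, x\<rangle>) = {ray (n \<oplus> \<one>), apex' \<langle>n, x\<rangle>}"
  "\<langle>n, x\<rangle> \<in> W \<Longrightarrow> nbrs M VG EG (apex' \<langle>n, x\<rangle>) = {ray (n \<oplus> \<one>), apex \<langle>n, x\<rangle>}"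
  unfolding nbrs_def edge_iff arc_iff VG_iff by auto

lemma nbrs_even:
  assumes "v \<in> VG" "v \<noteq> ray \<zero>"
  shows "finite (nbrs M VG EG v) \<and> even (card (nbrs M VG EG v))"
proof -
  consider n where "v = ray (n \<oplus> \<one>)" | n x where "\<langle>n, x\<rangle> \<in> W" "v = apex \<langle>n, x\<rangle> \<or> v = apex' \<langle>n, x\<rangle>"
    using assms(1)
  proof (cases rule: vertex_cases)
    case (1 k)
    then show ?thesis using assms(2) that(1) by (cases k rule: num_cases) auto
  qed (use that in blast)
  then show ?thesis
  proof cases
    case 1
    have ne: "n \<noteq> n \<oplus> \<one> \<oplus> \<one>" using lt_add_succ[of n \<one>] by (metis add_assoc ar.less_irrefl)
    show ?thesis
    proof (cases "\<exists>x. \<langle>n, x\<rangle> \<in> W")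
      case True
      then obtain x where "{x. \<langle>n, x\<rangle> \<in> W} = {x}" using W_unique by blast
      then show ?thesis unfolding 1 nbrs_ray_succ using ne by simp
    next
      case False
      then show ?thesis unfolding 1 nbrs_ray_succ using ne by simp
    qed
  next
    case 2
    then show ?thesis by (auto simp: nbrs_apex)
  qed
qed

lemma locally_finite_G: "locally_finite M VG EG"
  unfolding locally_finite_def
proof
  fix v assume v: "v \<in> VG"
  show "finite_in M (nbrs M VG EG v)"
    by (rule finite_bounded) (cases "v = ray \<zero>", use nbrs_even[OF v] in \<open>auto simp: nbrs_ray_0\<close>)
qed

lemma odd_G: "v \<in> VG \<Longrightarrow> odd_degree M VG EG v \<longleftrightarrow> v = ray \<zero>"
proof
  assume v: "v \<in> VG" "odd_degree M VG EG v"
  then show "v = ray \<zero>" using nbrs_even[of v] odd_card unfolding odd_degree_def by blast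
next
  assume v: "v = ray \<zero>"
  have "definable (\<lambda>e. e 0 = \<langle>\<zero>, ray \<one>\<rangle>)" by (intro definable_intros)
  then have "{z. z = \<langle>\<zero>, ray \<one>\<rangle>} \<in> Sets M" by (rule comprehension)
  moreover have "\<zero> \<oplus> \<zero> \<oplus> \<one> = \<one>" by (simp add: zero_add)
  moreover have "i \<prec> \<one> \<longleftrightarrow> i = \<zero>" for i using lt_succ[of i \<zero>] by (simp add: zero_add)
  ultimately show "odd_degree M VG EG v"
    unfolding odd_degree_def has_card_def v nbrs_ray_0 fin_seq_def
    by (intro exI[of _ \<zero>] bexI[of _ "{z. z = \<langle>\<zero>, ray \<one>\<rangle>}"]) auto
qed

lemma joined_ray:
  assumes "\<And>i. m \<preceq> i \<Longrightarrow> \<langle>ray i, ray (i \<oplus> \<one>)\<rangle> \<in> K"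
  shows "joined M VG K (ray m) (ray (m \<oplus> k))"
proof -
  have "definable (\<lambda>e. \<exists>i. i \<prec> e 0 \<oplus> \<one> \<and> e 0 = \<langle>i, ray (m \<oplus> i)\<rangle>)"
    unfolding ray_def by (intro definable_intros)
  then have "{z. \<exists>i. i \<prec> z \<oplus> \<one> \<and> z = \<langle>i, ray (m \<oplus> i)\<rangle>} \<in> Sets M" by (rule comprehension)
  from joinedI[OF this, of k "\<lambda>i. ray (m \<oplus> i)" VG K] show ?thesis
    using assms unfolding VG_iff by (auto simp flip: add_assoc)
qed

lemma connected_G: "connected_graph M VG EG"
proof -
  have sym: "\<langle>v, u\<rangle> \<in> EG" if "\<langle>u, v\<rangle> \<in> EG" for u v using that unfolding edge_iff by blast
  have r: "joined M VG EG (ray \<zero>) (ray k)" for k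
    using joined_ray[of \<zero> EG k] unfolding edge_iff arc_iff by auto
  have "joined M VG EG (ray \<zero>) u" if u: "u \<in> VG" for u
  proof -
    consider k where "u = ray k" | n x where "\<langle>n, x\<rangle> \<in> W" "u = apex \<langle>n, x\<rangle> \<or> u = apex' \<langle>n, x\<rangle>"
      by (rule vertex_cases) (use u in blast)+
    then show ?thesis
    proof cases
      case 2
      have "\<langle>ray (n \<oplus> \<one>), u\<rangle> \<in> EG" using 2 unfolding edge_iff arc_iff by blast
      moreover have "ray (n \<oplus> \<one>) \<in> VG" unfolding VG_iff by blast
      ultimately show ?thesis using joined_trans[OF r joined_edge] u by blast
    qed (use r in blast)
  qed
  note star = this
  show ?thesis unfolding connected_graph_def
    by (intro ballI joined_trans[OF joined_sym[OF star sym] star])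
qed

text \<open>A code bounds its components, so beyond a bound \<open>\<beta>\<close> of the deleted
  edges the ray and its triangles stay intact and connected. All vertices not reached from there lie
  below a fixed bound, which leaves no room for a second infinite component.\<close>

lemma one_infinite_component_G:
  assumes fs: "finite_subgraph M V' E' VG EG"
  shows "one_infinite_component M VG (EG - E')"
proof -
  let ?K = "EG - E'"
  obtain \<beta> where \<beta>: "\<And>z. z \<in> E' \<Longrightarrow> z \<prec> \<beta>"
    using fs unfolding finite_subgraph_def finite_in_def by blast
  have sym: "\<langle>v, u\<rangle> \<in> ?K" if "\<langle>u, v\<rangle> \<in> ?K" for u v
    using that fs graph_G unfolding finite_subgraph_def graph_def by blast
  have keep: "\<langle>s, t\<rangle> \<in> ?K" if "\<langle>s, t\<rangle> \<in> EG" "\<beta> \<preceq> s" for s t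
    using that \<beta>[of "\<langle>s, t\<rangle>"] le_pair(1)[of s t] by (metis DiffI ar.leD ar.order.trans)
  have "\<langle>ray i, ray (i \<oplus> \<one>)\<rangle> \<in> ?K" if "\<beta> \<preceq> i" for i
    by (rule keep) (use that le_vertex(1)[of i] ar.order.trans in \<open>auto simp: edge_iff arc_iff\<close>)
  then have r: "joined M VG ?K (ray \<beta>) (ray (\<beta> \<oplus> k))" for k by (rule joined_ray)
  have inf: "\<not> finite_in M (component M VG ?K (ray \<beta>))"
  proof
    assume "finite_in M (component M VG ?K (ray \<beta>))"
    then obtain b where "\<And>u. joined M VG ?K (ray \<beta>) u \<Longrightarrow> u \<prec> b"
      unfolding finite_in_def component_def by blast
    from this[OF r[of b]] have "ray (\<beta> \<oplus> b) \<prec> b" .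
    moreover have "b \<preceq> ray (\<beta> \<oplus> b)" using le_add(2)[of b \<beta>] le_vertex(1) ar.order.trans by blast
    ultimately show False by order
  qed
  define two where "two = \<one> \<oplus> \<one>"
  have two: "\<one> \<preceq> two" unfolding two_def by simp
  \<comment> \<open>The part in front of \<open>\<beta>\<close> contains the apexes of pairs
    \<open>(n, x)\<close> with \<open>n\<close> below \<open>\<beta>\<close>. It counts as finite
    only after the values \<open>x\<close> on this interval have received a common bound.\<close>
  have "definable (\<lambda>e. \<langle>e 1, e 0\<rangle> \<in> W)" by (intro definable_intros W_set)
  from strong_bounding[of "\<lambda>x n. \<langle>n, x\<rangle> \<in> W", OF this, of \<beta>]
  obtain B where "\<And>n x. n \<prec> \<beta> \<Longrightarrow> \<langle>n, x\<rangle> \<in> W \<Longrightarrow> \<exists>x. x \<prec> B \<and> \<langle>n, x\<rangle> \<in> W" by blast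
  then have B: "x \<prec> B" if "n \<prec> \<beta>" "\<langle>n, x\<rangle> \<in> W" for n x using that W_unique by blast
  have far: "joined M VG ?K (ray \<beta>) u" if u: "u \<in> VG" "\<langle>two, \<langle>\<beta>, B\<rangle>\<rangle> \<prec> u" for u
  proof -
    consider k where "u = ray k" | n x where "\<langle>n, x\<rangle> \<in> W" "u = apex \<langle>n, x\<rangle> \<or> u = apex' \<langle>n, x\<rangle>"
      by (rule vertex_cases) (use u in blast)+
    then show ?thesis
    proof cases
      case 1
      have "\<beta> \<preceq> k"
      proof (rule ccontr)
        assume "\<not> \<beta> \<preceq> k"
        then have "u \<preceq> \<langle>two, \<beta>\<rangle>" unfolding 1 ray_def by (intro pair_mono) (auto simp: two_def)
        also have "\<dots> \<preceq> \<langle>two, \<langle>\<beta>, B\<rangle>\<rangle>" by (rule pair_mono) auto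
        finally show False using u(2) by order
      qed
      then obtain j where "k = \<beta> \<oplus> j" unfolding le_iff_add ..
      then show ?thesis using r 1 by simp
    next
      case 2
      have "\<beta> \<preceq> n"
      proof (rule ccontr)
        assume "\<not> \<beta> \<preceq> n"
        then have "n \<prec> \<beta>" by order
        then have "n \<preceq> \<beta>" "x \<preceq> B" using B[OF _ 2(1)] ar.less_imp_le by auto
        then have "u \<preceq> \<langle>two, \<langle>\<beta>, B\<rangle>\<rangle>" using 2(2) two unfolding apex_def apex'_def two_def[symmetric]
          by (auto intro!: pair_mono)
        then show False using u(2) by order
      qed
      then obtain j where "n = \<beta> \<oplus> j" unfolding le_iff_add ..
      then have "joined M VG ?K (ray \<beta>) (ray (n \<oplus> \<one>))" using r[of "j \<oplus> \<one>"] by (simp add: add_assoc)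
      moreover have "\<langle>ray (n \<oplus> \<one>), u\<rangle> \<in> ?K"
      proof (rule keep)
        show "\<langle>ray (n \<oplus> \<one>), u\<rangle> \<in> EG" using 2 unfolding edge_iff arc_iff by blast
        show "\<beta> \<preceq> ray (n \<oplus> \<one>)"
          using \<open>\<beta> \<preceq> n\<close> le_add(1)[of n \<one>] le_vertex(1)[of "n \<oplus> \<one>"] by order
      qed
      moreover have "ray (n \<oplus> \<one>) \<in> VG" unfolding VG_iff by blast
      ultimately show ?thesis using joined_trans[OF _ joined_edge] u(1) by blast
    qed
  qed
  show ?thesis unfolding one_infinite_component_def
  proof (intro bexI[of _ "ray \<beta>"] conjI inf ballI impI)
    show "ray \<beta> \<in> VG" unfolding VG_iff by blast
    fix w assume w: "w \<in> VG" "\<not> finite_in M (component M VG ?K w)"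
    then obtain u where u: "joined M VG ?K w u" "\<not> u \<prec> \<langle>two, \<langle>\<beta>, B\<rangle>\<rangle> \<oplus> \<one>"
      unfolding finite_in_def component_def by blast
    then have "u \<in> VG" "\<langle>two, \<langle>\<beta>, B\<rangle>\<rangle> \<prec> u" unfolding joined_def lt_succ by auto
    then have "joined M VG ?K (ray \<beta>) u" by (rule far)
    then have 1: "joined M VG ?K w (ray \<beta>)" by (rule joined_trans[OF u(1) joined_sym[OF _ sym]])
    have 2: "joined M VG ?K (ray \<beta>) w" by (rule joined_sym[OF 1 sym])
    show "component M VG ?K w = component M VG ?K (ray \<beta>)"
      unfolding component_def using joined_trans[OF 1] joined_trans[OF 2] by (intro Collect_cong iffI)
  qed
qed

lemma pre_Eulerian_G: "pre_Eulerian M VG EG"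
proof -
  have "ray \<zero> \<in> VG" unfolding VG_iff by blast
  then show ?thesis unfolding pre_Eulerian_def
    using graph_G connected_G odd_G one_infinite_component_G by auto
qed

text \<open>The edge from \<open>ray (n + 1)\<close> to \<open>ray (n + 2)\<close> is a bridge, and \<open>left n\<close> is its bounded side.\<close>

definition left where
  "left n u \<longleftrightarrow> (\<exists>m. m \<prec> n \<oplus> \<one> \<oplus> \<one> \<and> u = ray m) \<or>
     (\<exists>m. m \<prec> n \<oplus> \<one> \<and> (\<exists>x. x \<prec> u \<oplus> \<one> \<and> (u = apex \<langle>m, x\<rangle> \<or> u = apex' \<langle>m, x\<rangle>)))"

lemma left_simps [simp]:
  "left n (ray m) \<longleftrightarrow> m \<preceq> n \<oplus> \<one>" "left n (apex \<langle>m, x\<rangle>) \<longleftrightarrow> m \<preceq> n" "left n (apex' \<langle>m, x\<rangle>) \<longleftrightarrow> m \<preceq> n"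
proof -
  have x: "x \<preceq> apex \<langle>m, x\<rangle>" "x \<preceq> apex' \<langle>m, x\<rangle>" for m x
    using le_pair(2)[of x m] le_vertex(2,3)[of "\<langle>m, x\<rangle>"] by order+
  show "left n (ray m) \<longleftrightarrow> m \<preceq> n \<oplus> \<one>" "left n (apex \<langle>m, x\<rangle>) \<longleftrightarrow> m \<preceq> n"
    "left n (apex' \<langle>m, x\<rangle>) \<longleftrightarrow> m \<preceq> n"
    unfolding left_def lt_succ using x by auto
qed

text \<open>The thresholds \<open>n + 1\<close> for the ray and \<open>n\<close> for the triangles
  match: the triangle of index \<open>m\<close> hangs on \<open>ray (m + 1)\<close> and so lies on
  the side of its base vertex.\<close>

lemma left_cross:
  assumes "arc s t" "left n s \<noteq> left n t"
  shows "s = ray (n \<oplus> \<one>) \<and> t = ray (n \<oplus> \<one> \<oplus> \<one>)"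
proof -
  have 1: "k = n \<oplus> \<one>" if "k \<preceq> n \<oplus> \<one>" "\<not> k \<preceq> n" for k using that le_succ_iff by blast
  have 2: "k \<preceq> n \<oplus> \<one>" if "k \<preceq> n" for k using that le_succ_iff by blast
  show ?thesis using assms unfolding arc_iff by (auto dest: 1 2 W_pair)
qed

lemma left_eq:
  assumes "\<langle>s, t\<rangle> \<in> EG" "\<not> (s = ray (n \<oplus> \<one>) \<and> t = ray (n \<oplus> \<one> \<oplus> \<one>))"
    "\<not> (t = ray (n \<oplus> \<one>) \<and> s = ray (n \<oplus> \<one> \<oplus> \<one>))"
  shows "left n s \<longleftrightarrow> left n t"
  using assms left_cross unfolding edge_iff by blast

section \<open>Recovering the domain from an Euler path\<close>

lemma domain_of_Euler_path:
  assumes "Euler_path M VG EG P"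
  shows "{n. \<exists>x. \<langle>n, x\<rangle> \<in> W} \<in> Sets M"
proof -
  have P: "P \<in> Sets M" "\<And>i. \<exists>!w. \<langle>i, w\<rangle> \<in> P" "\<And>i w. \<langle>i, w\<rangle> \<in> P \<Longrightarrow> w \<in> VG"
    "\<And>i w w'. \<langle>i, w\<rangle> \<in> P \<Longrightarrow> \<langle>i \<oplus> \<one>, w'\<rangle> \<in> P \<Longrightarrow> \<langle>w, w'\<rangle> \<in> EG"
    "\<And>u v. \<langle>u, v\<rangle> \<in> EG \<Longrightarrow> \<exists>!i. uses_edge M P i u v"
    using assms unfolding Euler_path_def infinite_path_def total_fun_def by blast+
  define p where "p i = (THE w. \<langle>i, w\<rangle> \<in> P)" for i
  have p: "\<langle>i, w\<rangle> \<in> P \<longleftrightarrow> w = p i" for i w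
    unfolding p_def using theI'[OF P(2)] P(2) by blast
  have pV: "p i \<in> VG" and pE: "\<langle>p i, p (i \<oplus> \<one>)\<rangle> \<in> EG" for i using P(3,4) p by blast+
  have uses: "uses_edge M P i u v \<longleftrightarrow> (u = p i \<and> v = p (i \<oplus> \<one>)) \<or> (v = p i \<and> u = p (i \<oplus> \<one>))" for i u v
    unfolding uses_edge_def p by blast
  have bridge: "\<langle>ray n, ray (n \<oplus> \<one>)\<rangle> \<in> EG" for n unfolding edge_iff arc_iff by blast
  have bounded: "\<exists>B. \<forall>j. j \<prec> i \<longrightarrow> p j \<prec> B" for i
  proof -
    have "definable (\<lambda>e. \<langle>e 1, e 0\<rangle> \<in> P)" by (intro definable_intros P)
    from strong_bounding[of "\<lambda>w j. \<langle>j, w\<rangle> \<in> P", OF this, of i] show ?thesis unfolding p by simp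
  qed
  have before: "\<exists>j. j \<preceq> i \<and> p j = apex \<langle>n, x\<rangle>"
    if i: "uses_edge M P i (ray (n \<oplus> \<one>)) (ray (n \<oplus> \<one> \<oplus> \<one>))" and x: "\<langle>n, x\<rangle> \<in> W" for i n x
  proof -
    \<comment> \<open>The bridge is used at step \<open>i\<close> only, so no other step changes
      sides.\<close>
    have step: "left n (p j) \<longleftrightarrow> left n (p (j \<oplus> \<one>))" if "j \<noteq> i" for j
    proof (rule left_eq[OF pE])
      have "\<not> uses_edge M P j (ray (n \<oplus> \<one>)) (ray (n \<oplus> \<one> \<oplus> \<one>))"
        using P(5)[OF bridge] i that by blast
      then show "\<not> (p j = ray (n \<oplus> \<one>) \<and> p (j \<oplus> \<one>) = ray (n \<oplus> \<one> \<oplus> \<one>))"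
        "\<not> (p (j \<oplus> \<one>) = ray (n \<oplus> \<one>) \<and> p j = ray (n \<oplus> \<one> \<oplus> \<one>))"
        unfolding uses by metis+
    qed
    have cross: "left n (p i) \<noteq> left n (p (i \<oplus> \<one>))"
    proof -
      have "left n (ray (n \<oplus> \<one>))" "\<not> left n (ray (n \<oplus> \<one> \<oplus> \<one>))" by auto
      then show ?thesis using i unfolding uses by metis
    qed
    \<comment> \<open>\<open>left n (p j)\<close> reaches the value of the path through an unbounded
      quantifier. Its existential and universal forms agree, so it becomes membership in a set, to
      which induction applies.\<close>
    define L where "L = {j. \<exists>w. \<langle>j, w\<rangle> \<in> P \<and> left n w}"
    have "definable (\<lambda>e. \<langle>e 1, e 0\<rangle> \<in> P \<and> left n (e 0))" "definable (\<lambda>e. \<langle>e 1, e 0\<rangle> \<in> P \<longrightarrow> left n (e 0))"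
      unfolding left_def ray_def apex_def apex'_def by (intro definable_intros P)+
    then have L: "L \<in> Sets M" unfolding L_def
      using delta1_comprehension[of "\<lambda>w j. \<langle>j, w\<rangle> \<in> P \<and> left n w" "\<lambda>w j. \<langle>j, w\<rangle> \<in> P \<longrightarrow> left n w"]
      unfolding p by simp
    have L_iff: "j \<in> L \<longleftrightarrow> left n (p j)" for j unfolding L_def p by simp
    have "j \<preceq> i \<longrightarrow> (j \<in> L \<longleftrightarrow> \<zero> \<in> L)" for j
    proof (rule definable_induct[of "\<lambda>j. j \<preceq> i \<longrightarrow> (j \<in> L \<longleftrightarrow> \<zero> \<in> L)"])
      fix j assume *: "j \<preceq> i \<longrightarrow> (j \<in> L \<longleftrightarrow> \<zero> \<in> L)"
      show "j \<oplus> \<one> \<preceq> i \<longrightarrow> (j \<oplus> \<one> \<in> L \<longleftrightarrow> \<zero> \<in> L)"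
      proof
        assume "j \<oplus> \<one> \<preceq> i"
        then have "j \<prec> i" by simp
        then have "j \<preceq> i" "j \<noteq> i" by (auto simp: ar.less_imp_le)
        then show "j \<oplus> \<one> \<in> L \<longleftrightarrow> \<zero> \<in> L" using * step L_iff by metis
      qed
    qed (intro definable_intros definable_le L, simp)
    then have early: "left n (p j) \<longleftrightarrow> left n (p i)" if "j \<preceq> i" for j using that L_iff by blast
    have "i \<oplus> \<one> \<oplus> j \<in> L \<longleftrightarrow> i \<oplus> \<one> \<in> L" for j
    proof (rule definable_induct[of "\<lambda>j. i \<oplus> \<one> \<oplus> j \<in> L \<longleftrightarrow> i \<oplus> \<one> \<in> L"])
      fix j assume *: "i \<oplus> \<one> \<oplus> j \<in> L \<longleftrightarrow> i \<oplus> \<one> \<in> L"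
      have "i \<oplus> \<one> \<oplus> j \<noteq> i" using lt_add_succ[of i j] by (metis add_assoc add_commute ar.less_irrefl)
      from step[OF this] * L_iff show "i \<oplus> \<one> \<oplus> (j \<oplus> \<one>) \<in> L \<longleftrightarrow> i \<oplus> \<one> \<in> L" by (simp add: add_assoc)
    qed (intro definable_intros L, simp)
    then have "left n (p (i \<oplus> \<one> \<oplus> k)) \<longleftrightarrow> left n (p (i \<oplus> \<one>))" for k using L_iff by blast
    then have late: "left n (p j) \<longleftrightarrow> left n (p (i \<oplus> \<one>))" if "i \<prec> j" for j
      using that succ_le[of i j] le_iff_add[of "i \<oplus> \<one>" j] by auto
    \<comment> \<open>Otherwise the path would stay on the bounded side after the crossing, and all
      edges further out along the ray would have to be used before it.\<close>
    have "left n (p i)"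
    proof (rule ccontr)
      assume right: "\<not> left n (p i)"
      obtain B where B: "\<And>j. j \<prec> i \<oplus> \<one> \<Longrightarrow> p j \<prec> B" using bounded by blast
      \<comment> \<open>\<open>ray m\<close> lies beyond the bridge, and its code is not below the
        bound \<open>B\<close> of the vertices visited up to step \<open>i\<close>.\<close>
      define m where "m = n \<oplus> \<one> \<oplus> \<one> \<oplus> B"
      obtain j where j: "uses_edge M P j (ray m) (ray (m \<oplus> \<one>))" using P(5)[OF bridge] by blast
      have "n \<oplus> \<one> \<prec> m" unfolding m_def by (metis le_add(1) succ_le)
      then have "\<not> left n (ray m)" "\<not> left n (ray (m \<oplus> \<one>))"
        unfolding left_simps using le_add(1)[of m \<one>] by order+
      then have "\<not> left n (p j)" "\<not> left n (p (j \<oplus> \<one>))" using j unfolding uses by metis+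
      then have "j \<prec> i" using late[of "j \<oplus> \<one>"] late[of j] cross right by (metis lt_succ ar.not_less)
      then have "p j \<prec> B" "p (j \<oplus> \<one>) \<prec> B" using B by (auto simp: ar.less_imp_le)
      then have "ray m \<prec> B" using j unfolding uses by auto
      moreover have "B \<preceq> ray m" unfolding m_def using le_add(2) le_vertex(1) ar.order.trans by blast
      ultimately show False by order
    qed
    then have l: "j \<preceq> i" if "left n (p j)" for j
      using late[of j] cross that by (metis ar.not_less)
    have "\<langle>ray (n \<oplus> \<one>), apex \<langle>n, x\<rangle>\<rangle> \<in> EG" using x unfolding edge_iff arc_iff by blast
    then obtain j where "uses_edge M P j (ray (n \<oplus> \<one>)) (apex \<langle>n, x\<rangle>)" using P(5) by blast
    then obtain k where k: "p k = apex \<langle>n, x\<rangle>" unfolding uses by metis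
    moreover have "left n (apex \<langle>n, x\<rangle>)" by simp
    ultimately show ?thesis using l[of k] by metis
  qed
  \<comment> \<open>\<open>z\<close> bounds the crossing time and the vertices visited until then,
    which makes the rest a bounded formula. Thus \<open>\<forall>z. ?R z n\<close> is the \<Pi>1
    form of \<open>n\<close> being in the domain.\<close>
  let ?R = "\<lambda>z n. \<not> (\<exists>i. i \<prec> z \<and> uses_edge M P i (ray (n \<oplus> \<one>)) (ray (n \<oplus> \<one> \<oplus> \<one>)) \<and>
    (\<forall>j. j \<prec> i \<oplus> \<one> \<longrightarrow> (\<exists>u. u \<prec> z \<and> \<langle>j, u\<rangle> \<in> P \<and> \<not> (\<exists>x. x \<prec> u \<oplus> \<one> \<and> u = apex \<langle>n, x\<rangle>))))"
  have dQ: "definable (\<lambda>e. \<langle>e 1, e 0\<rangle> \<in> W)" by (intro definable_intros W_set)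
  have dR: "definable (\<lambda>e. ?R (e 0) (e 1))"
    unfolding uses_edge_def ray_def apex_def by (intro definable_intros P)
  show ?thesis
  proof (rule delta1_comprehension[of "\<lambda>x n. \<langle>n, x\<rangle> \<in> W" ?R, OF dQ dR])
    fix n
    have ux: "x \<prec> apex \<langle>n, x\<rangle> \<oplus> \<one>" for x
      using le_pair(2)[of x n] le_vertex(2)[of "\<langle>n, x\<rangle>"] unfolding lt_succ by order
    show "(\<exists>x. \<langle>n, x\<rangle> \<in> W) \<longleftrightarrow> (\<forall>z. ?R z n)"
    proof
      assume "\<exists>x. \<langle>n, x\<rangle> \<in> W"
      then obtain x where x: "\<langle>n, x\<rangle> \<in> W" ..
      show "\<forall>z. ?R z n"
      proof (intro allI notI)
        fix z assume "\<exists>i. i \<prec> z \<and> uses_edge M P i (ray (n \<oplus> \<one>)) (ray (n \<oplus> \<one> \<oplus> \<one>)) \<and>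
          (\<forall>j. j \<prec> i \<oplus> \<one> \<longrightarrow> (\<exists>u. u \<prec> z \<and> \<langle>j, u\<rangle> \<in> P \<and> \<not> (\<exists>x. x \<prec> u \<oplus> \<one> \<and> u = apex \<langle>n, x\<rangle>)))"
        then obtain i where i: "uses_edge M P i (ray (n \<oplus> \<one>)) (ray (n \<oplus> \<one> \<oplus> \<one>))"
          "\<And>j. j \<preceq> i \<Longrightarrow> \<not> (\<exists>x. x \<prec> p j \<oplus> \<one> \<and> p j = apex \<langle>n, x\<rangle>)" unfolding p by auto
        obtain j where "j \<preceq> i" "p j = apex \<langle>n, x\<rangle>" using before[OF i(1) x] by blast
        then show False using i(2)[of j] ux by metis
      qed
    next
      assume R: "\<forall>z. ?R z n"
      show "\<exists>x. \<langle>n, x\<rangle> \<in> W"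
      proof (rule ccontr)
        assume no: "\<nexists>x. \<langle>n, x\<rangle> \<in> W"
        obtain i where i: "uses_edge M P i (ray (n \<oplus> \<one>)) (ray (n \<oplus> \<one> \<oplus> \<one>))"
          using P(5)[OF bridge] by blast
        obtain B where B: "\<And>j. j \<prec> i \<oplus> \<one> \<Longrightarrow> p j \<prec> B" using bounded by blast
        have "p j \<noteq> apex \<langle>n, x\<rangle>" for j x
          using pV[of j] no unfolding VG_iff by auto
        moreover have "p j \<prec> B \<oplus> (i \<oplus> \<one>)" if "j \<prec> i \<oplus> \<one>" for j
          using B[OF that] le_add(1)[of B "i \<oplus> \<one>"] by order
        moreover have "i \<prec> B \<oplus> (i \<oplus> \<one>)" by (simp flip: add_assoc)
        ultimately have "\<not> ?R (B \<oplus> (i \<oplus> \<one>)) n" using i unfolding p by blast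
        then show False using R by blast
      qed
    qed
  qed
qed

end

context rca
begin

theorem projective_if_Euler_paths:
  assumes "locally_finite_pre_Eulerian_thm M"
  shows projective
  unfolding projective_def
proof
  fix Z assume Z: "Z \<in> Sets M"
  \<comment> \<open>Selecting the least \<open>x\<close> is a bounded condition, and by the least
    number principle it does not change the domain.\<close>
  define W where "W = {z. \<exists>n. n \<prec> z \<oplus> \<one> \<and> (\<exists>x. x \<prec> z \<oplus> \<one> \<and> z = \<langle>n, x\<rangle> \<and>
    \<langle>n, x\<rangle> \<in> Z \<and> (\<forall>y. y \<prec> x \<longrightarrow> \<langle>n, y\<rangle> \<notin> Z))}"
  have W: "\<langle>n, x\<rangle> \<in> W \<longleftrightarrow> \<langle>n, x\<rangle> \<in> Z \<and> (\<forall>y. y \<prec> x \<longrightarrow> \<langle>n, y\<rangle> \<notin> Z)" for n x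
    unfolding W_def by auto
  interpret functional_relation M W
  proof
    show "W \<in> Sets M" unfolding W_def by (rule comprehension) (intro definable_intros Z)
    show "\<exists>n x. q = \<langle>n, x\<rangle>" if "q \<in> W" for q using that unfolding W_def by blast
    show "x = y" if "\<langle>n, x\<rangle> \<in> W" "\<langle>n, y\<rangle> \<in> W" for n x y
      using that lt_total[of x y] unfolding W by blast
  qed
  obtain P where "Euler_path M VG EG P"
    using assms graph_sets locally_finite_G pre_Eulerian_G
    unfolding locally_finite_pre_Eulerian_thm_def by blast
  then have "{n. \<exists>x. \<langle>n, x\<rangle> \<in> W} \<in> Sets M" by (rule domain_of_Euler_path)
  moreover have "(\<exists>x. \<langle>n, x\<rangle> \<in> W) \<longleftrightarrow> (\<exists>x. \<langle>n, x\<rangle> \<in> Z)" for n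
  proof
    have "definable (\<lambda>e. \<langle>n, e 0\<rangle> \<in> Z)" by (intro definable_intros Z)
    from definable_least[of "\<lambda>x. \<langle>n, x\<rangle> \<in> Z", OF this] show "\<exists>x. \<langle>n, x\<rangle> \<in> Z \<Longrightarrow> \<exists>x. \<langle>n, x\<rangle> \<in> W"
      unfolding W by blast
  qed (use W in blast)
  ultimately show "{n. \<exists>x. \<langle>n, x\<rangle> \<in> Z} \<in> Sets M" by simp
qed

end

section \<open>Finite sets, sequences and parity under arithmetical comprehension\<close>

locale aca = rca +
  assumes proj: projective
begin

section \<open>Definable functions under arithmetical comprehension\<close>

lemmas definable_ex = definable_ex_projective[OF proj]
lemmas definable_all = definable_all_projective[OF proj]

text \<open>Definability through the graph. Substituting such a function into a predicate costs a
  number quantifier, which projections make available.\<close>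

definition fdef :: "((nat \<Rightarrow> 'a) \<Rightarrow> 'a) \<Rightarrow> bool" where
  "fdef t \<longleftrightarrow> definable (\<lambda>e. e 0 = t (\<lambda>i. e (Suc i)))"

lemma fdef_at:
  assumes "fdef t" "j < k"
  shows "definable (\<lambda>e. e j = t (\<lambda>i. e (i + k)))"
proof -
  let ?r = "\<lambda>i. if i = 0 then j else i - 1 + k"
  have "inj ?r" by (rule injI) (use assms(2) in \<open>auto split: if_splits\<close>)
  from definable_subst[OF assms(1)[unfolded fdef_def] this] show ?thesis by simp
qed

text \<open>In a nest of quantifiers the innermost variable is argument 0; reversing the first
  \<open>m\<close> arguments restores the order in which a predicate was stated.\<close>

lemma definable_rev:
  assumes "definable P"
  shows "definable (\<lambda>e. P (\<lambda>i. e (if i < m then m - 1 - i else i)))"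
  by (rule definable_subst[OF assms]) (rule injI, auto split: if_splits)

lemma definable_comp1:
  assumes "definable (\<lambda>e. P (e 0))" "fdef t"
  shows "definable (\<lambda>e. P (t e))"
proof -
  have "definable (\<lambda>e. \<exists>x. x = t e \<and> P x)"
    by (intro definable_ex definable_conj assms(1)) (use fdef_at[OF assms(2), of 0 1] in simp)
  then show ?thesis by simp
qed

lemma definable_comp2:
  assumes "definable (\<lambda>e. P (e 0) (e 1))" "fdef t" "fdef u"
  shows "definable (\<lambda>e. P (t e) (u e))"
proof -
  have "definable (\<lambda>e. \<exists>x y. x = t e \<and> y = u e \<and> P x y)"
    using fdef_at[OF assms(2), of 1 2] fdef_at[OF assms(3), of 0 2] definable_rev[OF assms(1), of 2]
    by (intro definable_ex definable_conj) simp_all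
  then show ?thesis by simp
qed

lemma definable_comp3:
  assumes "definable (\<lambda>e. P (e 0) (e 1) (e 2))" "fdef t" "fdef u" "fdef v"
  shows "definable (\<lambda>e. P (t e) (u e) (v e))"
proof -
  have "definable (\<lambda>e. \<exists>x y z. x = t e \<and> y = u e \<and> z = v e \<and> P x y z)"
    using fdef_at[OF assms(2), of 2 3] fdef_at[OF assms(3), of 1 3] fdef_at[OF assms(4), of 0 3]
      definable_rev[OF assms(1), of 3]
    by (intro definable_ex definable_conj) (simp_all add: numeral_3_eq_3 numeral_2_eq_2)
  then show ?thesis by simp
qed

lemma definable_comp4:
  assumes "definable (\<lambda>e. P (e 0) (e 1) (e 2) (e 3))" "fdef t" "fdef u" "fdef v" "fdef w"
  shows "definable (\<lambda>e. P (t e) (u e) (v e) (w e))"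
proof -
  have "definable (\<lambda>e. \<exists>x y z a. x = t e \<and> y = u e \<and> z = v e \<and> a = w e \<and> P x y z a)"
    using fdef_at[OF assms(2), of 3 4] fdef_at[OF assms(3), of 2 4] fdef_at[OF assms(4), of 1 4]
      fdef_at[OF assms(5), of 0 4] definable_rev[OF assms(1), of 4]
    by (intro definable_ex definable_conj) (simp_all add: numeral_eq_Suc)
  then show ?thesis by simp
qed

lemma fdef_comp1: "fdef (\<lambda>e. g (e 0)) \<Longrightarrow> fdef t \<Longrightarrow> fdef (\<lambda>e. g (t e))"
  and fdef_comp2: "fdef (\<lambda>e. h (e 0) (e 1)) \<Longrightarrow> fdef t \<Longrightarrow> fdef u \<Longrightarrow> fdef (\<lambda>e. h (t e) (u e))"
proof -
  assume g: "fdef (\<lambda>e. g (e 0))" and t: "fdef t"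
  have "definable (\<lambda>e. \<exists>x. x = t (\<lambda>i. e (Suc i)) \<and> e 0 = g x)"
    using fdef_at[OF t, of 0 2] definable_rev[OF g[unfolded fdef_def], of 2]
    by (intro definable_ex definable_conj) simp_all
  then show "fdef (\<lambda>e. g (t e))" unfolding fdef_def by simp
next
  assume h: "fdef (\<lambda>e. h (e 0) (e 1))" and t: "fdef t" "fdef u"
  have "definable (\<lambda>e. \<exists>x y. x = t (\<lambda>i. e (Suc i)) \<and> y = u (\<lambda>i. e (Suc i)) \<and> e 0 = h x y)"
    using definable_rev[OF h[unfolded fdef_def], of 3] fdef_at[OF t(1), of 1 3] fdef_at[OF t(2), of 0 3]
    by (intro definable_ex definable_conj) (simp_all add: numeral_3_eq_3 numeral_2_eq_2)
  then show "fdef (\<lambda>e. h (t e) (u e))" unfolding fdef_def by simp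
qed

lemma fdef_const: "fdef (\<lambda>e. c)" and fdef_var: "fdef (\<lambda>e. e n)"
  unfolding fdef_def by (intro definable_intros)+

lemma fdef_add: "fdef t \<Longrightarrow> fdef u \<Longrightarrow> fdef (\<lambda>e. t e \<oplus> u e)"
  by (rule fdef_comp2[of "(\<oplus>)"]) (unfold fdef_def, intro definable_intros)

lemma fdef_pair: "fdef t \<Longrightarrow> fdef u \<Longrightarrow> fdef (\<lambda>e. \<langle>t e, u e\<rangle>)"
  by (rule fdef_comp2[of pr]) (unfold fdef_def, intro definable_intros)

lemma fdef_if:
  assumes "definable P" "fdef t" "fdef u"
  shows "fdef (\<lambda>e. if P e then t e else u e)"
proof -
  have "definable (\<lambda>e. P (\<lambda>i. e (Suc i)))" using definable_subst[OF assms(1), of Suc] by simp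
  then have "definable (\<lambda>e. (P (\<lambda>i. e (Suc i)) \<and> e 0 = t (\<lambda>i. e (Suc i))) \<or>
    (\<not> P (\<lambda>i. e (Suc i)) \<and> e 0 = u (\<lambda>i. e (Suc i))))"
    using assms(2,3) unfolding fdef_def by (intro definable_conj definable_disj definable_neg)
  then show ?thesis unfolding fdef_def by (rule back_subst[of definable]) auto
qed

lemma fdef_eq: "fdef t \<Longrightarrow> fdef u \<Longrightarrow> definable (\<lambda>e. t e = u e)"
  by (rule definable_comp2[of "(=)"]) (intro definable_intros)

lemma fdef_lt: "fdef t \<Longrightarrow> fdef u \<Longrightarrow> definable (\<lambda>e. t e \<prec> u e)"
  by (rule definable_comp2[of "(\<prec>)"]) (intro definable_intros)

lemma fdef_le: "fdef t \<Longrightarrow> fdef u \<Longrightarrow> definable (\<lambda>e. t e \<preceq> u e)"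
  by (rule definable_comp2[of "(\<preceq>)"]) (intro definable_le tdef_intros)

lemma fdef_mem: "A \<in> Sets M \<Longrightarrow> fdef t \<Longrightarrow> definable (\<lambda>e. t e \<in> A)"
  by (rule definable_comp1[of "\<lambda>x. x \<in> A"]) (intro definable_intros)

lemma msub_eq: "z = x \<ominus> y \<longleftrightarrow> (x \<prec> y \<and> z = \<zero>) \<or> y \<oplus> z = x"
proof (cases "x \<prec> y")
  case True
  then show ?thesis using msub_lt le_add(1)[of y z] by auto
next
  case False
  then obtain k where "x = y \<oplus> k" using le_iff_add ar.not_less by blast
  then show ?thesis using False by auto
qed

lemma fdef_msub: "fdef t \<Longrightarrow> fdef u \<Longrightarrow> fdef (\<lambda>e. t e \<ominus> u e)"
  by (rule fdef_comp2[of "(\<ominus>)"]) (unfold fdef_def msub_eq, intro definable_intros)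

text \<open>Codes in the format supplied by \<open>sigma1_bounded_code\<close>: an element is an
  index whose modulus fails to divide \<open>c\<close>. A number that is no such triple codes the
  empty set, so every number is a code.\<close>

definition elts :: "'a \<Rightarrow> 'a set" where
  "elts s = {i. \<exists>N b c. s = \<langle>N, \<langle>b, c\<rangle>\<rangle> \<and> i \<prec> N \<and> \<not> bdiv (modulus b i) c}"

lemma definable_elts: "fdef t \<Longrightarrow> fdef u \<Longrightarrow> definable (\<lambda>e. t e \<in> elts (u e))"
  by (rule definable_comp2[of "\<lambda>x s. x \<in> elts s"]) (unfold elts_def mem_Collect_eq, intro definable_intros definable_ex definable_bdiv tdef_modulus)

lemma elts_Sets: "elts s \<in> Sets M"
proof -
  have "definable (\<lambda>e. e 0 \<in> elts s)" by (intro definable_elts fdef_var fdef_const)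
  then show ?thesis using comprehension[of "\<lambda>x. x \<in> elts s"] by simp
qed

lemma elts_bounded: "\<exists>b. \<forall>x\<in>elts s. x \<prec> b"
proof (cases "\<exists>N b c. s = \<langle>N, \<langle>b, c\<rangle>\<rangle>")
  case True
  then show ?thesis unfolding elts_def by auto
next
  case False
  then show ?thesis unfolding elts_def by auto
qed

definition coded where "coded X \<longleftrightarrow> (\<exists>s. elts s = X)"

lemma coded_iff: "coded X \<longleftrightarrow> X \<in> Sets M \<and> (\<exists>b. \<forall>x\<in>X. x \<prec> b)"
proof
  assume "X \<in> Sets M \<and> (\<exists>b. \<forall>x\<in>X. x \<prec> b)"
  then obtain N where X: "X \<in> Sets M" and N: "\<And>x. x \<in> X \<Longrightarrow> x \<prec> N" by blast
  have "definable (\<lambda>e. e 1 \<in> X)" by (intro definable_intros X)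
  then obtain b c where "\<And>i. i \<prec> N \<Longrightarrow> i \<in> X \<longleftrightarrow> \<not> modulus b i divides c"
    by (rule sigma1_bounded_code[of "\<lambda>x i. i \<in> X" N]) (rule that, simp)
  then have "elts \<langle>N, \<langle>b, c\<rangle>\<rangle> = X" unfolding elts_def using N by (auto simp: bdiv_iff)
  then show "coded X" unfolding coded_def by blast
qed (use elts_Sets elts_bounded in \<open>auto simp: coded_def\<close>)

lemma coded_elts: "coded (elts s)" unfolding coded_def by blast

lemma coded_subset: "coded X \<Longrightarrow> Y \<subseteq> X \<Longrightarrow> Y \<in> Sets M \<Longrightarrow> coded Y"
  unfolding coded_iff by blast

text \<open>The least value is chosen so that \<open>entry s\<close> is a total function for every \<open>s\<close>; missing values are 0.\<close>

definition entry :: "'a \<Rightarrow> 'a \<Rightarrow> 'a" where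
  "entry s i = (if \<exists>w. \<langle>i, w\<rangle> \<in> elts s
     then THE w. \<langle>i, w\<rangle> \<in> elts s \<and> (\<forall>v. v \<prec> w \<longrightarrow> \<langle>i, v\<rangle> \<notin> elts s) else \<zero>)"

lemma entry_eq: "w = entry s i \<longleftrightarrow> (\<langle>i, w\<rangle> \<in> elts s \<and> (\<forall>v. v \<prec> w \<longrightarrow> \<langle>i, v\<rangle> \<notin> elts s)) \<or>
    (w = \<zero> \<and> \<not> (\<exists>w. \<langle>i, w\<rangle> \<in> elts s))"
proof (cases "\<exists>w. \<langle>i, w\<rangle> \<in> elts s")
  case True
  have "definable (\<lambda>e. \<langle>i, e 0\<rangle> \<in> elts s)" by (intro definable_elts fdef_var fdef_const fdef_pair)
  from definable_least[of "\<lambda>w. \<langle>i, w\<rangle> \<in> elts s", OF this]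
  have "\<exists>w. \<langle>i, w\<rangle> \<in> elts s \<and> (\<forall>v. v \<prec> w \<longrightarrow> \<langle>i, v\<rangle> \<notin> elts s)" using True by blast
  then obtain w0 where w0: "\<langle>i, w0\<rangle> \<in> elts s \<and> (\<forall>v. v \<prec> w0 \<longrightarrow> \<langle>i, v\<rangle> \<notin> elts s)" ..
  have un: "w = w0" if "\<langle>i, w\<rangle> \<in> elts s \<and> (\<forall>v. v \<prec> w \<longrightarrow> \<langle>i, v\<rangle> \<notin> elts s)" for w
    using that w0 lt_total[of w w0] by metis
  have "entry s i = w0" unfolding entry_def if_P[OF True] by (rule the_equality, rule w0, rule un)
  then show ?thesis using w0 un[of w] True by metis
qed (simp add: entry_def)

lemma fdef_ev: "fdef t \<Longrightarrow> fdef u \<Longrightarrow> fdef (\<lambda>e. entry (t e) (u e))"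
  by (rule fdef_comp2[of entry]) (unfold fdef_def entry_eq, intro definable_intros definable_ex definable_all definable_elts fdef_var fdef_pair)

lemmas def_intros = definable_conj definable_disj definable_imp definable_iff definable_ex definable_all definable_neg
  fdef_eq fdef_lt fdef_le definable_elts fdef_mem definable_const
  fdef_var fdef_const fdef_add fdef_pair fdef_msub fdef_ev fdef_if

text \<open>The graph over an initial segment is a set, and strong bounding makes it bounded, hence
  coded. The endpoint \<open>l\<close> is included because a walk of \<open>l\<close> steps has
  \<open>l + 1\<close> vertices.\<close>

lemma seq_code:
  assumes "fdef (\<lambda>e. g (e 0))"
  obtains s where "\<And>i. i \<preceq> l \<Longrightarrow> entry s i = g i"
proof -
  have g: "definable (\<lambda>e. e 0 = g (e 1))" using assms unfolding fdef_def by simp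
  from strong_bounding[of "\<lambda>w i. w = g i", OF this, of "l \<oplus> \<one>"]
  obtain B where B: "\<And>i. i \<preceq> l \<Longrightarrow> g i \<prec> B" by auto
  let ?X = "{z. \<exists>i. i \<preceq> l \<and> z = \<langle>i, g i\<rangle>}"
  have "?X \<in> Sets M"
    by (rule comprehension) (intro def_intros fdef_comp1[OF assms])
  moreover have "z \<prec> \<langle>l, B\<rangle> \<oplus> \<one>" if "z \<in> ?X" for z
    using that B pair_mono unfolding lt_succ by (auto simp: ar.less_imp_le)
  ultimately have "coded ?X" unfolding coded_iff by blast
  then obtain s where s: "elts s = ?X" unfolding coded_def by blast
  have "g i = entry s i" if "i \<preceq> l" for i
    unfolding entry_eq s using that by auto
  then show ?thesis using that by metis
qed

lemma mem_code_of_fin_seq: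
  assumes F: "F \<in> Sets M" "\<And>i. i \<prec> n \<Longrightarrow> \<exists>!w. \<langle>i, w\<rangle> \<in> F"
  obtains s where "\<And>i w. i \<prec> n \<Longrightarrow> \<langle>i, w\<rangle> \<in> F \<longleftrightarrow> w = entry s i"
proof -
  define g where "g i = (if i \<prec> n then THE w. \<langle>i, w\<rangle> \<in> F else \<zero>)" for i
  have g: "\<langle>i, w\<rangle> \<in> F \<longleftrightarrow> w = g i" if "i \<prec> n" for i w
    unfolding g_def using theI'[OF F(2)[OF that]] F(2)[OF that] that by auto
  have "w = g i \<longleftrightarrow> (i \<prec> n \<and> \<langle>i, w\<rangle> \<in> F) \<or> (\<not> i \<prec> n \<and> w = \<zero>)" for i w
  proof (cases "i \<prec> n")
    case True
    then show ?thesis using g[OF True] by simp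
  next
    case False
    then show ?thesis unfolding g_def by simp
  qed
  then have "fdef (\<lambda>e. g (e 0))" unfolding fdef_def by simp (intro def_intros F)
  then obtain s where "\<And>i. i \<preceq> n \<Longrightarrow> entry s i = g i" using seq_code by blast
  then show ?thesis using that[of s] g by (metis ar.less_imp_le)
qed

text \<open>The enumeration is a number instead of a set, so counting becomes a definable predicate
  that can occur in inductions.\<close>

definition card_code where
  "card_code s n \<longleftrightarrow> (\<exists>f. (\<forall>i. i \<prec> n \<longrightarrow> entry f i \<in> elts s) \<and>
     (\<forall>i. i \<prec> n \<longrightarrow> (\<forall>j. j \<prec> n \<longrightarrow> entry f i = entry f j \<longrightarrow> i = j)) \<and>
     (\<forall>u. u \<in> elts s \<longrightarrow> (\<exists>i. i \<prec> n \<and> entry f i = u)))"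

lemma card_code_iff: "card_code s n \<longleftrightarrow> (\<exists>f. bij_betw (entry f) {i. i \<prec> n} (elts s))"
proof -
  have "entry f ` {i. i \<prec> n} = elts s \<longleftrightarrow>
      (\<forall>i. i \<prec> n \<longrightarrow> entry f i \<in> elts s) \<and> (\<forall>u. u \<in> elts s \<longrightarrow> (\<exists>i. i \<prec> n \<and> entry f i = u))" for f
    unfolding set_eq_iff image_iff mem_Collect_eq Bex_def by metis
  then show ?thesis
    unfolding card_code_def bij_betw_def inj_on_def Ball_def mem_Collect_eq
    by (intro ex_cong1) (simp only: conj_ac)
qed

lemma definable_card_code: "fdef t \<Longrightarrow> fdef u \<Longrightarrow> definable (\<lambda>e. card_code (t e) (u e))"
  by (rule definable_comp2[of card_code]) (unfold card_code_def, intro def_intros)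

lemma card_codeI:
  assumes "fdef (\<lambda>e. g (e 0))" "bij_betw g {i. i \<prec> n} (elts s)"
  shows "card_code s n"
proof -
  obtain f where "\<And>i. i \<preceq> n \<Longrightarrow> entry f i = g i" using seq_code[OF assms(1)] by blast
  then have "bij_betw (entry f) {i. i \<prec> n} (elts s)"
    using assms(2) bij_betw_cong[of "{i. i \<prec> n}" g "entry f"] by (simp add: ar.less_imp_le)
  then show ?thesis unfolding card_code_iff by blast
qed

lemma has_card_iff: "has_card M X n \<longleftrightarrow> (\<exists>s. elts s = X \<and> card_code s n)"
proof
  assume "has_card M X n"
  then obtain F where F: "F \<in> Sets M" "fin_seq M F n" "\<forall>i u. \<langle>i, u\<rangle> \<in> F \<longrightarrow> u \<in> X"
    "\<forall>u\<in>X. \<exists>!i. \<langle>i, u\<rangle> \<in> F" unfolding has_card_def by (elim bexE conjE) (rule that)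
  have un: "\<exists>!w. \<langle>i, w\<rangle> \<in> F" if "i \<prec> n" for i using F(2) that unfolding fin_seq_def by blast
  have lt: "i \<prec> n" if "\<langle>i, w\<rangle> \<in> F" for i w using F(2) that unfolding fin_seq_def by fastforce
  obtain f where f: "\<And>i w. i \<prec> n \<Longrightarrow> \<langle>i, w\<rangle> \<in> F \<longleftrightarrow> w = entry f i"
    using mem_code_of_fin_seq[OF F(1) un] by blast
  have X: "X = {u. \<exists>i. i \<prec> n \<and> u = entry f i}"
    using F(3,4) f lt by blast
  have "X \<in> Sets M" unfolding X by (rule comprehension) (intro def_intros)
  have "definable (\<lambda>e. e 0 = entry f (e 1))" by (intro def_intros)
  from strong_bounding[of "\<lambda>w i. w = entry f i", OF this, of n]
  obtain B where "\<And>i. i \<prec> n \<Longrightarrow> entry f i \<prec> B" by auto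
  then have "coded X" using \<open>X \<in> Sets M\<close> unfolding coded_iff X by blast
  then obtain s where s: "elts s = X" unfolding coded_def by blast
  have "bij_betw (entry f) {i. i \<prec> n} (elts s)" unfolding s bij_betw_def inj_on_def
  proof (intro conjI ballI impI)
    fix i j assume ij: "i \<in> {i. i \<prec> n}" "j \<in> {i. i \<prec> n}" "entry f i = entry f j"
    then have "\<langle>i, entry f i\<rangle> \<in> F" "\<langle>j, entry f i\<rangle> \<in> F" using f by auto
    then show "i = j" using F(3,4) by blast
  qed (auto simp: X)
  then show "\<exists>s. elts s = X \<and> card_code s n" using s unfolding card_code_iff by blast
next
  assume "\<exists>s. elts s = X \<and> card_code s n"
  then obtain s f where s: "elts s = X" and f: "bij_betw (entry f) {i. i \<prec> n} X"
    unfolding card_code_iff by blast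
  let ?F = "{z. \<exists>i. i \<prec> n \<and> z = \<langle>i, entry f i\<rangle>}"
  have "?F \<in> Sets M" by (rule comprehension) (intro def_intros)
  then obtain F where F: "F \<in> Sets M" "F = ?F" by blast
  have mem: "\<langle>i, w\<rangle> \<in> F \<longleftrightarrow> i \<prec> n \<and> w = entry f i" for i w unfolding F(2) by auto
  have "fin_seq M F n" unfolding fin_seq_def mem using F(2) by auto
  moreover have "\<exists>!i. i \<prec> n \<and> u = entry f i" if "u \<in> X" for u
    using f that unfolding bij_betw_def inj_on_def by blast
  moreover have "entry f i \<in> X" if "i \<prec> n" for i
    using f that unfolding bij_betw_def by blast
  ultimately show "has_card M X n" unfolding has_card_def using F(1) mem by (intro bexI[of _ F]) simp_all
qed

lemma card_code_insert:
  assumes "card_code s n" "x \<notin> elts s" "elts t = insert x (elts s)"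
  shows "card_code t (n \<oplus> \<one>)"
proof -
  obtain f where f: "bij_betw (entry f) {i. i \<prec> n} (elts s)" using assms(1) unfolding card_code_iff by blast
  show ?thesis
  proof (rule card_codeI[of "\<lambda>i. if i = n then x else entry f i"])
    have eq: "{i. i \<prec> n \<oplus> \<one>} = insert n {i. i \<prec> n}" by (auto simp: le_def)
    show "bij_betw (\<lambda>i. if i = n then x else entry f i) {i. i \<prec> n \<oplus> \<one>} (elts t)"
      using f assms(2) unfolding eq assms(3) bij_betw_def inj_on_def by auto
  qed (intro def_intros)
qed

lemma card_code_remove:
  assumes "card_code t (n \<oplus> \<one>)" "x \<in> elts t" "elts s = elts t - {x}"
  shows "card_code s n"
proof -
  obtain f where f: "bij_betw (entry f) {i. i \<prec> n \<oplus> \<one>} (elts t)" using assms(1) unfolding card_code_iff by blast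
  have inj: "entry f i = entry f j \<Longrightarrow> i \<preceq> n \<Longrightarrow> j \<preceq> n \<Longrightarrow> i = j" for i j
    using f unfolding bij_betw_def inj_on_def by auto
  have sur: "u \<in> elts t \<longleftrightarrow> (\<exists>i. i \<preceq> n \<and> u = entry f i)" for u
    using f unfolding bij_betw_def by auto
  obtain k where k: "k \<preceq> n" "x = entry f k" using assms(2) sur by blast
  \<comment> \<open>The gap left by \<open>x\<close> at index \<open>k\<close> is filled with the
    last value.\<close>
  let ?g = "\<lambda>i. if i = k then entry f n else entry f i"
  show ?thesis
  proof (rule card_codeI[of ?g])
    show "bij_betw ?g {i. i \<prec> n} (elts s)"
    proof (rule bij_betwI')
      show "(?g i = ?g j) = (i = j)" if "i \<in> {i. i \<prec> n}" "j \<in> {i. i \<prec> n}" for i j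
        using that inj[of i j] inj[of n j] inj[of i n] by (auto simp: ar.less_imp_le)
      show "?g i \<in> elts s" if "i \<in> {i. i \<prec> n}" for i
      proof -
        have i: "i \<preceq> n" "i \<noteq> n" using that by (auto simp: ar.less_imp_le)
        have "entry f i \<in> elts t" "entry f n \<in> elts t" using i sur by blast+
        then show ?thesis using inj[OF _ i(1) k(1)] inj[of n k] k i(2) unfolding assms(3) by auto
      qed
      show "\<exists>i\<in>{i. i \<prec> n}. u = ?g i" if u: "u \<in> elts s" for u
      proof -
        obtain i where i: "i \<preceq> n" "u = entry f i" "i \<noteq> k"
          using u k(2) sur[of u] unfolding assms(3) by blast
        show ?thesis
        proof (cases "i = n")
          case True
          then have "k \<prec> n" using k i by (auto simp: le_def)
          then show ?thesis using i True by (intro bexI[of _ k]) auto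
        next
          case False
          then show ?thesis using i by (intro bexI[of _ i]) (auto simp: le_def)
        qed
      qed
    qed
  qed (intro def_intros)
qed

lemma code_remove: obtains t where "elts t = elts s - {x}"
proof -
  have "{y. y \<in> elts s \<and> y \<noteq> x} \<in> Sets M" by (rule comprehension) (intro def_intros)
  then have "elts s - {x} \<in> Sets M" by (rule back_subst[of "\<lambda>X. X \<in> Sets M"]) auto
  then have "coded (elts s - {x})" using coded_elts coded_subset by blast
  then show ?thesis using that unfolding coded_def by blast
qed

text \<open>Induction on a bound of the set; the step takes out its largest possible element
  \<open>b\<close>.\<close>

lemma card_code_exists: "\<exists>n. card_code s n"
proof -
  have ind: "\<forall>s. (\<forall>x. x \<in> elts s \<longrightarrow> x \<prec> b) \<longrightarrow> (\<exists>n. card_code s n)" for b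
  proof (rule definable_induct[of "\<lambda>b. \<forall>s. (\<forall>x. x \<in> elts s \<longrightarrow> x \<prec> b) \<longrightarrow> (\<exists>n. card_code s n)"])
    show "\<forall>s. (\<forall>x. x \<in> elts s \<longrightarrow> x \<prec> \<zero>) \<longrightarrow> (\<exists>n. card_code s n)"
    proof (intro allI impI)
      fix s assume "\<forall>x. x \<in> elts s \<longrightarrow> x \<prec> \<zero>"
      then have "bij_betw (entry s) {i. i \<prec> \<zero>} (elts s)" unfolding bij_betw_def by auto
      then show "\<exists>n. card_code s n" unfolding card_code_iff by blast
    qed
    fix b assume IH: "\<forall>s. (\<forall>x. x \<in> elts s \<longrightarrow> x \<prec> b) \<longrightarrow> (\<exists>n. card_code s n)"
    show "\<forall>s. (\<forall>x. x \<in> elts s \<longrightarrow> x \<prec> b \<oplus> \<one>) \<longrightarrow> (\<exists>n. card_code s n)"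
    proof (intro allI impI)
      fix s assume s: "\<forall>x. x \<in> elts s \<longrightarrow> x \<prec> b \<oplus> \<one>"
      obtain t where t: "elts t = elts s - {b}" using code_remove by blast
      then have "\<forall>x. x \<in> elts t \<longrightarrow> x \<prec> b" using s by (auto simp: le_def)
      then obtain n where n: "card_code t n" using IH by blast
      show "\<exists>n. card_code s n"
      proof (cases "b \<in> elts s")
        case True
        then have "elts s = insert b (elts t)" "b \<notin> elts t" using t by auto
        then show ?thesis using card_code_insert n by blast
      next
        case False
        then have "elts s = elts t" using t by auto
        then show ?thesis using n unfolding card_code_iff by auto
      qed
    qed
  qed (intro def_intros definable_card_code)
  then show ?thesis using elts_bounded[of s] by blast
qed

lemma card_code_zero: "card_code s \<zero> \<longleftrightarrow> elts s = {}"
  unfolding card_code_iff bij_betw_def by auto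

text \<open>The pigeonhole principle inside \<open>M\<close>: removing one element lowers both
  counts by one.\<close>

lemma card_code_unique: "card_code s n \<Longrightarrow> card_code s m \<Longrightarrow> n = m"
proof -
  have "\<forall>s m. card_code s n \<longrightarrow> card_code s m \<longrightarrow> n = m" for n
  proof (rule definable_induct[of "\<lambda>n. \<forall>s m. card_code s n \<longrightarrow> card_code s m \<longrightarrow> n = m"])
    show "\<forall>s m. card_code s \<zero> \<longrightarrow> card_code s m \<longrightarrow> \<zero> = m"
    proof (intro allI impI)
      fix s m assume "card_code s \<zero>" "card_code s m"
      then show "\<zero> = m"
        unfolding card_code_zero by (cases m rule: num_cases) (auto simp: card_code_def)
    qed
    fix n assume IH: "\<forall>s m. card_code s n \<longrightarrow> card_code s m \<longrightarrow> n = m"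
    show "\<forall>s m. card_code s (n \<oplus> \<one>) \<longrightarrow> card_code s m \<longrightarrow> n \<oplus> \<one> = m"
    proof (intro allI impI)
      fix s m assume n: "card_code s (n \<oplus> \<one>)" and m: "card_code s m"
      obtain x where x: "x \<in> elts s" using n unfolding card_code_def by auto
      then obtain k where k: "m = k \<oplus> \<one>" using m card_code_zero by (cases m rule: num_cases) auto
      obtain t where t: "elts t = elts s - {x}" using code_remove by blast
      have "card_code t n" "card_code t k" using card_code_remove[OF _ x t] n m k by auto
      then show "n \<oplus> \<one> = m" using IH k by blast
    qed
  qed (intro def_intros definable_card_code)
  then show "card_code s n \<Longrightarrow> card_code s m \<Longrightarrow> n = m" by blast
qed

section \<open>Parity\<close>

lemma even_odd_cases: obtains k where "n = k \<oplus> k" | k where "n = k \<oplus> k \<oplus> \<one>"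
proof -
  have "\<exists>k. n = k \<oplus> k \<or> n = k \<oplus> k \<oplus> \<one>"
  proof (rule definable_induct[of "\<lambda>n. \<exists>k. n = k \<oplus> k \<or> n = k \<oplus> k \<oplus> \<one>"])
    fix n assume "\<exists>k. n = k \<oplus> k \<or> n = k \<oplus> k \<oplus> \<one>"
    then obtain k where "n = k \<oplus> k \<or> n = k \<oplus> k \<oplus> \<one>" ..
    moreover have "k \<oplus> k \<oplus> \<one> \<oplus> \<one> = (k \<oplus> \<one>) \<oplus> (k \<oplus> \<one>)" by (simp add: add_ac)
    ultimately show "\<exists>k. n \<oplus> \<one> = k \<oplus> k \<or> n \<oplus> \<one> = k \<oplus> k \<oplus> \<one>" by metis
  qed (intro def_intros, auto intro: exI[of _ \<zero>])
  then show ?thesis using that by blast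
qed

lemma even_ne_odd: "k \<oplus> k \<noteq> j \<oplus> j \<oplus> \<one>"
proof (cases "k \<preceq> j")
  case True
  then have "k \<oplus> k \<preceq> j \<oplus> j" by (intro ar.add_mono)
  then have "k \<oplus> k \<prec> j \<oplus> j \<oplus> \<one>" by simp
  then show ?thesis by auto
next
  case False
  then have "j \<oplus> \<one> \<preceq> k" by auto
  then have "(j \<oplus> \<one>) \<oplus> (j \<oplus> \<one>) \<preceq> k \<oplus> k" by (intro ar.add_mono)
  moreover have "(j \<oplus> \<one>) \<oplus> (j \<oplus> \<one>) = (j \<oplus> j \<oplus> \<one>) \<oplus> \<one>" by (simp add: add_ac)
  ultimately have "j \<oplus> j \<oplus> \<one> \<prec> k \<oplus> k" by simp
  then show ?thesis by auto
qed

text \<open>Membership is compared pointwise so that the predicate remains definable when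
  \<open>X\<close> is given by a condition with parameters. A set without a code is never
  odd.\<close>

definition oddset where
  "oddset X \<longleftrightarrow> (\<exists>s. (\<forall>x. x \<in> elts s \<longleftrightarrow> x \<in> X) \<and> (\<exists>k. card_code s (k \<oplus> k \<oplus> \<one>)))"

lemma oddset_iff: "oddset X \<longleftrightarrow> (\<exists>k. has_card M X (k \<oplus> k \<oplus> \<one>))"
  unfolding oddset_def has_card_iff by (auto simp: set_eq_iff)

lemma oddset_empty: "\<not> oddset {}"
  unfolding oddset_def card_code_def by auto

lemma oddset_remove:
  assumes "coded X" "x \<in> X"
  shows "oddset (X - {x}) \<longleftrightarrow> \<not> oddset X"
proof -
  obtain t where t: "elts t = X" using assms(1) unfolding coded_def by blast
  obtain s where s: "elts s = elts t - {x}" using code_remove by blast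
  obtain n where n: "card_code s n" using card_code_exists by blast
  have n': "card_code t (n \<oplus> \<one>)" using card_code_insert[OF n, of x t] s t assms(2) by auto
  have same: "card_code u m \<longleftrightarrow> card_code v m" if "elts u = elts v" for u v m
    unfolding card_code_iff that ..
  have 1: "oddset X \<longleftrightarrow> (\<exists>k. n \<oplus> \<one> = k \<oplus> k \<oplus> \<one>)"
    unfolding oddset_iff has_card_iff using n' card_code_unique t same by metis
  have 2: "oddset (X - {x}) \<longleftrightarrow> (\<exists>k. n = k \<oplus> k \<oplus> \<one>)"
    unfolding oddset_iff has_card_iff using n card_code_unique s t same by metis
  show ?thesis unfolding 1 2
  proof (cases n rule: even_odd_cases)
    case (1 k)
    then show "(\<exists>k. n = k \<oplus> k \<oplus> \<one>) = (\<not> (\<exists>k. n \<oplus> \<one> = k \<oplus> k \<oplus> \<one>))"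
      using even_ne_odd[of k] by auto
  next
    case (2 k)
    then show "(\<exists>k. n = k \<oplus> k \<oplus> \<one>) = (\<not> (\<exists>k. n \<oplus> \<one> = k \<oplus> k \<oplus> \<one>))"
      using even_ne_odd[of _ k] by (metis basic(2))
  qed
qed

end

section \<open>Trails\<close>

context rca
begin

definition walk :: "'a set \<Rightarrow> ('a \<Rightarrow> 'a) \<Rightarrow> 'a \<Rightarrow> bool" where
  "walk K f n \<longleftrightarrow> (\<forall>i. i \<prec> n \<longrightarrow> \<langle>f i, f (i \<oplus> \<one>)\<rangle> \<in> K)"

definition edges :: "('a \<Rightarrow> 'a) \<Rightarrow> 'a \<Rightarrow> 'a set" where
  "edges f n = {x. \<exists>i. i \<prec> n \<and> (x = \<langle>f i, f (i \<oplus> \<one>)\<rangle> \<or> x = \<langle>f (i \<oplus> \<one>), f i\<rangle>)}"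

text \<open>\<open>edges\<close> contains both orientations, so testing one of them forbids a second
  use in either direction.\<close>

definition trail :: "'a set \<Rightarrow> ('a \<Rightarrow> 'a) \<Rightarrow> 'a \<Rightarrow> bool" where
  "trail K f n \<longleftrightarrow> (\<forall>i. i \<prec> n \<longrightarrow> \<langle>f i, f (i \<oplus> \<one>)\<rangle> \<in> K \<and> \<langle>f i, f (i \<oplus> \<one>)\<rangle> \<notin> edges f i)"

definition symm :: "'a set \<Rightarrow> bool" where
  "symm K \<longleftrightarrow> (\<forall>x\<in>K. \<exists>u v. x = \<langle>u, v\<rangle> \<and> \<langle>v, u\<rangle> \<in> K)"

lemma symmD: "symm K \<Longrightarrow> \<langle>u, v\<rangle> \<in> K \<Longrightarrow> \<langle>v, u\<rangle> \<in> K"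
  unfolding symm_def by fastforce

lemma symm_edges: "symm (edges f n)"
  unfolding symm_def edges_def by blast

lemma symm_diff: "symm K \<Longrightarrow> symm L \<Longrightarrow> symm (K - L)"
  unfolding symm_def by (metis DiffD1 DiffD2 DiffI pair_eq)

lemma edges_zero [simp]: "edges f \<zero> = {}"
  unfolding edges_def by simp

lemma edges_succ: "edges f (n \<oplus> \<one>) = edges f n \<union> {\<langle>f n, f (n \<oplus> \<one>)\<rangle>, \<langle>f (n \<oplus> \<one>), f n\<rangle>}"
  unfolding edges_def lt_succ le_def by blast

lemma edges_mono: "m \<preceq> n \<Longrightarrow> edges f m \<subseteq> edges f n"
  unfolding edges_def using ar.order.strict_trans2 by blast

lemma edges_cong: "(\<And>i. i \<preceq> n \<Longrightarrow> f i = g i) \<Longrightarrow> edges f n = edges g n"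
proof -
  assume fg: "\<And>i. i \<preceq> n \<Longrightarrow> f i = g i"
  have "f i = g i \<and> f (i \<oplus> \<one>) = g (i \<oplus> \<one>)" if "i \<prec> n" for i
    using fg[of i] fg[of "i \<oplus> \<one>"] that by (simp add: ar.less_imp_le)
  then show ?thesis unfolding edges_def by (intro Collect_cong ex_cong1 conj_cong refl) auto
qed

lemma trail_cong: "(\<And>i. i \<preceq> n \<Longrightarrow> f i = g i) \<Longrightarrow> trail K f n \<longleftrightarrow> trail K g n"
proof -
  assume fg: "\<And>i. i \<preceq> n \<Longrightarrow> f i = g i"
  have "f i = g i \<and> f (i \<oplus> \<one>) = g (i \<oplus> \<one>) \<and> edges f i = edges g i" if i: "i \<prec> n" for i
  proof (intro conjI edges_cong)
    show "f i = g i" "f (i \<oplus> \<one>) = g (i \<oplus> \<one>)"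
      using fg[of i] fg[of "i \<oplus> \<one>"] i by (simp_all add: ar.less_imp_le)
    show "f j = g j" if "j \<preceq> i" for j using fg[of j] that i by (meson ar.less_imp_le ar.order.trans)
  qed
  then show ?thesis unfolding trail_def by (intro all_cong) auto
qed

lemma trail_succ: "trail K f (n \<oplus> \<one>) \<longleftrightarrow>
    trail K f n \<and> \<langle>f n, f (n \<oplus> \<one>)\<rangle> \<in> K \<and> \<langle>f n, f (n \<oplus> \<one>)\<rangle> \<notin> edges f n"
  unfolding trail_def lt_succ le_def by blast

lemma trail_walk: "trail K f n \<Longrightarrow> walk K f n"
  unfolding trail_def walk_def by blast

lemma trail_prefix: "trail K f n \<Longrightarrow> m \<preceq> n \<Longrightarrow> trail K f m"
  unfolding trail_def using ar.order.strict_trans2 by blast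

lemma trail_zero [simp]: "trail K f \<zero>"
  unfolding trail_def by simp

lemma edges_subset: "walk K f n \<Longrightarrow> symm K \<Longrightarrow> edges f n \<subseteq> K"
  unfolding walk_def edges_def using symmD by blast

lemma trail_diff:
  assumes "trail K f n" "edges f n \<inter> L = {}"
  shows "trail (K - L) f n"
  using assms unfolding trail_def edges_def by blast

lemma trail_subset: "trail K f n \<Longrightarrow> K \<subseteq> L \<Longrightarrow> trail L f n"
  unfolding trail_def by blast

lemma lt_add_cases: "j \<prec> n \<oplus> m \<longleftrightarrow> j \<prec> n \<or> (\<exists>k. k \<prec> m \<and> j = n \<oplus> k)"
proof (cases "j \<prec> n")
  case True
  then show ?thesis using le_add(1)[of n m] ar.order.strict_trans2 by blast
next
  case False
  then obtain k where "j = n \<oplus> k" using le_iff_add ar.not_less by blast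
  then show ?thesis by simp
qed

lemma edges_add:
  assumes "\<And>i. i \<preceq> n \<Longrightarrow> h i = f i" "\<And>j. j \<preceq> m \<Longrightarrow> h (n \<oplus> j) = g j"
  shows "edges h (n \<oplus> m) = edges f n \<union> edges g m"
proof -
  have 1: "h i = f i \<and> h (i \<oplus> \<one>) = f (i \<oplus> \<one>)" if "i \<prec> n" for i
    using assms(1)[of i] assms(1)[of "i \<oplus> \<one>"] that by (simp add: ar.less_imp_le)
  have 2: "h (n \<oplus> j) = g j \<and> h (n \<oplus> j \<oplus> \<one>) = g (j \<oplus> \<one>)" if "j \<prec> m" for j
    using assms(2)[of j] assms(2)[of "j \<oplus> \<one>"] that by (simp add: ar.less_imp_le add_assoc)
  show ?thesis unfolding edges_def lt_add_cases using 1 2 by (auto; metis)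
qed

text \<open>Being an equivalence, this serves both to glue trails and to cut them: the second part
  may use exactly the edges that the first leaves over.\<close>

lemma trail_add:
  assumes h: "\<And>i. i \<preceq> n \<Longrightarrow> h i = f i" "\<And>j. j \<preceq> m \<Longrightarrow> h (n \<oplus> j) = g j"
  shows "trail K h (n \<oplus> m) \<longleftrightarrow> trail K f n \<and> trail (K - edges f n) g m"
proof -
  have 2: "h (n \<oplus> j) = g j \<and> h (n \<oplus> j \<oplus> \<one>) = g (j \<oplus> \<one>) \<and> edges h (n \<oplus> j) = edges f n \<union> edges g j"
    if j: "j \<prec> m" for j
  proof (intro conjI)
    show "h (n \<oplus> j) = g j" using h(2)[of j] j by (simp add: ar.less_imp_le)
    show "h (n \<oplus> j \<oplus> \<one>) = g (j \<oplus> \<one>)" using h(2)[of "j \<oplus> \<one>"] j by (simp add: add_assoc)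
    have "i \<preceq> m" if "i \<preceq> j" for i using that j by order
    then show "edges h (n \<oplus> j) = edges f n \<union> edges g j" by (intro edges_add h)
  qed
  have "trail K h (n \<oplus> m) \<longleftrightarrow> trail K h n \<and>
      (\<forall>j. j \<prec> m \<longrightarrow> \<langle>h (n \<oplus> j), h (n \<oplus> j \<oplus> \<one>)\<rangle> \<in> K \<and> \<langle>h (n \<oplus> j), h (n \<oplus> j \<oplus> \<one>)\<rangle> \<notin> edges h (n \<oplus> j))"
    unfolding trail_def lt_add_cases by blast
  also have "trail K h n \<longleftrightarrow> trail K f n" by (rule trail_cong) (rule h)
  finally show ?thesis unfolding trail_def[of "K - edges f n"] using 2 by auto
qed

text \<open>The edge was traversed at step \<open>n\<close> or later, so both of its endpoints are
  visited from time \<open>n\<close> on. This is what allows insertions that leave an initial part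
  alone.\<close>

lemma edges_index:
  assumes "\<langle>x, y\<rangle> \<in> edges f m" "\<langle>x, y\<rangle> \<notin> edges f n"
  shows "\<exists>i. n \<preceq> i \<and> i \<preceq> m \<and> f i = x" "\<exists>i. n \<preceq> i \<and> i \<preceq> m \<and> f i = y"
proof -
  obtain i where i: "i \<prec> m" "(x = f i \<and> y = f (i \<oplus> \<one>)) \<or> (x = f (i \<oplus> \<one>) \<and> y = f i)"
    using assms(1) unfolding edges_def by auto
  have "n \<preceq> i" using assms(2) i unfolding edges_def by (auto simp: ar.not_less)
  moreover have "n \<preceq> i \<oplus> \<one>" using \<open>n \<preceq> i\<close> le_add(1)[of i \<one>] by order
  moreover have "i \<preceq> m" "i \<oplus> \<one> \<preceq> m" using i(1) by (auto simp: ar.less_imp_le)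
  ultimately show "\<exists>i. n \<preceq> i \<and> i \<preceq> m \<and> f i = x" "\<exists>i. n \<preceq> i \<and> i \<preceq> m \<and> f i = y" using i(2) by blast+
qed

text \<open>With all of \<open>M\<close> as vertex set, reachability depends on the edges only;
  numbers that are not vertices of the graph become isolated points.\<close>

abbreviation conn :: "'a set \<Rightarrow> 'a \<Rightarrow> 'a \<Rightarrow> bool" where
  "conn K u v \<equiv> joined M UNIV K u v"

lemma conn_refl: "conn K u u" by (rule joined_refl) simp
lemma conn_edge: "\<langle>u, v\<rangle> \<in> K \<Longrightarrow> conn K u v" by (rule joined_edge) simp_all
lemma conn_sym: "symm K \<Longrightarrow> conn K u v \<Longrightarrow> conn K v u"
  by (rule joined_sym) (use symmD in blast)+

lemma joined_iff_conn: "joined M V K u v \<longleftrightarrow> u \<in> V \<and> v \<in> V \<and> conn K u v"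
  unfolding joined_def by auto

definition nb :: "'a set \<Rightarrow> 'a \<Rightarrow> 'a set" where
  "nb K x = {y. \<langle>x, y\<rangle> \<in> K}"

end

context aca
begin

section \<open>Definability of trails and reachability\<close>

lemma definable_edges:
  assumes "fdef t" "fdef u" "fdef v"
  shows "definable (\<lambda>e. t e \<in> edges (entry (u e)) (v e))"
  by (rule definable_comp3[of "\<lambda>x s n. x \<in> edges (entry s) n"])
    (unfold edges_def mem_Collect_eq, intro def_intros, (rule assms)+)

lemma definable_trail:
  assumes "K \<in> Sets M" "fdef u" "fdef v"
  shows "definable (\<lambda>e. trail K (entry (u e)) (v e))"
  by (rule definable_comp2[of "\<lambda>s n. trail K (entry s) n"])
    (unfold trail_def, intro def_intros definable_edges assms, (rule assms)+)

text \<open>The set quantifier over walks becomes a number quantifier over codes, which makes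
  reachability definable.\<close>

lemma conn_iff: "conn K u v \<longleftrightarrow> (\<exists>s n. walk K (entry s) n \<and> entry s \<zero> = u \<and> entry s n = v)"
proof
  assume "conn K u v"
  then obtain F f n where F: "F \<in> Sets M" "\<And>i w. i \<preceq> n \<Longrightarrow> \<langle>i, w\<rangle> \<in> F \<longleftrightarrow> w = f i"
    "f \<zero> = u" "f n = v" "\<And>i. i \<prec> n \<Longrightarrow> \<langle>f i, f (i \<oplus> \<one>)\<rangle> \<in> K"
    by (rule joinedE) (rule that; assumption)
  have "\<exists>!w. \<langle>i, w\<rangle> \<in> F" if "i \<prec> n \<oplus> \<one>" for i using F(2)[of i] that by simp
  then obtain s where "\<And>i w. i \<prec> n \<oplus> \<one> \<Longrightarrow> \<langle>i, w\<rangle> \<in> F \<longleftrightarrow> w = entry s i"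
    using mem_code_of_fin_seq[OF F(1)] by blast
  then have s: "entry s i = f i" if "i \<preceq> n" for i using F(2)[OF that] that by (metis lt_succ)
  have "walk K (entry s) n" unfolding walk_def
  proof (intro allI impI)
    fix i assume "i \<prec> n"
    then show "\<langle>entry s i, entry s (i \<oplus> \<one>)\<rangle> \<in> K"
      using F(5)[of i] s[of i] s[of "i \<oplus> \<one>"] by (simp add: ar.less_imp_le)
  qed
  then show "\<exists>s n. walk K (entry s) n \<and> entry s \<zero> = u \<and> entry s n = v"
    using s[of \<zero>] s[of n] F(3,4) by (intro exI[of _ s] exI[of _ n]) simp
next
  assume "\<exists>s n. walk K (entry s) n \<and> entry s \<zero> = u \<and> entry s n = v"
  then obtain s n where s: "walk K (entry s) n" "entry s \<zero> = u" "entry s n = v" by blast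
  have "{z. \<exists>i. z = \<langle>i, entry s i\<rangle>} \<in> Sets M" by (rule comprehension) (intro def_intros)
  from joinedI[OF this, of n "entry s" UNIV K] show "conn K u v"
    using s unfolding walk_def by simp
qed

lemma definable_conn:
  assumes "K \<in> Sets M" "fdef u" "fdef v"
  shows "definable (\<lambda>e. conn K (u e) (v e))"
  by (rule definable_comp2[of "\<lambda>x y. conn K x y"])
    (unfold conn_iff walk_def, intro def_intros assms, (rule assms)+)

lemma conn_induct:
  assumes "conn K u v" "definable (\<lambda>e. Q (e 0))" "Q u" and step: "\<And>x y. Q x \<Longrightarrow> \<langle>x, y\<rangle> \<in> K \<Longrightarrow> Q y"
  shows "Q v"
proof -
  obtain s n where s: "walk K (entry s) n" "entry s \<zero> = u" "entry s n = v"
    using assms(1) unfolding conn_iff by blast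
  have "i \<preceq> n \<longrightarrow> Q (entry s i)" for i
  proof (rule definable_induct[of "\<lambda>i. i \<preceq> n \<longrightarrow> Q (entry s i)"])
    fix i assume "i \<preceq> n \<longrightarrow> Q (entry s i)"
    then show "i \<oplus> \<one> \<preceq> n \<longrightarrow> Q (entry s (i \<oplus> \<one>))"
      using step[of "entry s i" "entry s (i \<oplus> \<one>)"] s(1) unfolding walk_def succ_le by (auto simp: ar.less_imp_le)
  qed (intro def_intros definable_comp1[OF assms(2)], simp add: s(2) assms(3))
  then show ?thesis using s(3) by blast
qed

lemma walk_conn:
  assumes "walk K (entry s) n" "i \<preceq> n"
  shows "conn K (entry s \<zero>) (entry s i)"
  using assms unfolding conn_iff walk_def by (metis ar.order.strict_trans2)

lemma conn_out: "conn K x y \<Longrightarrow> x = y \<or> (\<exists>z. \<langle>x, z\<rangle> \<in> K)"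
proof -
  assume "conn K x y"
  then obtain s n where s: "walk K (entry s) n" "entry s \<zero> = x" "entry s n = y" unfolding conn_iff by blast
  show ?thesis
  proof (cases "n = \<zero>")
    case False
    then have "\<langle>entry s \<zero>, entry s (\<zero> \<oplus> \<one>)\<rangle> \<in> K" using s(1) unfolding walk_def gt_zero_iff[symmetric] by blast
    then show ?thesis using s(2) by blast
  qed (use s in auto)
qed

lemma concat_code:
  assumes "entry s n = entry t \<zero>"
  obtains u where "\<And>i. i \<preceq> n \<Longrightarrow> entry u i = entry s i" "\<And>j. j \<preceq> m \<Longrightarrow> entry u (n \<oplus> j) = entry t j"
proof -
  have "fdef (\<lambda>e. if e 0 \<preceq> n then entry s (e 0) else entry t (e 0 \<ominus> n))" by (intro def_intros)
  from seq_code[of "\<lambda>i. if i \<preceq> n then entry s i else entry t (i \<ominus> n)", OF this, of "n \<oplus> m"]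
  obtain u where u: "\<And>i. i \<preceq> n \<oplus> m \<Longrightarrow> entry u i = (if i \<preceq> n then entry s i else entry t (i \<ominus> n))" by blast
  show ?thesis
  proof (rule that)
    show "entry u i = entry s i" if "i \<preceq> n" for i
      using u[of i] that le_add(1)[of n m] ar.order.trans by simp
    show "entry u (n \<oplus> j) = entry t j" if "j \<preceq> m" for j
      using u[of "n \<oplus> j"] that assms le_add(1)[of n j] by (cases "j = \<zero>") auto
  qed
qed

lemma append_code:
  obtains u where "\<And>i. i \<preceq> n \<Longrightarrow> entry u i = entry s i" "entry u (n \<oplus> \<one>) = y"
proof -
  have "fdef (\<lambda>e. if e 0 \<preceq> n then entry s (e 0) else y)" by (intro def_intros)
  from seq_code[of "\<lambda>i. if i \<preceq> n then entry s i else y", OF this, of "n \<oplus> \<one>"]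
  obtain u where u: "\<And>i. i \<preceq> n \<oplus> \<one> \<Longrightarrow> entry u i = (if i \<preceq> n then entry s i else y)" by blast
  show ?thesis
  proof (rule that)
    show "entry u i = entry s i" if "i \<preceq> n" for i using u[of i] that le_succ_iff[of i n] by simp
    show "entry u (n \<oplus> \<one>) = y" using u[of "n \<oplus> \<one>"] by simp
  qed
qed

lemma trail_append:
  assumes "trail K (entry s) n" "\<langle>entry s n, y\<rangle> \<in> K - edges (entry s) n"
  obtains u where "\<And>i. i \<preceq> n \<Longrightarrow> entry u i = entry s i" "entry u (n \<oplus> \<one>) = y" "trail K (entry u) (n \<oplus> \<one>)"
    "edges (entry u) (n \<oplus> \<one>) = edges (entry s) n \<union> {\<langle>entry s n, y\<rangle>, \<langle>y, entry s n\<rangle>}"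
proof -
  obtain u where u: "\<And>i. i \<preceq> n \<Longrightarrow> entry u i = entry s i" "entry u (n \<oplus> \<one>) = y" using append_code[of n s y] by blast
  have "edges (entry u) n = edges (entry s) n" "trail K (entry u) n \<longleftrightarrow> trail K (entry s) n"
    by (rule edges_cong trail_cong, erule u)+
  then show ?thesis using that[of u] u assms unfolding trail_succ edges_succ by simp
qed

lemma edges_Sets: "edges (entry s) n \<in> Sets M"
  using comprehension[of "\<lambda>x. x \<in> edges (entry s) n"] definable_edges[OF fdef_var fdef_const fdef_const] by simp

lemma edges_bounded: "\<exists>b. \<forall>x\<in>edges (entry s) n. x \<prec> b"
proof -
  have "definable (\<lambda>e. e 0 = entry s (e 1))" by (intro def_intros)
  from strong_bounding[of "\<lambda>w i. w = entry s i", OF this, of "n \<oplus> \<one>"]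
  obtain B where B: "\<And>i. i \<preceq> n \<Longrightarrow> entry s i \<prec> B" by auto
  have "x \<prec> \<langle>B, B\<rangle> \<oplus> \<one>" if x: "x \<in> edges (entry s) n" for x
  proof -
    obtain i where i: "i \<prec> n" "x = \<langle>entry s i, entry s (i \<oplus> \<one>)\<rangle> \<or> x = \<langle>entry s (i \<oplus> \<one>), entry s i\<rangle>"
      using x unfolding edges_def by blast
    have "entry s i \<preceq> B" "entry s (i \<oplus> \<one>) \<preceq> B" using B[of i] B[of "i \<oplus> \<one>"] i(1) by (auto simp: ar.less_imp_le)
    then show ?thesis unfolding lt_succ using i(2) pair_mono by blast
  qed
  then show ?thesis by blast
qed

lemma Sets_diff: "A \<in> Sets M \<Longrightarrow> B \<in> Sets M \<Longrightarrow> A - B \<in> Sets M"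
  using comprehension[of "\<lambda>x. x \<in> A \<and> x \<notin> B"] definable_conj[OF fdef_mem[OF _ fdef_var] definable_neg[OF fdef_mem[OF _ fdef_var]]]
  by (simp add: set_diff_eq)

lemma nb_Sets: "K \<in> Sets M \<Longrightarrow> nb K x \<in> Sets M"
  unfolding nb_def by (rule comprehension) (intro def_intros)

text \<open>Follow the walk with a trail. If the next edge has been used before, its far end already
  lies on the trail, which is then cut off there.\<close>

lemma conn_trail:
  assumes K: "K \<in> Sets M" and "conn K u v"
  obtains s n where "trail K (entry s) n" "entry s \<zero> = u" "entry s n = v"
proof -
  let ?Q = "\<lambda>v. \<exists>s n. trail K (entry s) n \<and> entry s \<zero> = u \<and> entry s n = v"
  have "?Q v"
  proof (rule conn_induct[OF assms(2), of ?Q])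
    show "definable (\<lambda>e. ?Q (e 0))" by (intro def_intros definable_trail K)
    obtain s where "entry s \<zero> = u" using seq_code[of "\<lambda>_. u" \<zero>] fdef_const by auto
    then show "?Q u" using trail_zero by blast
    fix x y assume "?Q x" and xy: "\<langle>x, y\<rangle> \<in> K"
    then obtain s n where s: "trail K (entry s) n" "entry s \<zero> = u" "entry s n = x" by blast
    show "?Q y"
    proof (cases "\<langle>x, y\<rangle> \<in> edges (entry s) n")
      case True
      then obtain i where "i \<preceq> n" "entry s i = y" using edges_index(2)[of x y "entry s" n \<zero>] by auto
      then show ?thesis using trail_prefix[OF s(1)] s(2) by blast
    next
      case False
      with xy s obtain t where "\<And>i. i \<preceq> n \<Longrightarrow> entry t i = entry s i" "entry t (n \<oplus> \<one>) = y"
        "trail K (entry t) (n \<oplus> \<one>)" using trail_append[of K s n y] by blast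
      then show ?thesis using s(2) zero_le by metis
    qed
  qed
  then show ?thesis using that by blast
qed

lemma oddset_ne: "oddset X \<Longrightarrow> X \<noteq> {}" using oddset_empty by blast

text \<open>A step takes one edge away from each of its two ends and flips the parity at both; over
  a whole trail the flips cancel except at its start and its end. The inequalities of truth values
  are exclusive disjunctions, so closed trails are covered too.\<close>

lemma trail_parity:
  assumes K: "K \<in> Sets M" "symm K" "\<And>x. \<langle>x, x\<rangle> \<notin> K" and t: "trail K (entry s) n" and c: "coded (nb K x)"
  shows "oddset (nb (K - edges (entry s) n) x) \<longleftrightarrow> ((oddset (nb K x) \<noteq> (x = entry s \<zero>)) \<noteq> (x = entry s n))"
proof -
  let ?P = "\<lambda>m. oddset (nb (K - edges (entry s) m) x) \<longleftrightarrow> ((oddset (nb K x) \<noteq> (x = entry s \<zero>)) \<noteq> (x = entry s m))"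
  have "m \<preceq> n \<longrightarrow> ?P m" for m
  proof (rule definable_induct[of "\<lambda>m. m \<preceq> n \<longrightarrow> ?P m"])
    show "definable (\<lambda>e. e 0 \<preceq> n \<longrightarrow> ?P (e 0))"
      unfolding oddset_def nb_def mem_Collect_eq Diff_iff
      by (intro def_intros definable_edges definable_card_code K)
    fix m assume IH: "m \<preceq> n \<longrightarrow> ?P m"
    show "m \<oplus> \<one> \<preceq> n \<longrightarrow> ?P (m \<oplus> \<one>)"
    proof
      assume "m \<oplus> \<one> \<preceq> n"
      then have m: "m \<prec> n" by simp
      then have IH: "?P m" using IH by (simp add: ar.less_imp_le)
      let ?K = "K - edges (entry s) m" and ?u = "entry s m" and ?v = "entry s (m \<oplus> \<one>)"
      have uv: "\<langle>?u, ?v\<rangle> \<in> ?K" using t m unfolding trail_def by blast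
      then have vu: "\<langle>?v, ?u\<rangle> \<in> ?K" using symmD[OF symm_diff[OF K(2) symm_edges]] by blast
      have ne: "?u \<noteq> ?v" using uv K(3) by auto
      have cK: "coded (nb ?K x)"
        by (rule coded_subset[OF c _ nb_Sets[OF Sets_diff[OF K(1) edges_Sets]]]) (auto simp: nb_def)
      have eq: "nb (K - edges (entry s) (m \<oplus> \<one>)) x =
          nb ?K x - (if x = ?u then {?v} else if x = ?v then {?u} else {})"
        unfolding nb_def edges_succ using ne by auto
      consider "x = ?u" | "x = ?v" | "x \<noteq> ?u" "x \<noteq> ?v" by blast
      then show "?P (m \<oplus> \<one>)"
      proof cases
        case 1
        then have "?v \<in> nb ?K x" using uv unfolding nb_def by simp
        from oddset_remove[OF cK this] show ?thesis unfolding eq using IH 1 ne by auto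
      next
        case 2
        then have "?u \<in> nb ?K x" using vu unfolding nb_def by simp
        from oddset_remove[OF cK this] show ?thesis unfolding eq using IH 2 ne by auto
      next
        case 3
        then show ?thesis unfolding eq using IH by simp
      qed
    qed
  qed auto
  then show ?thesis by simp
qed

text \<open>Greedy selection by code: at stage \<open>k\<close> the trail is exchanged for an
  admissible one that keeps all its edges and contains \<open>k\<close>, if there is one. Since the
  edges lie below \<open>b\<close>, the trail at stage \<open>b\<close> is maximal with respect to
  inclusion.\<close>

lemma maximal_trail:
  assumes P: "definable (\<lambda>e. P (e 0) (e 1))" and b: "\<forall>s n x. P s n \<longrightarrow> x \<in> edges (entry s) n \<longrightarrow> x \<prec> b"
    and "P s0 n0"
  shows "\<exists>s n. P s n \<and>
    (\<forall>t m. P t m \<longrightarrow> edges (entry s) n \<subseteq> edges (entry t) m \<longrightarrow> edges (entry t) m \<subseteq> edges (entry s) n)"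
proof -
  let ?Q = "\<lambda>k. \<exists>s n. P s n \<and> (\<forall>t m. P t m \<longrightarrow> (\<forall>x. x \<in> edges (entry s) n \<longrightarrow> x \<in> edges (entry t) m) \<longrightarrow>
    (\<forall>x. x \<prec> k \<longrightarrow> x \<in> edges (entry t) m \<longrightarrow> x \<in> edges (entry s) n))"
  have "?Q b"
  proof (rule definable_induct[of ?Q])
    show "definable (\<lambda>e. ?Q (e 0))" by (intro def_intros definable_edges definable_comp2[OF P])
    show "?Q \<zero>" using assms(3) by auto
    fix k assume "?Q k"
    then obtain s n where s: "P s n" and max: "\<And>t m x. P t m \<Longrightarrow> edges (entry s) n \<subseteq> edges (entry t) m \<Longrightarrow>
      x \<prec> k \<Longrightarrow> x \<in> edges (entry t) m \<Longrightarrow> x \<in> edges (entry s) n" by blast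
    show "?Q (k \<oplus> \<one>)"
    proof (cases "\<exists>t m. P t m \<and> edges (entry s) n \<subseteq> edges (entry t) m \<and> k \<in> edges (entry t) m")
      case True
      then obtain t m where t: "P t m" "edges (entry s) n \<subseteq> edges (entry t) m" "k \<in> edges (entry t) m" by blast
      have "x \<in> edges (entry t) m" if "P u l" "edges (entry t) m \<subseteq> edges (entry u) l" "x \<preceq> k" "x \<in> edges (entry u) l"
        for u l x using max[of u l x] that t unfolding le_def by blast
      then show ?thesis using t(1) unfolding lt_succ by blast
    next
      case False
      have "x \<in> edges (entry s) n" if "P u l" "edges (entry s) n \<subseteq> edges (entry u) l" "x \<preceq> k" "x \<in> edges (entry u) l"
        for u l x using max[of u l x] that False unfolding le_def by blast
      then show ?thesis using s unfolding lt_succ by blast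
    qed
  qed
  then show ?thesis using b by blast
qed

text \<open>Always taking the least successor makes the sequence unique. Its graph \<open>A\<close>
  states the existence of a coded finite approximation, which is definable, so totality and
  uniqueness follow by induction.\<close>

lemma dependent_choice:
  assumes R: "definable (\<lambda>e. R (e 0) (e 1) (e 2))" and x0: "I x0"
    and step: "\<And>k x. I x \<Longrightarrow> \<exists>y. I y \<and> R k x y" and I: "definable (\<lambda>e. I (e 0))"
  obtains h where "fdef (\<lambda>e. h (e 0))" "h \<zero> = x0" "\<And>k. I (h k)" "\<And>k. R k (h k) (h (k \<oplus> \<one>))"
proof -
  let ?S = "\<lambda>k x y. I y \<and> R k x y \<and> (\<forall>z. z \<prec> y \<longrightarrow> \<not> (I z \<and> R k x z))"
  have dS: "fdef t \<Longrightarrow> fdef u \<Longrightarrow> fdef v \<Longrightarrow> definable (\<lambda>e. ?S (t e) (u e) (v e))" for t u v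
    by (rule definable_comp3[of ?S]) (intro def_intros definable_comp3[OF R] definable_comp1[OF I])
  have ex: "\<exists>y. ?S k x y" if "I x" for k x
  proof -
    have "definable (\<lambda>e. I (e 0) \<and> R k x (e 0))" by (intro def_intros definable_comp3[OF R] definable_comp1[OF I])
    from definable_least[of "\<lambda>y. I y \<and> R k x y", OF this] step[OF that, of k] show ?thesis by blast
  qed
  have un: "y = z" if "?S k x y" "?S k x z" for k x y z using that lt_total[of y z] by blast
  define A where "A n y \<longleftrightarrow>
    (\<exists>s. entry s \<zero> = x0 \<and> (\<forall>i. i \<prec> n \<longrightarrow> ?S i (entry s i) (entry s (i \<oplus> \<one>))) \<and> entry s n = y)" for n y
  have dA: "fdef t \<Longrightarrow> fdef u \<Longrightarrow> definable (\<lambda>e. A (t e) (u e))" for t u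
    by (rule definable_comp2[of A]) (unfold A_def, intro def_intros dS)
  have A0: "A \<zero> y \<longleftrightarrow> y = x0" for y
  proof -
    obtain s where "entry s \<zero> = x0" using seq_code[of "\<lambda>_. x0" \<zero>] fdef_const by auto
    then show ?thesis unfolding A_def by auto
  qed
  have Asucc: "A (n \<oplus> \<one>) y \<longleftrightarrow> (\<exists>x. A n x \<and> ?S n x y)" for n y
  proof
    assume "A (n \<oplus> \<one>) y"
    then show "\<exists>x. A n x \<and> ?S n x y" unfolding A_def lt_succ le_def by blast
  next
    assume "\<exists>x. A n x \<and> ?S n x y"
    then obtain s where s: "entry s \<zero> = x0" "\<And>i. i \<prec> n \<Longrightarrow> ?S i (entry s i) (entry s (i \<oplus> \<one>))" "?S n (entry s n) y"
      unfolding A_def by blast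
    obtain u where u: "\<And>i. i \<preceq> n \<Longrightarrow> entry u i = entry s i" "entry u (n \<oplus> \<one>) = y" using append_code[of n s y] by blast
    have "?S i (entry u i) (entry u (i \<oplus> \<one>))" if "i \<prec> n" for i
      using s(2)[OF that] u(1)[of i] u(1)[of "i \<oplus> \<one>"] that by (simp add: ar.less_imp_le)
    moreover have "?S n (entry u n) (entry u (n \<oplus> \<one>))" using s(3) u(1)[of n] u(2) by simp
    ultimately have "\<forall>i. i \<prec> n \<oplus> \<one> \<longrightarrow> ?S i (entry u i) (entry u (i \<oplus> \<one>))" unfolding lt_succ le_def by blast
    then show "A (n \<oplus> \<one>) y" using u(1)[of \<zero>] u(2) s(1) unfolding A_def by (intro exI[of _ u]) simp
  qed
  have Aex: "\<exists>y. A n y \<and> I y" for n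
    by (rule definable_induct[of "\<lambda>n. \<exists>y. A n y \<and> I y"], intro def_intros dA definable_comp1[OF I])
      (use A0 x0 in blast, unfold Asucc, use ex in blast)
  have Aun: "\<forall>y z. A n y \<longrightarrow> A n z \<longrightarrow> y = z" for n
  proof (rule definable_induct[of "\<lambda>n. \<forall>y z. A n y \<longrightarrow> A n z \<longrightarrow> y = z"])
    show "definable (\<lambda>e. \<forall>y z. A (e 0) y \<longrightarrow> A (e 0) z \<longrightarrow> y = z)" by (intro def_intros dA)
    show "\<forall>y z. A \<zero> y \<longrightarrow> A \<zero> z \<longrightarrow> y = z" unfolding A0 by simp
    fix n assume IH: "\<forall>y z. A n y \<longrightarrow> A n z \<longrightarrow> y = z"
    show "\<forall>y z. A (n \<oplus> \<one>) y \<longrightarrow> A (n \<oplus> \<one>) z \<longrightarrow> y = z"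
      unfolding Asucc
    proof (intro allI impI)
      fix y z assume "\<exists>x. A n x \<and> ?S n x y" "\<exists>x. A n x \<and> ?S n x z"
      then obtain x x' where x: "A n x" "?S n x y" and x': "A n x'" "?S n x' z" by (elim exE conjE) blast
      have "x = x'" using IH x(1) x'(1) by blast
      show "y = z" by (rule un[OF x(2)]) (use x'(2) \<open>x = x'\<close> in simp)
    qed
  qed
  define h where "h n = (THE y. A n y)" for n
  have h: "y = h n \<longleftrightarrow> A n y" for n y
  proof -
    obtain w where w: "A n w" using Aex[of n] by (elim exE conjE) blast
    have u: "y = w" if "A n y" for y using Aun[of n, THEN spec, THEN spec, THEN mp, THEN mp, OF that w] .
    have "h n = w" unfolding h_def by (rule the_equality, rule w, rule u)
    then show ?thesis using w u[of y] by (intro iffI) simp_all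
  qed
  show ?thesis
  proof (rule that[of h])
    show "fdef (\<lambda>e. h (e 0))" unfolding fdef_def h by (intro dA fdef_var)
    have "A \<zero> x0" unfolding A0 ..
    then show "h \<zero> = x0" by (rule h[THEN iffD2, symmetric])
    show "I (h k)" for k using Aex[of k] h[of _ k] by metis
    have "A (k \<oplus> \<one>) (h (k \<oplus> \<one>))" for k using h by blast
    then have "\<exists>x. A k x \<and> ?S k x (h (k \<oplus> \<one>))" for k unfolding Asucc .
    then show "R k (h k) (h (k \<oplus> \<one>))" for k using h[of _ k] by metis
  qed
qed

end

section \<open>Construction of the Euler path\<close>

text \<open>\<open>odd_start\<close> unites the two kinds of pre-Eulerian graph: if
  \<open>v0\<close> has infinite degree, its neighbours have no code, and the condition says that no
  vertex of finite degree is odd. Deletions are restricted to the edges of coded sequences, the only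
  ones the construction makes.\<close>

locale Euler = aca +
  fixes V E v0
  assumes E: "E \<in> Sets M" "symm E" "\<And>x. \<langle>x, x\<rangle> \<notin> E"
    and edge_in: "\<langle>x, y\<rangle> \<in> E \<Longrightarrow> x \<in> V"
    and V: "V \<in> Sets M" "v0 \<in> V"
    and connected: "x \<in> V \<Longrightarrow> conn E v0 x"
    and odd_start: "coded (nb E x) \<Longrightarrow> oddset (nb E x) \<longleftrightarrow> x = v0"
    and infinite_component: "\<exists>z\<in>V. (\<forall>b. \<exists>u. conn (E - edges (entry s) n) z u \<and> \<not> u \<prec> b) \<and>
      (\<forall>w\<in>V. (\<forall>b. \<exists>u. conn (E - edges (entry s) n) w u \<and> \<not> u \<prec> b) \<longrightarrow> conn (E - edges (entry s) n) z w)"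
begin

abbreviation rest where "rest s n \<equiv> E - edges (entry s) n"

definition unbounded where "unbounded K z \<longleftrightarrow> (\<forall>b. \<exists>u. conn K z u \<and> \<not> u \<prec> b)"

lemma rest_Sets: "rest s n \<in> Sets M"
  by (intro Sets_diff E edges_Sets)

lemma rest_symm: "symm (rest s n)"
  by (intro symm_diff E symm_edges)

lemma rest_irrefl: "\<langle>x, x\<rangle> \<notin> rest s n"
  using E by blast

lemma edge_in2: "\<langle>x, y\<rangle> \<in> E \<Longrightarrow> y \<in> V"
  using edge_in symmD[OF E(2)] by blast

lemma conn_in_V: "conn (rest s n) x y \<Longrightarrow> x \<in> V \<Longrightarrow> y \<in> V"
  by (erule conn_induct[of _ _ _ "\<lambda>y. y \<in> V"]) (intro def_intros V, simp, use edge_in2 in blast)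

lemma coded_nb_rest: "coded (nb E x) \<longleftrightarrow> coded (nb (rest s n) x)"
proof
  assume "coded (nb E x)"
  then show "coded (nb (rest s n) x)"
    by (rule coded_subset[OF _ _ nb_Sets[OF rest_Sets]]) (auto simp: nb_def)
next
  assume "coded (nb (rest s n) x)"
  then obtain b where b: "\<And>y. y \<in> nb (rest s n) x \<Longrightarrow> y \<prec> b" unfolding coded_iff by blast
  obtain c where c: "\<And>y. y \<in> edges (entry s) n \<Longrightarrow> y \<prec> c" using edges_bounded by blast
  have "y \<prec> b \<oplus> c" if y: "y \<in> nb E x" for y
  proof (cases "y \<in> nb (rest s n) x")
    case True
    then show ?thesis using b le_add(1)[of b c] ar.order.strict_trans2 by blast
  next
    case False
    then have "\<langle>x, y\<rangle> \<prec> c" using y c unfolding nb_def by blast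
    then show ?thesis using le_pair(2)[of y x] le_add(2)[of c b] by order
  qed
  then show "coded (nb E x)" unfolding coded_iff using nb_Sets[OF E(1)] by blast
qed

lemma odd_rest:
  assumes "trail E (entry s) n" "entry s \<zero> = v0" "coded (nb E x)"
  shows "oddset (nb (rest s n) x) \<longleftrightarrow> x = entry s n"
  using trail_parity[OF E assms(1,3)] odd_start[OF assms(3)] assms(2) by auto

text \<open>If the end has finite degree, parity leaves an odd number of edges there; if it has
  infinite degree, a trail cannot exhaust them. So a trail from \<open>v0\<close> never gets
  stuck.\<close>

lemma end_not_isolated:
  assumes "trail E (entry s) n" "entry s \<zero> = v0"
  shows "\<exists>y. \<langle>entry s n, y\<rangle> \<in> rest s n"
proof (cases "coded (nb E (entry s n))")
  case True
  then have "oddset (nb (rest s n) (entry s n))" using odd_rest[OF assms] by blast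
  then show ?thesis using oddset_ne unfolding nb_def by blast
next
  case False
  moreover have "coded {}"
    using comprehension[OF definable_const[of False]] unfolding coded_iff by simp
  ultimately have "nb (rest s n) (entry s n) \<noteq> {}" using coded_nb_rest by metis
  then show ?thesis unfolding nb_def by blast
qed

text \<open>Isolated vertices are ignored: only the edges left over have to be connected.\<close>

definition good where
  "good s n \<longleftrightarrow> trail E (entry s) n \<and> entry s \<zero> = v0 \<and>
     (\<forall>x x' y y'. \<langle>x, x'\<rangle> \<in> rest s n \<longrightarrow> \<langle>y, y'\<rangle> \<in> rest s n \<longrightarrow> conn (rest s n) x y)"

text \<open>Taking \<open>x\<close> to be the end of \<open>s\<close> contradicts the last conclusion, so that end never lies in a finite
  component; every other maximal trail in a finite component is therefore closed.\<close>

lemma maximal_trail_in_component: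
  assumes s: "trail E (entry s) n" "entry s \<zero> = v0" and d: "\<And>u. conn (rest s n) x u \<Longrightarrow> u \<prec> d"
  obtains t m where "trail (rest s n) (entry t) m" "entry t \<zero> = x"
    "\<And>y. \<langle>entry t m, y\<rangle> \<notin> rest s n - edges (entry t) m" "(entry t m = entry s n) \<noteq> (entry t m = x)"
proof -
  let ?R = "rest s n"
  let ?P = "\<lambda>t m. trail ?R (entry t) m \<and> entry t \<zero> = x"
  have dP: "definable (\<lambda>e. ?P (e 0) (e 1))" by (intro def_intros definable_trail rest_Sets)
  have bd: "z \<prec> \<langle>d, d\<rangle> \<oplus> \<one>" if P: "?P t m" and z: "z \<in> edges (entry t) m" for t m z
  proof -
    have c: "entry t i \<preceq> d" if "i \<preceq> m" for i
      using walk_conn[OF trail_walk that] P d by (metis ar.less_imp_le)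
    obtain i where i: "i \<prec> m" "z = \<langle>entry t i, entry t (i \<oplus> \<one>)\<rangle> \<or> z = \<langle>entry t (i \<oplus> \<one>), entry t i\<rangle>"
      using z unfolding edges_def by blast
    have "entry t i \<preceq> d" "entry t (i \<oplus> \<one>) \<preceq> d" using c i(1) by (auto simp: ar.less_imp_le)
    then show ?thesis unfolding lt_succ using i(2) pair_mono by blast
  qed
  obtain t0 where "entry t0 \<zero> = x" using seq_code[of "\<lambda>_. x" \<zero>] fdef_const by auto
  then have P0: "?P t0 \<zero>" by simp
  have b: "\<forall>t m z. ?P t m \<longrightarrow> z \<in> edges (entry t) m \<longrightarrow> z \<prec> \<langle>d, d\<rangle> \<oplus> \<one>"
    using bd by (intro allI impI)
  from maximal_trail[of ?P "\<langle>d, d\<rangle> \<oplus> \<one>", OF dP b P0] obtain t m where Pt: "?P t m"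
    and max: "\<forall>u l. ?P u l \<longrightarrow> edges (entry t) m \<subseteq> edges (entry u) l \<longrightarrow> edges (entry u) l \<subseteq> edges (entry t) m"
    by - (erule exE, erule exE, erule conjE, rule that)
  from Pt have t: "trail ?R (entry t) m" "entry t \<zero> = x" by auto
  note max = max[rule_format, OF conjI]
  have stuck: "\<langle>entry t m, y\<rangle> \<notin> ?R - edges (entry t) m" for y
  proof
    assume y: "\<langle>entry t m, y\<rangle> \<in> ?R - edges (entry t) m"
    obtain u where u: "\<And>i. i \<preceq> m \<Longrightarrow> entry u i = entry t i" "entry u (m \<oplus> \<one>) = y" "trail ?R (entry u) (m \<oplus> \<one>)"
      "edges (entry u) (m \<oplus> \<one>) = edges (entry t) m \<union> {\<langle>entry t m, y\<rangle>, \<langle>y, entry t m\<rangle>}"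
      using trail_append[OF t(1) y] by blast
    then have "edges (entry u) (m \<oplus> \<one>) \<subseteq> edges (entry t) m" using max[of u "m \<oplus> \<one>"] t(2) u(1)[of \<zero>] by auto
    then show False using u(4) y by blast
  qed
  have "conn ?R x (entry t m)" using walk_conn[OF trail_walk[OF t(1)], of m] t(2) by simp
  then have "y \<prec> d" if "y \<in> nb ?R (entry t m)" for y
    using that joined_trans[OF _ conn_edge] d unfolding nb_def by blast
  then have fin: "coded (nb ?R (entry t m))"
    unfolding coded_iff using nb_Sets[OF rest_Sets] by blast
  have "nb (?R - edges (entry t) m) (entry t m) = {}" using stuck unfolding nb_def by blast
  then have "(entry t m = entry s n) \<noteq> (entry t m = x)"
    using trail_parity[OF rest_Sets rest_symm rest_irrefl t(1) fin] oddset_empty t(2)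
      odd_rest[OF s] fin coded_nb_rest by auto
  then show ?thesis using that t stuck by blast
qed

lemma splice:
  assumes s: "trail E (entry s) n" and i: "i \<preceq> n" and t: "trail (rest s n) (entry t) m"
    "entry t \<zero> = entry s i" "entry t m = entry s i"
  obtains u l where "trail E (entry u) l" "i \<preceq> l" "\<And>j. j \<preceq> i \<Longrightarrow> entry u j = entry s j" "entry u l = entry s n"
    "edges (entry u) l = edges (entry s) n \<union> edges (entry t) m"
proof -
  obtain r where r: "n = i \<oplus> r" using i le_iff_add by blast
  have "fdef (\<lambda>e. entry s (i \<oplus> e 0))" by (intro def_intros)
  from seq_code[of "\<lambda>j. entry s (i \<oplus> j)", OF this, of r]
  obtain g where g: "\<And>j. j \<preceq> r \<Longrightarrow> entry s (i \<oplus> j) = entry g j" by metis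
  have sp: "trail E (entry s) i" "trail (E - edges (entry s) i) (entry g) r"
    and es: "edges (entry s) n = edges (entry s) i \<union> edges (entry g) r"
    using trail_add[of i "entry s" "entry s" r "entry g" E] edges_add[of i "entry s" "entry s" r "entry g"] g s r by auto
  obtain h where h: "\<And>j. j \<preceq> i \<Longrightarrow> entry h j = entry s j" "\<And>j. j \<preceq> m \<Longrightarrow> entry h (i \<oplus> j) = entry t j"
    using concat_code[of s i t m] t(2) by metis
  have eh: "edges (entry h) (i \<oplus> m) = edges (entry s) i \<union> edges (entry t) m" by (rule edges_add[of i "entry h" "entry s" m "entry t", OF h])
  have "rest s n \<subseteq> E - edges (entry s) i" using edges_mono[OF i] by blast
  then have th: "trail E (entry h) (i \<oplus> m)"
    using trail_add[of i "entry h" "entry s" m "entry t" E, OF h] sp(1) trail_subset[OF t(1)] by blast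
  have hm: "entry h (i \<oplus> m) = entry g \<zero>" using h(2)[of m] t(3) g[of \<zero>] by simp
  obtain u where u: "\<And>j. j \<preceq> i \<oplus> m \<Longrightarrow> entry u j = entry h j" "\<And>j. j \<preceq> r \<Longrightarrow> entry u (i \<oplus> m \<oplus> j) = entry g j"
    using concat_code[OF hm, of r] by metis
  have eu: "edges (entry u) (i \<oplus> m \<oplus> r) = edges (entry h) (i \<oplus> m) \<union> edges (entry g) r" by (rule edges_add[of "i \<oplus> m" "entry u" "entry h" r "entry g", OF u])
  have "edges (entry t) m \<subseteq> rest s n" by (rule edges_subset[OF trail_walk[OF t(1)] rest_symm])
  then have "edges (entry g) r \<inter> edges (entry t) m = {}" using es by blast
  then have "trail (E - edges (entry s) i - edges (entry t) m) (entry g) r" by (rule trail_diff[OF sp(2)])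
  moreover have "E - edges (entry s) i - edges (entry t) m = E - edges (entry h) (i \<oplus> m)" unfolding eh by blast
  ultimately have "trail E (entry u) (i \<oplus> m \<oplus> r)" using trail_add[of "i \<oplus> m" "entry u" "entry h" r "entry g" E, OF u] th by simp
  moreover have "i \<preceq> i \<oplus> m \<oplus> r" by (simp add: add_assoc)
  moreover have "entry u j = entry s j" if "j \<preceq> i" for j
  proof -
    have "j \<preceq> i \<oplus> m" using that le_add(1)[of i m] by order
    then show ?thesis using u(1) h(1)[OF that] by simp
  qed
  moreover have "entry u (i \<oplus> m \<oplus> r) = entry s n" using u(2)[of r] g[of r] r by simp
  moreover have "edges (entry u) (i \<oplus> m \<oplus> r) = edges (entry s) n \<union> edges (entry t) m" unfolding eu eh es by blast
  ultimately show ?thesis using that by blast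
qed

lemma extend_good:
  assumes s: "good s n" and ab: "\<langle>a, b\<rangle> \<in> rest s n"
  obtains t m where "good t m" "n \<prec> m" "\<And>i. i \<preceq> n \<Longrightarrow> entry t i = entry s i" "\<langle>a, b\<rangle> \<in> edges (entry t) m"
proof -
  let ?R = "rest s n"
  have st: "trail E (entry s) n" "entry s \<zero> = v0" using s unfolding good_def by auto
  have good_conn: "conn ?R x y" if "\<langle>x, x'\<rangle> \<in> ?R" "\<langle>y, y'\<rangle> \<in> ?R" for x x' y y'
    using s that unfolding good_def by blast
  obtain y where "\<langle>entry s n, y\<rangle> \<in> ?R" using end_not_isolated[OF st] by blast
  then have "conn ?R (entry s n) a" using good_conn ab by blast
  then obtain g0 k0 where g0: "trail ?R (entry g0) k0" "entry g0 \<zero> = entry s n" "entry g0 k0 = a"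
    by (rule conn_trail[OF rest_Sets])
  have "\<exists>g k. trail ?R (entry g) k \<and> entry g \<zero> = entry s n \<and> \<langle>a, b\<rangle> \<in> edges (entry g) k"
  proof (cases "\<langle>a, b\<rangle> \<in> edges (entry g0) k0")
    case False
    then have "\<langle>entry g0 k0, b\<rangle> \<in> ?R - edges (entry g0) k0" using ab g0(3) by simp
    then obtain u where u: "\<And>i. i \<preceq> k0 \<Longrightarrow> entry u i = entry g0 i" "trail ?R (entry u) (k0 \<oplus> \<one>)"
      "edges (entry u) (k0 \<oplus> \<one>) = edges (entry g0) k0 \<union> {\<langle>entry g0 k0, b\<rangle>, \<langle>b, entry g0 k0\<rangle>}"
      by (rule trail_append[OF g0(1)]) blast
    then show ?thesis using g0 u(1)[of \<zero>] by (intro exI[of _ u] exI[of _ "k0 \<oplus> \<one>"]) simp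
  qed (use g0 in blast)
  then obtain g k where g: "trail ?R (entry g) k" "entry g \<zero> = entry s n" "\<langle>a, b\<rangle> \<in> edges (entry g) k" by blast
  obtain s1 where s1: "\<And>i. i \<preceq> n \<Longrightarrow> entry s1 i = entry s i" "\<And>j. j \<preceq> k \<Longrightarrow> entry s1 (n \<oplus> j) = entry g j"
    using concat_code[of s n g k] g(2) by metis
  define n1 where "n1 = n \<oplus> k"
  have t1: "trail E (entry s1) n1" unfolding n1_def using trail_add[of n "entry s1" "entry s" k "entry g" E, OF s1] st(1) g(1) by blast
  have e1: "edges (entry s1) n1 = edges (entry s) n \<union> edges (entry g) k" unfolding n1_def by (rule edges_add[of n "entry s1" "entry s" k "entry g", OF s1])
  have s10: "entry s1 \<zero> = v0" using s1(1)[of \<zero>] st(2) by simp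
  let ?R1 = "rest s1 n1"
  obtain z where z: "z \<in> V" "unbounded ?R1 z" and zu: "\<And>w. w \<in> V \<Longrightarrow> unbounded ?R1 w \<Longrightarrow> conn ?R1 z w"
    using infinite_component[of s1 n1] unfolding unbounded_def by blast
  \<comment> \<open>Along a walk in \<open>E\<close> from \<open>v0\<close>, every edge of the trail
    that is crossed ends at a vertex of the trail. Hence the trail meets every component left over,
    and its vertices give a bounded list of representatives.\<close>
  have touch: "\<exists>i. i \<preceq> n1 \<and> conn ?R1 (entry s1 i) x" if "x \<in> V" for x
  proof (rule conn_induct[OF connected[OF that], of "\<lambda>x. \<exists>i. i \<preceq> n1 \<and> conn ?R1 (entry s1 i) x"])
    show "definable (\<lambda>e. \<exists>i. i \<preceq> n1 \<and> conn ?R1 (entry s1 i) (e 0))" by (intro def_intros definable_conn rest_Sets)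
    show "\<exists>i. i \<preceq> n1 \<and> conn ?R1 (entry s1 i) v0" using s10 conn_refl zero_le by metis
    fix x y assume x: "\<exists>i. i \<preceq> n1 \<and> conn ?R1 (entry s1 i) x" and xy: "\<langle>x, y\<rangle> \<in> E"
    show "\<exists>i. i \<preceq> n1 \<and> conn ?R1 (entry s1 i) y"
    proof (cases "\<langle>x, y\<rangle> \<in> edges (entry s1) n1")
      case True
      then show ?thesis using edges_index(2)[of x y "entry s1" n1 \<zero>] conn_refl by auto
    next
      case False
      then have "conn ?R1 x y" using xy by (intro conn_edge) blast
      then show ?thesis using x joined_trans by blast
    qed
  qed
  have "\<exists>\<beta>. \<forall>x y. \<langle>x, y\<rangle> \<in> E \<longrightarrow> \<langle>x, y\<rangle> \<in> edges (entry s1) n1 \<or> \<not> conn ?R1 z x \<longrightarrow> \<langle>x, y\<rangle> \<prec> \<beta>"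
  proof -
    \<comment> \<open>\<open>d\<close> bounds the component of the \<open>i\<close>-th vertex of the
      trail. Strong bounding turns this into one \<open>B\<close> for all \<open>i\<close> whose
      component is bounded.\<close>
    let ?Q = "\<lambda>d i. \<forall>u. conn ?R1 (entry s1 i) u \<longrightarrow> u \<prec> d"
    have "definable (\<lambda>e. ?Q (e 0) (e 1))" by (intro def_intros definable_conn rest_Sets)
    from strong_bounding[of ?Q, OF this, of "n1 \<oplus> \<one>"]
    obtain B where B: "\<And>i. i \<preceq> n1 \<Longrightarrow> \<exists>d. ?Q d i \<Longrightarrow> \<exists>d. d \<prec> B \<and> ?Q d i" unfolding lt_succ by blast
    obtain c where c: "\<And>x. x \<in> edges (entry s1) n1 \<Longrightarrow> x \<prec> c" using edges_bounded by blast
    have "\<langle>x, y\<rangle> \<prec> c \<oplus> (\<langle>B, B\<rangle> \<oplus> \<one>)"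
      if xy: "\<langle>x, y\<rangle> \<in> E" "\<langle>x, y\<rangle> \<in> edges (entry s1) n1 \<or> \<not> conn ?R1 z x" for x y
    proof (cases "\<langle>x, y\<rangle> \<in> edges (entry s1) n1")
      case True
      then show ?thesis using c[OF True] le_add(1)[of c "\<langle>B, B\<rangle> \<oplus> \<one>"] by order
    next
      case False
      then have nz: "\<not> conn ?R1 z x" and xyR: "\<langle>x, y\<rangle> \<in> ?R1" using xy by auto
      obtain i where i: "i \<preceq> n1" "conn ?R1 (entry s1 i) x" using touch edge_in xy(1) by blast
      have "x \<in> V" using edge_in xy(1) by blast
      then have "entry s1 i \<in> V" using conn_in_V conn_sym[OF rest_symm i(2)] by blast
      moreover have "\<not> conn ?R1 z (entry s1 i)" using nz joined_trans[OF _ i(2)] by blast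
      ultimately have "\<not> unbounded ?R1 (entry s1 i)" using zu by blast
      then have "\<exists>d. ?Q d i" unfolding unbounded_def by blast
      then obtain d where d: "d \<prec> B" "?Q d i" using B i(1) by blast
      have "conn ?R1 (entry s1 i) y" using i(2) conn_edge[OF xyR] by (rule joined_trans)
      then have "x \<preceq> B" "y \<preceq> B" using d i(2) by (meson ar.less_imp_le ar.order.strict_trans)+
      then have "\<langle>x, y\<rangle> \<preceq> \<langle>B, B\<rangle>" by (rule pair_mono)
      moreover have "\<langle>B, B\<rangle> \<prec> c \<oplus> (\<langle>B, B\<rangle> \<oplus> \<one>)" by (simp flip: add_assoc)
      ultimately show ?thesis by order
    qed
    then show ?thesis by blast
  qed
  then obtain \<beta> where \<beta>: "\<And>x y. \<langle>x, y\<rangle> \<in> E \<Longrightarrow>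
      \<langle>x, y\<rangle> \<in> edges (entry s1) n1 \<or> \<not> conn ?R1 z x \<Longrightarrow> \<langle>x, y\<rangle> \<prec> \<beta>" by blast
  let ?P = "\<lambda>t m. trail E (entry t) m \<and> n \<preceq> m \<and> (\<forall>i. i \<preceq> n \<longrightarrow> entry t i = entry s i) \<and> entry t m = entry s1 n1 \<and>
    (\<forall>x. x \<in> edges (entry s1) n1 \<longrightarrow> x \<in> edges (entry t) m) \<and>
    (\<forall>x y. \<langle>x, y\<rangle> \<in> edges (entry t) m \<longrightarrow> \<langle>x, y\<rangle> \<in> edges (entry s1) n1 \<or> \<not> conn ?R1 z x)"
  have dP: "definable (\<lambda>e. ?P (e 0) (e 1))"
    by (intro def_intros definable_trail definable_edges definable_conn rest_Sets E)
  have bP: "x \<prec> \<beta>" if P: "?P t m" and x: "x \<in> edges (entry t) m" for t m x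
  proof -
    obtain p q where pq: "x = \<langle>p, q\<rangle>" using x unfolding edges_def by blast
    have "x \<in> E" using edges_subset[OF trail_walk E(2)] P x by blast
    then show ?thesis using \<beta> P x unfolding pq by blast
  qed
  have P1: "?P s1 n1" using t1 s1(1) by (auto simp: n1_def)
  have b: "\<forall>t m x. ?P t m \<longrightarrow> x \<in> edges (entry t) m \<longrightarrow> x \<prec> \<beta>"
    using bP by (intro allI impI)
  from maximal_trail[of ?P \<beta>, OF dP b P1] obtain s2 n2 where P2: "?P s2 n2" and max: "\<forall>t m. ?P t m \<longrightarrow>
      edges (entry s2) n2 \<subseteq> edges (entry t) m \<longrightarrow> edges (entry t) m \<subseteq> edges (entry s2) n2"
    by - (erule exE, erule exE, erule conjE, rule that)
  let ?R2 = "rest s2 n2"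
  have t2: "trail E (entry s2) n2" and n2: "n \<preceq> n2" and s2: "\<And>i. i \<preceq> n \<Longrightarrow> entry s2 i = entry s i"
    and end2: "entry s2 n2 = entry s1 n1" and sub12: "edges (entry s1) n1 \<subseteq> edges (entry s2) n2"
    and new2: "\<And>x y. \<langle>x, y\<rangle> \<in> edges (entry s2) n2 \<Longrightarrow> \<langle>x, y\<rangle> \<in> edges (entry s1) n1 \<or> \<not> conn ?R1 z x"
    using P2 by (simp_all add: subset_iff)
  have s20: "entry s2 \<zero> = v0" using s2[of \<zero>] st(2) by simp
  have es: "edges (entry s2) n = edges (entry s) n" by (rule edges_cong) (rule s2)
  have RR: "?R2 \<subseteq> ?R" using edges_mono[OF n2, of "entry s2"] es by blast
  \<comment> \<open>The edges added after \<open>s1\<close> avoid the component of \<open>z\<close>,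
    so everything reachable from \<open>z\<close> remains reachable and this component stays
    unbounded.\<close>
  have keep: "conn ?R2 z u" if "conn ?R1 z u" for u
  proof -
    have "conn ?R1 z u \<and> conn ?R2 z u"
    proof (rule conn_induct[OF that, of "\<lambda>u. conn ?R1 z u \<and> conn ?R2 z u"])
      show "definable (\<lambda>e. conn ?R1 z (e 0) \<and> conn ?R2 z (e 0))" by (intro def_intros definable_conn rest_Sets)
      fix x y assume x: "conn ?R1 z x \<and> conn ?R2 z x" and xy: "\<langle>x, y\<rangle> \<in> ?R1"
      then have "\<langle>x, y\<rangle> \<in> ?R2" using new2 by blast
      then show "conn ?R1 z y \<and> conn ?R2 z y" using x xy joined_trans[OF _ conn_edge] by blast
    qed (simp add: conn_refl)
    then show ?thesis ..
  qed
  then have "unbounded ?R2 z" using z(2) unfolding unbounded_def by blast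
  then have zu2: "conn ?R2 z w" if "w \<in> V" "unbounded ?R2 w" for w
  proof -
    obtain z' where "\<And>w. w \<in> V \<Longrightarrow> unbounded ?R2 w \<Longrightarrow> conn ?R2 z' w"
      using infinite_component[of s2 n2] unfolding unbounded_def by blast
    then have "conn ?R2 z' w" "conn ?R2 z' z" using that z(1) \<open>unbounded ?R2 z\<close> by blast+
    then show ?thesis using joined_trans[OF conn_sym[OF rest_symm]] by blast
  qed
  have main: "conn ?R2 z x0" if x0: "\<langle>x0, y0\<rangle> \<in> ?R2" for x0 y0
  proof (rule ccontr)
    assume nz: "\<not> conn ?R2 z x0"
    have "x0 \<in> V" using x0 edge_in by blast
    then have "\<not> unbounded ?R2 x0" using zu2 nz by blast
    then obtain d where d: "\<And>u. conn ?R2 x0 u \<Longrightarrow> u \<prec> d" unfolding unbounded_def by blast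
    have mt: "\<exists>t m. trail ?R2 (entry t) m \<and> entry t \<zero> = x \<and> (\<forall>y. \<langle>entry t m, y\<rangle> \<notin> ?R2 - edges (entry t) m) \<and>
        (entry t m = entry s2 n2) \<noteq> (entry t m = x)" if x: "conn ?R2 x0 x" for x
    proof -
      have dx: "u \<prec> d" if "conn ?R2 x u" for u using d joined_trans[OF x that] .
      obtain t m where "trail ?R2 (entry t) m" "entry t \<zero> = x" "\<And>y. \<langle>entry t m, y\<rangle> \<notin> ?R2 - edges (entry t) m"
        "(entry t m = entry s2 n2) \<noteq> (entry t m = x)"
        by (rule maximal_trail_in_component[where x = x, OF t2 s20]) (erule dx, (rule that; assumption))
      then show ?thesis by (intro exI[of _ t] exI[of _ m]) simp
    qed
    have w0: "\<not> conn ?R2 x0 (entry s2 n2)" using mt by blast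
    \<comment> \<open>Goodness of \<open>s\<close> enters here. A walk from \<open>a\<close> to
      \<open>x0\<close> avoids the edges of \<open>s\<close>, so any edge of \<open>s2\<close> on it
      was traversed at step \<open>n\<close> or later. The bounded component therefore meets
      \<open>s2\<close> at some time from \<open>n\<close> on, and splicing there preserves the
      initial part \<open>s\<close>.\<close>
    have "conn ?R a x0" using good_conn[OF ab] x0 RR by blast
    then have "\<exists>i. n \<preceq> i \<and> i \<preceq> n2 \<and> conn ?R2 (entry s2 i) x0"
    proof (rule conn_induct[of _ _ _ "\<lambda>x. \<exists>i. n \<preceq> i \<and> i \<preceq> n2 \<and> conn ?R2 (entry s2 i) x"])
      show "definable (\<lambda>e. \<exists>i. n \<preceq> i \<and> i \<preceq> n2 \<and> conn ?R2 (entry s2 i) (e 0))"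
        by (intro def_intros definable_conn rest_Sets)
      have "\<langle>a, b\<rangle> \<in> edges (entry s2) n2" using g(3) e1 sub12 by blast
      moreover have "\<langle>a, b\<rangle> \<notin> edges (entry s2) n" unfolding es using ab by blast
      ultimately show "\<exists>i. n \<preceq> i \<and> i \<preceq> n2 \<and> conn ?R2 (entry s2 i) a"
        using edges_index(1)[of a b "entry s2" n2 n] conn_refl by auto
      fix x y assume x: "\<exists>i. n \<preceq> i \<and> i \<preceq> n2 \<and> conn ?R2 (entry s2 i) x" and xy: "\<langle>x, y\<rangle> \<in> ?R"
      show "\<exists>i. n \<preceq> i \<and> i \<preceq> n2 \<and> conn ?R2 (entry s2 i) y"
      proof (cases "\<langle>x, y\<rangle> \<in> edges (entry s2) n2")
        case True
        moreover have "\<langle>x, y\<rangle> \<notin> edges (entry s2) n" unfolding es using xy by blast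
        ultimately show ?thesis using edges_index(2)[of x y "entry s2" n2 n] conn_refl by auto
      next
        case False
        then have "conn ?R2 x y" using xy by (intro conn_edge) blast
        then show ?thesis using x joined_trans by blast
      qed
    qed
    then obtain i where i: "n \<preceq> i" "i \<preceq> n2" "conn ?R2 (entry s2 i) x0" by blast
    have x1: "conn ?R2 x0 (entry s2 i)" by (rule conn_sym[OF rest_symm i(3)])
    obtain t m where t: "trail ?R2 (entry t) m" "entry t \<zero> = entry s2 i"
      "\<And>y. \<langle>entry t m, y\<rangle> \<notin> ?R2 - edges (entry t) m" "(entry t m = entry s2 n2) \<noteq> (entry t m = entry s2 i)"
      using mt[OF x1] by blast
    have ct: "conn ?R2 x0 (entry t j)" if "j \<preceq> m" for j
      using joined_trans[OF x1] walk_conn[OF trail_walk[OF t(1)] that] t(2) by simp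
    then have "entry t m \<noteq> entry s2 n2" using w0 by (metis ar.order.refl)
    then have tm: "entry t m = entry s2 i" using t(4) by blast
    obtain y1 where y1: "\<langle>entry s2 i, y1\<rangle> \<in> ?R2" using conn_out[OF i(3)] x0 by blast
    have "m \<noteq> \<zero>" using t(2,3) y1 by auto
    obtain u l where u: "trail E (entry u) l" "i \<preceq> l" "\<And>j. j \<preceq> i \<Longrightarrow> entry u j = entry s2 j" "entry u l = entry s2 n2"
      "edges (entry u) l = edges (entry s2) n2 \<union> edges (entry t) m"
      using splice[OF t2 i(2) t(1,2) tm] by blast
    \<comment> \<open>An edge of \<open>t\<close> beginning in the component of \<open>z\<close>
      would join \<open>z\<close> to \<open>x0\<close>. So the spliced trail is again admissible and
      contradicts maximality.\<close>
    have "\<not> conn ?R1 z x" if xy: "\<langle>x, y\<rangle> \<in> edges (entry t) m" for x y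
    proof
      assume "conn ?R1 z x"
      then have zx: "conn ?R2 z x" by (rule keep)
      obtain j where "j \<preceq> m" "entry t j = x" using edges_index(1)[of x y "entry t" m \<zero>] xy by auto
      then have "conn ?R2 x x0" using ct conn_sym[OF rest_symm] by blast
      then show False using joined_trans[OF zx] nz by blast
    qed
    moreover have "n \<preceq> l" using i(1) u(2) by order
    moreover have "entry u j = entry s j" if "j \<preceq> n" for j
    proof -
      have "j \<preceq> i" using that i(1) by order
      then show ?thesis using u(3) s2[OF that] by simp
    qed
    ultimately have "?P u l" using u(1,4,5) end2 sub12 new2 by auto
    from max[THEN spec, THEN spec, THEN mp, OF this]
    have "edges (entry t) m \<subseteq> edges (entry s2) n2" using u(5) by blast
    moreover have "\<langle>entry t \<zero>, entry t (\<zero> \<oplus> \<one>)\<rangle> \<in> ?R2" using t(1) \<open>m \<noteq> \<zero>\<close> gt_zero_iff unfolding trail_def by blast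
    moreover have "\<langle>entry t \<zero>, entry t (\<zero> \<oplus> \<one>)\<rangle> \<in> edges (entry t) m"
      using \<open>m \<noteq> \<zero>\<close> gt_zero_iff unfolding edges_def by blast
    ultimately show False by blast
  qed
  have "good s2 n2" unfolding good_def
  proof (intro conjI t2 s20 allI impI)
    fix x x' y y' assume "\<langle>x, x'\<rangle> \<in> ?R2" "\<langle>y, y'\<rangle> \<in> ?R2"
    then have "conn ?R2 z x" "conn ?R2 z y" using main by blast+
    then show "conn ?R2 x y" using joined_trans[OF conn_sym[OF rest_symm]] by blast
  qed
  moreover have ab2: "\<langle>a, b\<rangle> \<in> edges (entry s2) n2" using g(3) e1 sub12 by blast
  moreover have "n \<noteq> n2" using ab2 ab es by blast
  then have "n \<prec> n2" using n2 unfolding le_def by blast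
  ultimately show ?thesis using that s2 by blast
qed

section \<open>Iteration along the enumeration of edges\<close>

lemma definable_conn_rest:
  "fdef t \<Longrightarrow> fdef u \<Longrightarrow> fdef v \<Longrightarrow> fdef w \<Longrightarrow> definable (\<lambda>e. conn (rest (t e) (u e)) (v e) (w e))"
  by (rule definable_comp4[of "\<lambda>s n x y. conn (rest s n) x y"])
    (unfold conn_iff walk_def Diff_iff, intro def_intros definable_edges E)

lemma definable_good: "fdef t \<Longrightarrow> fdef u \<Longrightarrow> definable (\<lambda>e. good (t e) (u e))"
  by (rule definable_comp2[of good], unfold good_def Diff_iff)
    (intro def_intros definable_edges definable_trail definable_conn_rest E)

lemma good_start: "\<exists>s. good s \<zero>"
proof -
  obtain s where s: "entry s \<zero> = v0" using seq_code[of "\<lambda>_. v0" \<zero>] fdef_const by auto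
  have "conn E x y" if "\<langle>x, x'\<rangle> \<in> E" "\<langle>y, y'\<rangle> \<in> E" for x x' y y'
    using joined_trans[OF conn_sym[OF E(2) connected] connected] edge_in that by blast
  then show ?thesis unfolding good_def using s by auto
qed

lemma good_step:
  assumes "good s n"
  shows "\<exists>t m. good t m \<and> n \<prec> m \<and> (\<forall>i. i \<preceq> n \<longrightarrow> entry t i = entry s i) \<and> (k \<in> E \<longrightarrow> k \<in> edges (entry t) m)"
proof (cases "k \<in> rest s n")
  case True
  then obtain a b where ab: "k = \<langle>a, b\<rangle>" using E(2) unfolding symm_def by blast
  then show ?thesis using True extend_good[OF assms, of a b] by metis
next
  case False
  have "trail E (entry s) n" "entry s \<zero> = v0" using assms unfolding good_def by auto
  from end_not_isolated[OF this] obtain y where y: "\<langle>entry s n, y\<rangle> \<in> rest s n" by blast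
  obtain t m where t: "good t m" "n \<prec> m" "\<And>i. i \<preceq> n \<Longrightarrow> entry t i = entry s i"
    using extend_good[OF assms y] by metis
  have "edges (entry s) n = edges (entry t) n" by (rule edges_cong) (simp add: t(3))
  then have "edges (entry s) n \<subseteq> edges (entry t) m" using edges_mono[of n m "entry t"] t(2) ar.less_imp_le by blast
  then show ?thesis using t False by blast
qed

theorem Euler_path_exists: "\<exists>P\<in>Sets M. Euler_path M V E P"
proof -
  let ?I = "\<lambda>x. \<exists>s n. x = \<langle>s, n\<rangle> \<and> good s n"
  let ?R = "\<lambda>k x y. \<exists>s n t m. x = \<langle>s, n\<rangle> \<and> y = \<langle>t, m\<rangle> \<and> n \<prec> m \<and>
    (\<forall>i. i \<preceq> n \<longrightarrow> entry t i = entry s i) \<and> (k \<in> E \<longrightarrow> k \<in> edges (entry t) m)"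
  obtain s0 where s0: "good s0 \<zero>" using good_start ..
  have "definable (\<lambda>e. ?R (e 0) (e 1) (e 2))" by (intro def_intros definable_edges E)
  moreover have "?I \<langle>s0, \<zero>\<rangle>" using s0 by blast
  moreover have "\<exists>y. ?I y \<and> ?R k x y" if "?I x" for k x
  proof -
    obtain s n where x: "x = \<langle>s, n\<rangle>" "good s n" using \<open>?I x\<close> by blast
    obtain t m where "good t m" "n \<prec> m \<and> (\<forall>i. i \<preceq> n \<longrightarrow> entry t i = entry s i) \<and> (k \<in> E \<longrightarrow> k \<in> edges (entry t) m)"
      using good_step[OF x(2), of k] by blast
    then show ?thesis using x(1) by blast
  qed
  moreover have "definable (\<lambda>e. ?I (e 0))" by (intro def_intros definable_good)
  ultimately obtain h where h: "fdef (\<lambda>e. h (e 0))" and hI: "\<And>k. ?I (h k)" and hR: "\<And>k. ?R k (h k) (h (k \<oplus> \<one>))"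
    by (rule dependent_choice[of ?R ?I]) (assumption, (rule that; assumption))
  define S where "S k = (THE s. \<exists>n. h k = \<langle>s, n\<rangle>)" for k
  define N where "N k = (THE n. \<exists>s. h k = \<langle>s, n\<rangle>)" for k
  have hSN: "h k = \<langle>S k, N k\<rangle>" for k
  proof -
    obtain s n where "h k = \<langle>s, n\<rangle>" using hI by blast
    then show ?thesis unfolding S_def N_def by simp
  qed
  have S_iff: "s = S k \<longleftrightarrow> (\<exists>n. h k = \<langle>s, n\<rangle>)" and N_iff: "n = N k \<longleftrightarrow> (\<exists>s. h k = \<langle>s, n\<rangle>)" for s n k
    unfolding hSN by auto
  have fS: "fdef (\<lambda>e. S (e 0))" unfolding fdef_def S_iff by (intro def_intros fdef_comp1[OF h])
  have fN: "fdef (\<lambda>e. N (e 0))" unfolding fdef_def N_iff by (intro def_intros fdef_comp1[OF h])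
  have good: "good (S k) (N k)" for k using hI[of k] unfolding hSN by auto
  have step: "N k \<prec> N (k \<oplus> \<one>)" "\<And>i. i \<preceq> N k \<Longrightarrow> entry (S (k \<oplus> \<one>)) i = entry (S k) i"
    "k \<in> E \<Longrightarrow> k \<in> edges (entry (S (k \<oplus> \<one>))) (N (k \<oplus> \<one>))" for k
    using hR[of k] unfolding hSN pair_eq by auto
  \<comment> \<open>Position \<open>i\<close> is already settled at stage \<open>i\<close>, which
    justifies reading the limit along the diagonal.\<close>
  have N_ge: "k \<preceq> N k" for k
  proof (rule definable_induct[of "\<lambda>k. k \<preceq> N k"])
    show "n \<oplus> \<one> \<preceq> N (n \<oplus> \<one>)" if "n \<preceq> N n" for n
      using step(1)[of n] that unfolding succ_le by order
  qed (intro def_intros fdef_comp1[OF fN], simp)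
  have mono: "N k \<preceq> N (k \<oplus> j) \<and> (\<forall>i. i \<preceq> N k \<longrightarrow> entry (S (k \<oplus> j)) i = entry (S k) i)" for k j
  proof (rule definable_induct[of "\<lambda>j. N k \<preceq> N (k \<oplus> j) \<and> (\<forall>i. i \<preceq> N k \<longrightarrow> entry (S (k \<oplus> j)) i = entry (S k) i)"])
    fix j assume IH: "N k \<preceq> N (k \<oplus> j) \<and> (\<forall>i. i \<preceq> N k \<longrightarrow> entry (S (k \<oplus> j)) i = entry (S k) i)"
    have "N k \<preceq> N (k \<oplus> j \<oplus> \<one>)" using IH[THEN conjunct1] step(1)[of "k \<oplus> j"] by order
    moreover have "entry (S (k \<oplus> j \<oplus> \<one>)) i = entry (S k) i" if "i \<preceq> N k" for i
    proof -
      have "i \<preceq> N (k \<oplus> j)" using that IH[THEN conjunct1] by order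
      then show ?thesis using step(2) IH that by simp
    qed
    ultimately show "N k \<preceq> N (k \<oplus> (j \<oplus> \<one>)) \<and> (\<forall>i. i \<preceq> N k \<longrightarrow> entry (S (k \<oplus> (j \<oplus> \<one>))) i = entry (S k) i)"
      by (simp add: add_assoc)
  qed (intro def_intros fdef_comp1[OF fS] fdef_comp1[OF fN], simp)
  define p where "p i = entry (S i) i" for i
  have p: "entry (S k) i = p i" if "i \<preceq> N k" for i k
  proof (cases "i \<preceq> k")
    case True
    then obtain j where "k = i \<oplus> j" unfolding le_iff_add ..
    then show ?thesis using mono[of i j] N_ge[of i] unfolding p_def by blast
  next
    case False
    then obtain j where "i = k \<oplus> j" using le_iff_add ar.linear by blast
    then show ?thesis using mono[of k j] that unfolding p_def by simp
  qed
  let ?P = "{z. \<exists>i. z = \<langle>i, p i\<rangle>}"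
  have P: "?P \<in> Sets M" unfolding p_def by (rule comprehension) (intro def_intros fdef_comp1[OF fS])
  have memP: "\<langle>i, w\<rangle> \<in> ?P \<longleftrightarrow> w = p i" for i w by auto
  have tr: "\<langle>p i, p (i \<oplus> \<one>)\<rangle> \<in> E \<and> \<langle>p i, p (i \<oplus> \<one>)\<rangle> \<notin> edges p i" for i
  proof -
    let ?k = "i \<oplus> \<one>"
    have lt: "i \<prec> N ?k" using N_ge[of ?k] by simp
    have "trail E (entry (S ?k)) (N ?k)" using good unfolding good_def by blast
    moreover have "trail E (entry (S ?k)) (N ?k) \<longleftrightarrow> trail E p (N ?k)" by (rule trail_cong) (rule p)
    ultimately show ?thesis using lt unfolding trail_def by blast
  qed
  have "infinite_path M V E ?P"
    unfolding infinite_path_def total_fun_def memP using P tr edge_in by blast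
  moreover have "\<exists>!i. uses_edge M ?P i u v" if uv: "\<langle>u, v\<rangle> \<in> E" for u v
  proof -
    have uses: "uses_edge M ?P i u v \<longleftrightarrow> \<langle>u, v\<rangle> = \<langle>p i, p (i \<oplus> \<one>)\<rangle> \<or> \<langle>u, v\<rangle> = \<langle>p (i \<oplus> \<one>), p i\<rangle>" for i
      unfolding uses_edge_def memP pair_eq by blast
    \<comment> \<open>The edge with code \<open>k\<close> is secured in passing from stage
      \<open>k\<close> to stage \<open>k + 1\<close>.\<close>
    let ?k = "\<langle>u, v\<rangle> \<oplus> \<one>"
    have "\<langle>u, v\<rangle> \<in> edges (entry (S ?k)) (N ?k)" by (rule step(3)[OF uv])
    moreover have "edges (entry (S ?k)) (N ?k) = edges p (N ?k)" by (rule edges_cong) (rule p)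
    ultimately have ex: "\<exists>i. uses_edge M ?P i u v" unfolding uses edges_def by blast
    have nlt: "\<not> i \<prec> j" if "uses_edge M ?P i u v" "uses_edge M ?P j u v" for i j
    proof
      assume "i \<prec> j"
      then have "\<langle>u, v\<rangle> \<in> edges p j" "\<langle>v, u\<rangle> \<in> edges p j"
        using \<open>uses_edge M ?P i u v\<close> unfolding uses edges_def by auto
      then show False using \<open>uses_edge M ?P j u v\<close> tr[of j] unfolding uses by auto
    qed
    obtain i where i: "uses_edge M ?P i u v" using ex ..
    show ?thesis
    proof (rule ex1I, rule i)
      show "j = i" if j: "uses_edge M ?P j u v" for j
        using nlt[OF i j] nlt[OF j i] lt_total[of i j] by (elim disjE) simp_all
    qed
  qed
  ultimately show ?thesis using P unfolding Euler_path_def by blast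
qed

end

section \<open>Pre-Eulerian graphs satisfy the assumptions of the construction\<close>

context aca
begin

lemma conn_closed:
  assumes "conn K x y" "V \<in> Sets M" "x \<in> V" "\<And>u v. \<langle>u, v\<rangle> \<in> K \<Longrightarrow> v \<in> V"
  shows "y \<in> V"
  by (rule conn_induct[OF assms(1), of "\<lambda>y. y \<in> V"]) (intro def_intros assms, use assms(3,4) in blast)+

lemma Euler_path_if_pre_Eulerian:
  assumes pe: "pre_Eulerian M V E"
  shows "\<exists>P\<in>Sets M. Euler_path M V E P"
proof -
  have V: "V \<in> Sets M" and E: "E \<in> Sets M" and pairs: "\<And>x. x \<in> E \<Longrightarrow> \<exists>u v. x = \<langle>u, v\<rangle>"
    and edge: "\<And>u v. \<langle>u, v\<rangle> \<in> E \<Longrightarrow> u \<in> V \<and> v \<in> V \<and> u \<noteq> v \<and> \<langle>v, u\<rangle> \<in> E"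
    using pe unfolding pre_Eulerian_def graph_def by blast+
  have sE: "symm E" unfolding symm_def using pairs edge by blast
  have con: "conn E u v" if "u \<in> V" "v \<in> V" for u v
    using pe that joined_iff_conn unfolding pre_Eulerian_def connected_graph_def by blast
  have nbrs: "nbrs M V E v = nb E v" for v unfolding nbrs_def nb_def using edge by blast
  have odd: "odd_degree M V E v \<longleftrightarrow> oddset (nb E v)" for v unfolding odd_degree_def nbrs oddset_iff ..
  have odd_unique: "u = v" if "u \<in> V" "v \<in> V" "oddset (nb E u)" "oddset (nb E v)" for u v
    using pe that unfolding pre_Eulerian_def odd by blast
  have inV: "x \<in> V" if "oddset (nb E x)" for x
    using oddset_ne[OF that] edge unfolding nb_def by blast
  have "\<exists>v0\<in>V. (\<forall>x\<in>V. oddset (nb E x) \<longrightarrow> x = v0) \<and> (oddset (nb E v0) \<or> \<not> coded (nb E v0))"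
  proof (cases "\<exists>v\<in>V. oddset (nb E v)")
    case True
    then show ?thesis using odd_unique by blast
  next
    case False
    then obtain v where "v \<in> V" "infinite_degree M V E v" using pe unfolding pre_Eulerian_def odd by blast
    moreover from this(2) have "\<not> coded (nb E v)"
      unfolding infinite_degree_def nbrs finite_in_def coded_iff by blast
    ultimately show ?thesis using False by blast
  qed
  then obtain v0 where v0: "v0 \<in> V" "\<And>x. x \<in> V \<Longrightarrow> oddset (nb E x) \<Longrightarrow> x = v0"
    "oddset (nb E v0) \<or> \<not> coded (nb E v0)" by blast
  interpret Euler M V E v0
  proof
    show "E \<in> Sets M" "V \<in> Sets M" "symm E" "v0 \<in> V" by fact+
    show "\<langle>x, x\<rangle> \<notin> E" for x using edge by blast
    show "x \<in> V" if "\<langle>x, y\<rangle> \<in> E" for x y using edge that by blast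
    show "conn E v0 x" if "x \<in> V" for x using con v0(1) that by blast
    show "oddset (nb E x) \<longleftrightarrow> x = v0" if "coded (nb E x)" for x
      using that v0 inV by blast
    fix s n
    \<comment> \<open>\<open>s\<close> is an arbitrary coded sequence and need not run inside
      \<open>E\<close>, so the intersection with \<open>E\<close> is needed to obtain a subgraph.
      Codes dominate their components, so the vertices below \<open>b\<close> include all endpoints
      of its edges.\<close>
    let ?F = "edges (entry s) n \<inter> E" and ?K = "E - edges (entry s) n"
    obtain b where b: "\<And>x. x \<in> edges (entry s) n \<Longrightarrow> x \<prec> b" using edges_bounded by blast
    let ?V = "{u. u \<in> V \<and> u \<prec> b}"
    have "?V \<in> Sets M" by (rule comprehension) (intro def_intros V)
    moreover have "{x. x \<in> edges (entry s) n \<and> x \<in> E} \<in> Sets M"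
      by (rule comprehension) (intro def_intros E edges_Sets)
    then have F: "?F \<in> Sets M" by (simp add: Int_def)
    moreover have "u \<prec> b" "v \<prec> b" "\<langle>v, u\<rangle> \<in> ?F" if uv: "\<langle>u, v\<rangle> \<in> ?F" for u v
    proof -
      have "\<langle>u, v\<rangle> \<prec> b" using b uv by blast
      then show "u \<prec> b" "v \<prec> b" using le_pair(1)[of u v] le_pair(2)[of v u] by order+
      show "\<langle>v, u\<rangle> \<in> ?F" using uv symmD[OF symm_edges] edge by blast
    qed
    ultimately have "finite_subgraph M ?V ?F V E"
      unfolding finite_subgraph_def graph_def finite_in_def using pairs edge b by blast
    then have "one_infinite_component M V (E - ?F)"
      using pe \<open>?V \<in> Sets M\<close> F unfolding pre_Eulerian_def by blast
    moreover have "E - ?F = ?K" by blast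
    ultimately have "one_infinite_component M V ?K" by simp
    then obtain z where z: "z \<in> V" "\<not> finite_in M (component M V ?K z)"
      "\<forall>w\<in>V. \<not> finite_in M (component M V ?K w) \<longrightarrow> component M V ?K w = component M V ?K z"
      unfolding one_infinite_component_def by (elim bexE conjE) (rule that)
    have comp: "component M V ?K v = {u. conn ?K v u}" if v: "v \<in> V" for v
    proof -
      have "u \<in> V" if "conn ?K v u" for u by (rule conn_closed[OF that V v]) (use edge in blast)
      then show ?thesis using v unfolding component_def joined_iff_conn[of V] by blast
    qed
    have unb: "\<not> finite_in M (component M V ?K v) \<longleftrightarrow> (\<forall>b. \<exists>u. conn ?K v u \<and> \<not> u \<prec> b)" if "v \<in> V" for v
      unfolding comp[OF that] finite_in_def by blast
    have "conn ?K z w" if w: "w \<in> V" "\<forall>b. \<exists>u. conn ?K w u \<and> \<not> u \<prec> b" for w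
    proof -
      have "component M V ?K w = component M V ?K z" using z(3) w unb[OF w(1)] by blast
      then show ?thesis using comp[OF w(1)] comp[OF z(1)] conn_refl[of ?K w] by blast
    qed
    then show "\<exists>z\<in>V. (\<forall>b. \<exists>u. conn ?K z u \<and> \<not> u \<prec> b) \<and>
        (\<forall>w\<in>V. (\<forall>b. \<exists>u. conn ?K w u \<and> \<not> u \<prec> b) \<longrightarrow> conn ?K z w)"
      using z(1) z(2)[unfolded unb[OF z(1)]] by blast
  qed
  show ?thesis by (rule Euler_path_exists)
qed

end

theorem theorem19:
  fixes M :: "'a L2"
  assumes "L2_structure M" and "RCA0 M"
  shows "(ACA0 M \<longleftrightarrow> pre_Eulerian_thm M) \<and>
         (pre_Eulerian_thm M \<longleftrightarrow> locally_finite_pre_Eulerian_thm M)"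
proof -
  interpret rca M
    using assms unfolding L2_structure_def by unfold_locales
  have "pre_Eulerian_thm M" if "ACA0 M"
  proof -
    interpret aca M
      using that ACA0_iff_projective by unfold_locales blast
    show ?thesis unfolding pre_Eulerian_thm_def using Euler_path_if_pre_Eulerian by blast
  qed
  moreover have "locally_finite_pre_Eulerian_thm M" if "pre_Eulerian_thm M"
    using that unfolding pre_Eulerian_thm_def locally_finite_pre_Eulerian_thm_def by blast
  moreover have "ACA0 M" if "locally_finite_pre_Eulerian_thm M"
    using projective_if_Euler_paths[OF that] ACA0_iff_projective by blast
  ultimately show ?thesis by blast
qed

end
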